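(* Let $s:[0,1]\to[0,1]$ be a continuous map for which there is a set $\{0=\hat x_0<\cdots<\hat x_N=1\}$ such that for every $i=0,\ldots,N$, $s(\hat x_i)=\hat x_j$ for some $0\le j\le N$, and $s$ is monotone on $[\hat x_{i-1},\hat x_i]$ for $i=1,\ldots,N$. Let $s^*$ be its index map and $A^*$ the associated $N\times N$ zero-one matrix, and suppose that $\sum_{i=1}^N A^*_{i,j}>1$ for every $j$. Let $\{a_{i,j}\}$ be any admissible family of slopes satisfying $\sum_{i=1}^N A_{i,j}=1$ for every $j$. (1) If $A^*$ is irreducible, then there exists a unique map $t$ associated with $(s^*,\{a_{i,j}\})$ such that $t$ is expanding Markov, $t\in PA(\lambda)$, and $t$ and $s$ are topologically conjugate if $s$ is a linear or expanding Markov map. (2) If $A^*$ can be decomposed into multiple irreducible subsets, then infinitely many such $t$ exist. (3) If $A^*$ can be decomposed into multiple subsets, at least one of which is transient, then no such $t$ exists.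
   Context: $\lambda$ is Lebesgue measure on $[0,1]$. $PA(\lambda)$ is the set of continuous piecewise affine maps $h:[0,1]\to[0,1]$ with $\lambda(h^{-1}(A))=\lambda(A)$ for every Borel set $A\subseteq[0,1]$. Continuous maps $s_1,s_2:[0,1]\to[0,1]$ are topologically conjugate if $s_2=h\circ s_1\circ h^{-1}$ for some homeomorphism $h$ of $[0,1]$. A continuous map $s$ is linear Markov if it is piecewise affine and the set of all $s^k(x)$, with $k\ge0$ and $x$ an endpoint of an affine piece, is finite. It is expanding Markov if it is piecewise monotone, the set of all $s^k(x)$, with $k\ge0$ and $x$ an endpoint of a monotone piece, is finite, and there is a constant $c>1$ with $|s(x)-s(y)|\ge c|x-y|$ whenever $x,y$ lie in the same monotone piece. Index map: $s^*:\{0,\ldots,N\}\to\{0,\ldots,N\}$, $s^*(i)=j$ if $s(\hat x_i)=\hat x_j$. Matrix $A^*$ ($N\times N$): $A^*_{i,j}=1$ if $\min(s^*(i-1),s^*(i))<j\le\max(s^*(i-1),s^*(i))$, and $A^*_{i,j}=0$ otherwise. Admissible family of slopes: real numbers $a_{i,j}\neq0$, for the pairs $(i,j)$ with $A^*_{i,j}=1$, with $a_{i,j}>0$ if $s^*(i-1)<s^*(i)$ and $a_{i,j}<0$ otherwise. The associated non-negative matrix is $A_{i,j}=|a_{i,j}|^{-1}$ if $A^*_{i,j}=1$, and $A_{i,j}=0$ otherwise. A map $t$ is associated with $(s^*,\{a_{i,j}\})$ if $t:[0,1]\to[0,1]$ is continuous and there is a partition $0=x_0<x_1<\cdots<x_N=1$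 with $\mathcal{I}_i=[x_{i-1},x_i]$ such that $t(x_i)=x_{s^*(i)}$ for all $i$, $t$ is monotone on each $\mathcal{I}_i$, and $t$ is affine with slope $a_{i,j}$ on $\mathcal{I}_i\cap t^{-1}(\mathcal{I}_j)$ whenever $A^*_{i,j}=1$. Decomposition of $A^*$: consider the directed graph on nodes $1,\ldots,N$ with an arc from $j$ to $i$ iff $A^*_{i,j}=1$. Node $i$ is reachable from $j$ if $((A^* )^k)_{i,j}>0$ for some $k\ge1$; two nodes communicate if each is reachable from the other. The nodes decompose uniquely into $K$ disjoint subsets (communicating classes) such that nodes in the same subset communicate and nodes in different subsets do not. The column stochastic matrix $A$ defines a Markov chain, $A_{i,j}$ being the transition probability from $j$ to $i$. A node is recurrent if the probability of ever returning to it, starting from it, is $1$, and transient otherwise; all nodes of a subset are of the same type, and the subset is called recurrent or transient accordingly. $A^*$ is irreducible if $K=1$ (every node is reachable from every other node). $A^*$ can be decomposed into multiple irreducible subsets if $K>1$ and every subset is recurrent.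
   Formalization: For linear Markov s, the conjugacy claim additionally requires s to be affine on each interval [x̂_{i-1}, x̂_i] of the given set (its break points are among the x̂_i); without this the claim is false. *)

theory Defs
  imports "HOL-Probability.Probability"
begin

text \<open>
  A map from \<open>[0,1]\<close> to itself is represented by a real function that is \<open>undefined\<close> off
  \<open>[0,1]\<close>. Hence equality of functions is equality of maps, which matters for uniqueness and
  for counting maps.
\<close>

definition cont_interval_map :: "(real \<Rightarrow> real) \<Rightarrow> bool" where
  "cont_interval_map f \<longleftrightarrow> f \<in> {0..1} \<rightarrow>\<^sub>E {0..1} \<and> continuous_on {0..1} f"

definition interval_partition :: "nat \<Rightarrow> (nat \<Rightarrow> real) \<Rightarrow> bool" where
  "interval_partition n x \<longleftrightarrow> x 0 = 0 \<and> x n = 1 \<and> (\<forall>i<n. x i < x (Suc i))"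

definition piece :: "(nat \<Rightarrow> real) \<Rightarrow> nat \<Rightarrow> real set" where
  "piece x i = {x (i - 1)..x i}"

definition monotone_map_on :: "real set \<Rightarrow> (real \<Rightarrow> real) \<Rightarrow> bool" where
  "monotone_map_on S f \<longleftrightarrow> mono_on S f \<or> antimono_on S f"

definition affine_with_slope_on :: "real \<Rightarrow> real set \<Rightarrow> (real \<Rightarrow> real) \<Rightarrow> bool" where
  "affine_with_slope_on m S f \<longleftrightarrow> (\<exists>b. \<forall>y\<in>S. f y = m * y + b)"

definition piecewise_affine_wrt :: "nat \<Rightarrow> (nat \<Rightarrow> real) \<Rightarrow> (real \<Rightarrow> real) \<Rightarrow> bool" where
  "piecewise_affine_wrt n x f \<longleftrightarrow>
     interval_partition n x \<and> (\<forall>i\<in>{1..n}. \<exists>m. affine_with_slope_on m (piece x i) f)"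

definition piecewise_monotone_wrt :: "nat \<Rightarrow> (nat \<Rightarrow> real) \<Rightarrow> (real \<Rightarrow> real) \<Rightarrow> bool" where
  "piecewise_monotone_wrt n x f \<longleftrightarrow>
     interval_partition n x \<and> (\<forall>i\<in>{1..n}. monotone_map_on (piece x i) f)"

definition endpoint_orbits :: "nat \<Rightarrow> (nat \<Rightarrow> real) \<Rightarrow> (real \<Rightarrow> real) \<Rightarrow> real set" where
  "endpoint_orbits n x f = {(f ^^ k) (x i) | k i. i \<le> n}"

definition PA_lambda :: "(real \<Rightarrow> real) set" where
  "PA_lambda = {h. cont_interval_map h \<and> (\<exists>n x. piecewise_affine_wrt n x h) \<and>
     (\<forall>A\<in>sets borel. A \<subseteq> {0..1} \<longrightarrow> emeasure lborel (h -` A \<inter> {0..1}) = emeasure lborel A)}"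

definition topologically_conjugate :: "(real \<Rightarrow> real) \<Rightarrow> (real \<Rightarrow> real) \<Rightarrow> bool" where
  "topologically_conjugate f g \<longleftrightarrow>
     (\<exists>h h'. homeomorphism {0..1} {0..1} h h' \<and> (\<forall>y\<in>{0..1}. g y = h (f (h' y))))"

text \<open>
  The partition in \<open>linear_Markov\<close> and \<open>expanding_Markov\<close> may be finer than the one into maximal pieces; this
  does not change the notions.
\<close>

definition linear_Markov :: "(real \<Rightarrow> real) \<Rightarrow> bool" where
  "linear_Markov f \<longleftrightarrow> cont_interval_map f \<and>
     (\<exists>n x. piecewise_affine_wrt n x f \<and> finite (endpoint_orbits n x f))"

definition expanding_Markov :: "(real \<Rightarrow> real) \<Rightarrow> bool" where
  "expanding_Markov f \<longleftrightarrow> cont_interval_map f \<and>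
     (\<exists>n x. piecewise_monotone_wrt n x f \<and> finite (endpoint_orbits n x f) \<and>
       (\<exists>c>1. \<forall>i\<in>{1..n}. \<forall>y\<in>piece x i. \<forall>z\<in>piece x i. \<bar>f y - f z\<bar> \<ge> c * \<bar>y - z\<bar>))"

text \<open>
  A linear Markov map can have an invariant partition with monotone pieces that omits some of its
  break points, and such a partition does not determine the conjugacy class. For instance, let
  \<open>s\<close> be the identity on \<open>[0,1/8]\<close>, affine from \<open>[1/8,1/2]\<close> onto \<open>[1/8,1]\<close> and increasing, and
  affine from \<open>[1/2,1]\<close> onto \<open>[0,1]\<close> and decreasing. It is linear Markov and has the same index
  map with respect to \<open>{0,1/2,1}\<close> as the tent map, but is not conjugate to it. A linear Markov
  map is therefore required to be affine on the pieces of the given partition.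
\<close>

definition linear_Markov_with_partition :: "nat \<Rightarrow> (nat \<Rightarrow> real) \<Rightarrow> (real \<Rightarrow> real) \<Rightarrow> bool" where
  "linear_Markov_with_partition n x f \<longleftrightarrow> linear_Markov f \<and> piecewise_affine_wrt n x f"

text \<open>Matrices are functions of a row and a column index, both ranging over \<open>{1..N}\<close>.\<close>

definition index_map :: "nat \<Rightarrow> (nat \<Rightarrow> real) \<Rightarrow> (real \<Rightarrow> real) \<Rightarrow> nat \<Rightarrow> nat" where
  "index_map N x f i = (THE j. j \<le> N \<and> f (x i) = x j)"

definition A_star :: "(nat \<Rightarrow> nat) \<Rightarrow> nat \<Rightarrow> nat \<Rightarrow> nat" where
  "A_star \<sigma> i j =
     (if min (\<sigma> (i - 1)) (\<sigma> i) < j \<and> j \<le> max (\<sigma> (i - 1)) (\<sigma> i) then 1 else 0)"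

definition admissible_slopes :: "nat \<Rightarrow> (nat \<Rightarrow> nat) \<Rightarrow> (nat \<Rightarrow> nat \<Rightarrow> real) \<Rightarrow> bool" where
  "admissible_slopes N \<sigma> a \<longleftrightarrow>
     (\<forall>i\<in>{1..N}. \<forall>j\<in>{1..N}. A_star \<sigma> i j = 1 \<longrightarrow>
        (if \<sigma> (i - 1) < \<sigma> i then a i j > 0 else a i j < 0))"

definition A_mat :: "(nat \<Rightarrow> nat) \<Rightarrow> (nat \<Rightarrow> nat \<Rightarrow> real) \<Rightarrow> nat \<Rightarrow> nat \<Rightarrow> real" where
  "A_mat \<sigma> a i j = (if A_star \<sigma> i j = 1 then inverse \<bar>a i j\<bar> else 0)"

definition associated ::
  "nat \<Rightarrow> (nat \<Rightarrow> nat) \<Rightarrow> (nat \<Rightarrow> nat \<Rightarrow> real) \<Rightarrow> (real \<Rightarrow> real) \<Rightarrow> bool" where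
  "associated N \<sigma> a t \<longleftrightarrow> cont_interval_map t \<and>
     (\<exists>x. interval_partition N x \<and>
        (\<forall>i\<le>N. t (x i) = x (\<sigma> i)) \<and>
        (\<forall>i\<in>{1..N}. monotone_map_on (piece x i) t) \<and>
        (\<forall>i\<in>{1..N}. \<forall>j\<in>{1..N}. A_star \<sigma> i j = 1 \<longrightarrow>
           affine_with_slope_on (a i j) (piece x i \<inter> t -` piece x j) t))"

primrec mat_power :: "nat \<Rightarrow> (nat \<Rightarrow> nat \<Rightarrow> nat) \<Rightarrow> nat \<Rightarrow> nat \<Rightarrow> nat \<Rightarrow> nat" where
  "mat_power N B 0 = (\<lambda>i j. if i = j then 1 else 0)"
| "mat_power N B (Suc k) = (\<lambda>i j. \<Sum>l\<in>{1..N}. mat_power N B k i l * B l j)"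

definition reachable_from :: "nat \<Rightarrow> (nat \<Rightarrow> nat) \<Rightarrow> nat \<Rightarrow> nat \<Rightarrow> bool" where
  "reachable_from N \<sigma> i j \<longleftrightarrow> (\<exists>k\<ge>1. mat_power N (A_star \<sigma>) k i j > 0)"

definition communicate :: "nat \<Rightarrow> (nat \<Rightarrow> nat) \<Rightarrow> nat \<Rightarrow> nat \<Rightarrow> bool" where
  "communicate N \<sigma> i j \<longleftrightarrow> reachable_from N \<sigma> i j \<and> reachable_from N \<sigma> j i"

text \<open>A node that does not reach itself forms a class of its own.\<close>

definition communicating_classes :: "nat \<Rightarrow> (nat \<Rightarrow> nat) \<Rightarrow> nat set set" where
  "communicating_classes N \<sigma> =
     {1..N} // {(i, j) \<in> {1..N} \<times> {1..N}. i = j \<or> communicate N \<sigma> i j}"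

definition irreducible_A_star :: "nat \<Rightarrow> (nat \<Rightarrow> nat) \<Rightarrow> bool" where
  "irreducible_A_star N \<sigma> \<longleftrightarrow> card (communicating_classes N \<sigma>) = 1"

text \<open>
  For a column stochastic matrix \<open>P\<close>, \<open>chain_law N P j\<close> is the law, on the space of sequences of
  nodes, of the Markov chain started at \<open>j\<close> in which \<open>P k l\<close> is the transition probability from
  \<open>l\<close> to \<open>k\<close>; see the lemma \<open>chain_law_cylinder\<close>. It is the Ionescu-Tulcea limit of the
  kernels \<open>chain_kernel N P j n\<close>, which give the distribution of the state at time \<open>n\<close> when the
  states at earlier times are known.
\<close>

definition transition_pmf :: "nat \<Rightarrow> (nat \<Rightarrow> nat \<Rightarrow> real) \<Rightarrow> nat \<Rightarrow> nat pmf" where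
  "transition_pmf N P l = embed_pmf (\<lambda>k. if k \<in> {1..N} then P k l else 0)"

definition chain_kernel ::
  "nat \<Rightarrow> (nat \<Rightarrow> nat \<Rightarrow> real) \<Rightarrow> nat \<Rightarrow> nat \<Rightarrow> (nat \<Rightarrow> nat) \<Rightarrow> nat measure" where
  "chain_kernel N P j n \<omega> =
     measure_pmf (case n of 0 \<Rightarrow> return_pmf j | Suc m \<Rightarrow> transition_pmf N P (\<omega> m))"

definition chain_law :: "nat \<Rightarrow> (nat \<Rightarrow> nat \<Rightarrow> real) \<Rightarrow> nat \<Rightarrow> (nat \<Rightarrow> nat) measure" where
  "chain_law N P j =
     projective_family.lim UNIV
       (Ionescu_Tulcea.CI (chain_kernel N P j) (\<lambda>_. count_space UNIV))
       (\<lambda>_. count_space UNIV)"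

definition recurrent_node :: "nat \<Rightarrow> (nat \<Rightarrow> nat \<Rightarrow> real) \<Rightarrow> nat \<Rightarrow> bool" where
  "recurrent_node N P j \<longleftrightarrow> measure (chain_law N P j) {\<omega>. \<exists>n\<ge>1. \<omega> n = j} = 1"

definition transient_node :: "nat \<Rightarrow> (nat \<Rightarrow> nat \<Rightarrow> real) \<Rightarrow> nat \<Rightarrow> bool" where
  "transient_node N P j \<longleftrightarrow> \<not> recurrent_node N P j"

definition recurrent_class :: "nat \<Rightarrow> (nat \<Rightarrow> nat \<Rightarrow> real) \<Rightarrow> nat set \<Rightarrow> bool" where
  "recurrent_class N P C \<longleftrightarrow> (\<forall>j\<in>C. recurrent_node N P j)"

definition transient_class :: "nat \<Rightarrow> (nat \<Rightarrow> nat \<Rightarrow> real) \<Rightarrow> nat set \<Rightarrow> bool" where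
  "transient_class N P C \<longleftrightarrow> (\<forall>j\<in>C. transient_node N P j)"

lemma Ionescu_Tulcea_chain_kernel:
  "Ionescu_Tulcea (chain_kernel N P j) (\<lambda>_. count_space UNIV)"
proof (rule Ionescu_Tulcea.intro)
  show "prob_space (chain_kernel N P j n \<omega>)"
    if "\<omega> \<in> space (PiM {0..<n} (\<lambda>_. count_space UNIV))" for n \<omega>
    unfolding chain_kernel_def by (rule prob_space_measure_pmf)
  show "chain_kernel N P j n \<in> measurable (PiM {0..<n} (\<lambda>_. count_space UNIV))
          (subprob_algebra (count_space UNIV))" for n
  proof (cases n)
    case 0
    then show ?thesis
      by (simp add: chain_kernel_def[abs_def] measure_pmf_in_subprob_space)
  next
    case (Suc m)
    have "(\<lambda>\<omega>. \<omega> m) \<in> measurable (PiM {0..<n} (\<lambda>_. count_space UNIV)) (count_space UNIV)"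
      using Suc by (intro measurable_component_singleton) auto
    then have "(\<lambda>\<omega>. measure_pmf (transition_pmf N P (\<omega> m)))
        \<in> measurable (PiM {0..<n} (\<lambda>_. count_space UNIV)) (subprob_algebra (count_space UNIV))"
      by (rule measurable_compose) (simp add: measure_pmf_in_subprob_space)
    then show ?thesis
      using Suc by (simp add: chain_kernel_def[abs_def])
  qed
qed

lemma chain_law_cylinder_kernel:
  "emeasure (chain_law N P j) {\<omega>. \<forall>m<n. \<omega> m = p m} =
     (\<Prod>m<n. emeasure (chain_kernel N P j m p) {p m})"
proof -
  let ?S = "\<lambda>_::nat. count_space (UNIV :: nat set)"
  interpret IT: Ionescu_Tulcea "chain_kernel N P j" ?S
    by (rule Ionescu_Tulcea_chain_kernel)
  define X where "X n = {restrict p {0..<n}}" for n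
  have X_eq: "X n = (\<Pi>\<^sub>E m\<in>{0..<n}. {p m})" for n
    unfolding X_def by (auto simp: PiE_iff extensional_def fun_eq_iff)
  have X_sets [measurable]: "X n \<in> sets (PiM {0..<n} ?S)" for n
    unfolding X_eq by (intro sets_PiM_I_finite) auto
  have C: "emeasure (IT.C 0 n (\<lambda>_. undefined)) (X n) =
      (\<Prod>m<n. emeasure (chain_kernel N P j m p) {p m})" for n
  proof (induction n)
    case 0
    show ?case
      using X_sets[of 0] by (simp add: X_def restrict_def)
  next
    case (Suc n)
    let ?u = "\<lambda>_::nat. undefined :: nat"
    let ?c = "emeasure (chain_kernel N P j n p) {p n}"
    have u: "?u \<in> space (PiM {0..<0} ?S)"
      by (simp add: space_PiM)
    have spC: "space (IT.C 0 n ?u) = space (PiM {0..<n} ?S)"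
      using IT.space_C[OF u, of n] by simp
    have seC: "sets (IT.C 0 n ?u) = sets (PiM {0..<n} ?S)"
      using IT.sets_C[OF u, of n] by simp
    have kern: "emeasure (IT.eP n \<omega>) (X (Suc n)) = ?c * indicator (X n) \<omega>"
      if "\<omega> \<in> space (PiM {0..<n} ?S)" for \<omega>
    proof -
      have ext: "\<omega> \<in> extensional {0..<n}"
        using that by (simp add: space_PiM PiE_iff)
      have upd: "fun_upd \<omega> n y \<in> X (Suc n) \<longleftrightarrow> \<omega> \<in> X n \<and> y = p n" for y
        using ext unfolding X_def
        by (auto simp: fun_eq_iff extensional_def restrict_def)
      have "emeasure (IT.eP n \<omega>) (X (Suc n)) =
          emeasure (chain_kernel N P j n \<omega>) ((\<lambda>y. fun_upd \<omega> n y) -` X (Suc n) \<inter> space (?S n))"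
        by (rule IT.emeasure_eP[OF that X_sets])
      also have "(\<lambda>y. fun_upd \<omega> n y) -` X (Suc n) \<inter> space (?S n) =
          (if \<omega> \<in> X n then {p n} else {})"
        using upd by auto
      also have "emeasure (chain_kernel N P j n \<omega>) \<dots> = ?c * indicator (X n) \<omega>"
      proof (cases "\<omega> \<in> X n")
        case True
        then have "chain_kernel N P j n \<omega> = chain_kernel N P j n p"
          by (auto simp: X_def chain_kernel_def split: nat.split)
        with True show ?thesis by simp
      qed simp
      finally show ?thesis .
    qed
    have "emeasure (IT.C 0 (Suc n) ?u) (X (Suc n)) =
        (\<integral>\<^sup>+\<omega>. emeasure (IT.eP n \<omega>) (X (Suc n)) \<partial>IT.C 0 n ?u)"
      using IT.measurable_eP[of n] X_sets[of "Suc n"]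
      by (simp, subst emeasure_bind[where N = "PiM {0..<Suc n} ?S"])
         (auto simp: spC measurable_cong_sets[OF seC refl])
    also have "\<dots> = (\<integral>\<^sup>+\<omega>. ?c * indicator (X n) \<omega> \<partial>IT.C 0 n ?u)"
      by (intro nn_integral_cong kern) (simp add: spC)
    also have "\<dots> = ?c * emeasure (IT.C 0 n ?u) (X n)"
      using X_sets[of n] by (intro nn_integral_cmult_indicator) (simp add: seC)
    finally show ?case
      using Suc.IH by (simp add: mult.commute)
  qed
  have emb: "prod_emb UNIV ?S {0..<n} (X n) = {\<omega>. \<forall>m<n. \<omega> m = p m}"
  proof -
    have "restrict \<omega> {0..<n} = restrict p {0..<n} \<longleftrightarrow> (\<forall>m<n. \<omega> m = p m)" for \<omega>
      by (metis atLeastLessThan_iff le0 restrict_apply' restrict_ext)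
    then show ?thesis
      unfolding X_def by (auto simp: prod_emb_def space_PiM)
  qed
  have "emeasure (chain_law N P j) {\<omega>. \<forall>m<n. \<omega> m = p m} = emeasure (IT.CI {0..<n}) (X n)"
    unfolding chain_law_def emb[symmetric] by (rule IT.lim) auto
  also have "\<dots> = emeasure (IT.C 0 n (\<lambda>_. undefined)) (prod_emb {0..<n} ?S {0..<n} (X n))"
    by (rule IT.emeasure_CI) auto
  also have "prod_emb {0..<n} ?S {0..<n} (X n) = X n"
    using sets.sets_into_space[OF X_sets] by (intro prod_emb_id) (auto simp: space_PiM)
  finally show ?thesis
    using C by simp
qed

lemma pmf_transition:
  assumes "\<And>k. k \<in> {1..N} \<Longrightarrow> 0 \<le> P k l" and "(\<Sum>k\<in>{1..N}. P k l) = 1" and "k \<in> {1..N}"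
  shows "pmf (transition_pmf N P l) k = P k l"
proof -
  let ?f = "\<lambda>k. if k \<in> {1..N} then P k l else 0"
  have "(\<integral>\<^sup>+k. ennreal (?f k) \<partial>count_space UNIV) = (\<Sum>k\<in>{1..N}. ennreal (?f k))"
    by (rule nn_integral_count_space') auto
  also have "\<dots> = ennreal (\<Sum>k\<in>{1..N}. ?f k)"
    using assms(1) by (intro sum_ennreal) auto
  also have "\<dots> = 1"
    using assms(2) by simp
  finally have "pmf (embed_pmf ?f) k = ?f k"
    using assms(1) by (intro pmf_embed_pmf) auto
  then show ?thesis
    using assms(3) by (simp add: transition_pmf_def)
qed

lemma chain_law_cylinder:
  assumes nonneg: "\<And>k l. k \<in> {1..N} \<Longrightarrow> l \<in> {1..N} \<Longrightarrow> 0 \<le> P k l"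
    and stochastic: "\<And>l. l \<in> {1..N} \<Longrightarrow> (\<Sum>k\<in>{1..N}. P k l) = 1"
    and p: "p ` {..n} \<subseteq> {1..N}"
  shows "measure (chain_law N P j) {\<omega>. \<forall>m\<le>n. \<omega> m = p m} =
           (if p 0 = j then \<Prod>m<n. P (p (Suc m)) (p m) else 0)"
proof -
  have zero: "emeasure (chain_kernel N P j 0 p) {p 0} = (if p 0 = j then 1 else 0)"
    by (simp add: chain_kernel_def indicator_def)
  have step: "emeasure (chain_kernel N P j (Suc m) p) {p (Suc m)} = ennreal (P (p (Suc m)) (p m))"
    if "m < n" for m
  proof -
    have "p m \<in> {1..N}" "p (Suc m) \<in> {1..N}"
      using p that by (auto simp: image_subset_iff)
    then have "pmf (transition_pmf N P (p m)) (p (Suc m)) = P (p (Suc m)) (p m)"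
      by (intro pmf_transition nonneg stochastic)
    then show ?thesis
      by (simp add: chain_kernel_def emeasure_pmf_single)
  qed
  have "{\<omega>. \<forall>m\<le>n. \<omega> m = p m} = {\<omega>. \<forall>m<Suc n. \<omega> m = p m}"
    by (simp add: less_Suc_eq_le)
  then have "emeasure (chain_law N P j) {\<omega>. \<forall>m\<le>n. \<omega> m = p m} =
      (\<Prod>m<Suc n. emeasure (chain_kernel N P j m p) {p m})"
    using chain_law_cylinder_kernel[of N P j "Suc n" p] by simp
  also have "\<dots> = (if p 0 = j then 1 else 0) * (\<Prod>m<n. ennreal (P (p (Suc m)) (p m)))"
    using step by (simp add: prod.lessThan_Suc_shift zero del: prod.lessThan_Suc)
  also have "(\<Prod>m<n. ennreal (P (p (Suc m)) (p m))) = ennreal (\<Prod>m<n. P (p (Suc m)) (p m))"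
    using p by (intro prod_ennreal nonneg) (auto simp: image_subset_iff)
  finally show ?thesis
    using p
    by (auto simp: measure_def image_subset_iff intro!: prod_nonneg nonneg enn2real_ennreal)
qed

end

theory Submission
  imports Defs
begin

text \<open>
  If \<open>t\<close> is associated with a partition \<open>x\<close>, then the vector of lengths \<open>x i - x (i - 1)\<close> is fixed by
  the column stochastic matrix \<open>A\<close>: the piece \<open>i\<close> consists of the preimages of those pieces \<open>k\<close> that
  it is mapped onto, and these preimages have lengths \<open>A i k * (x k - x (k - 1))\<close>. Conversely every
  positive fixed vector of total mass one is the vector of lengths of exactly one associated map.
  So the theorem is about positive stationary distributions of the Markov chain. There is one if
  \<open>A\<close> is irreducible, the convex combinations of those of the classes if all classes
  are recurrent, and none if there is a transient node. All entries of \<open>A\<close> are less than one since no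
  column has a single positive entry; hence associated maps expand, and they preserve Lebesgue
  measure since the columns of \<open>A\<close> sum up to one. A monotone semiconjugacy from \<open>s\<close> to \<open>t\<close> is the limit
  of \<open>h \<mapsto> (inverse branches of t) \<circ> h \<circ> s\<close>. An interval on which it is constant would
  grow without bound under iteration of \<open>s\<close>, so it is a conjugacy.
\<close>

section \<open>Stationary vectors and recurrence\<close>

text \<open>Two obstacles lie outside this correspondence. In \<open>associated\<close> the
  partition is hidden by an existential quantifier, so different stationary vectors might belong to
  the same map. The infinite count therefore needs that a map determines its partition, which
  follows from its turning points and its expansion. Secondly, recurrence concerns infinite paths,
  whereas stationarity is linear algebra. The bridge is the probability of avoiding a node for
  \<open>m\<close> steps, which obeys a linear recursion: a positive stationary vector makes these
  probabilities summable, and conversely their convergence to zero forces every node reachable from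
  a recurrent one to lead back to it. The growth arguments share one pattern, which replaces the
  iteration of a map: a bounded set of positive numbers is empty if each element \<open>q\<close> is
  followed by an element of size at least \<open>c * q\<close>, with a fixed
  \<open>c > 1\<close>.\<close>

definition arcs :: "nat \<Rightarrow> (nat \<Rightarrow> nat) \<Rightarrow> (nat \<times> nat) set" where
  "arcs N \<sigma> = {(j, i) \<in> {1..N} \<times> {1..N}. A_star \<sigma> i j = 1}"

text \<open>An entry of a product of nonnegative matrices is positive where the underlying relations
  compose. Arcs run from column to row, hence the swapped indices.\<close>

lemma mat_power_pos_iff:
  assumes "i \<in> {1..N}" "j \<in> {1..N}"
  shows "mat_power N (A_star \<sigma>) k i j > 0 \<longleftrightarrow> (j, i) \<in> arcs N \<sigma> ^^ k"
  using assms(2)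
proof (induction k arbitrary: j)
  case 0
  then show ?case by auto
next
  case (Suc k)
  have "A_star \<sigma> l j > 0 \<longleftrightarrow> A_star \<sigma> l j = 1" for l
    by (simp add: A_star_def)
  then have "mat_power N (A_star \<sigma>) (Suc k) i j > 0 \<longleftrightarrow>
      (\<exists>l\<in>{1..N}. mat_power N (A_star \<sigma>) k i l > 0 \<and> A_star \<sigma> l j = 1)"
    by (simp add: zero_less_iff_neq_zero del: neq0_conv One_nat_def)
  also have "\<dots> \<longleftrightarrow> (\<exists>l\<in>{1..N}. (l, i) \<in> arcs N \<sigma> ^^ k \<and> A_star \<sigma> l j = 1)"
    using Suc.IH by blast
  also have "\<dots> \<longleftrightarrow> (\<exists>l. (j, l) \<in> arcs N \<sigma> \<and> (l, i) \<in> arcs N \<sigma> ^^ k)"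
    using Suc.prems by (auto simp: arcs_def)
  also have "\<dots> \<longleftrightarrow> (j, i) \<in> arcs N \<sigma> ^^ Suc k"
    by (metis relpow_Suc_D2 relpow_Suc_I2)
  finally show ?case .
qed

lemma reachable_iff_trancl:
  assumes "i \<in> {1..N}" "j \<in> {1..N}"
  shows "reachable_from N \<sigma> i j \<longleftrightarrow> (j, i) \<in> (arcs N \<sigma>)\<^sup>+"
  unfolding reachable_from_def mat_power_pos_iff[OF assms] trancl_power
  by (metis One_nat_def less_eq_Suc_le)

lemma communicating_classes_iff:
  "communicating_classes N \<sigma> =
     (\<lambda>i. insert i {j \<in> {1..N}. (i, j) \<in> (arcs N \<sigma>)\<^sup>+ \<and> (j, i) \<in> (arcs N \<sigma>)\<^sup>+}) ` {1..N}"
  unfolding communicating_classes_def quotient_def communicate_def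
  by (auto simp: reachable_iff_trancl Image_def)

text \<open>
  By induction on the number of states: the matrix \<open>Q\<close> of the chain that is watched only while it
  is not in the state \<open>n\<close> is stochastic again.
\<close>

lemma stationary_vector_exists:
  fixes P :: "'a \<Rightarrow> 'a \<Rightarrow> real"
  assumes "finite S" "S \<noteq> {}"
    and "\<And>i j. i \<in> S \<Longrightarrow> j \<in> S \<Longrightarrow> 0 \<le> P i j"
    and "\<And>j. j \<in> S \<Longrightarrow> (\<Sum>i\<in>S. P i j) = 1"
  shows "\<exists>v. (\<forall>i\<in>S. 0 \<le> v i \<and> v i = (\<Sum>j\<in>S. P i j * v j)) \<and> sum v S = 1"
  using assms
proof (induction S arbitrary: P rule: finite_ne_induct)
  case (singleton x)
  then show ?case by (intro exI[of _ "\<lambda>_. 1"]) auto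
next
  case (insert n S)
  have nonneg: "0 \<le> P i j" if "i \<in> insert n S" "j \<in> insert n S" for i j
    using insert.prems(1) that by blast
  have col: "P n j + (\<Sum>i\<in>S. P i j) = 1" if "j \<in> insert n S" for j
    using insert.prems(2)[OF that] insert.hyps by simp
  show ?case
  proof (cases "P n n = 1")
    case True
    \<comment> \<open>In this case \<open>n\<close> is absorbing, and the point mass at
      \<open>n\<close> is stationary.\<close>
    have z: "P i n = 0" if "i \<in> S" for i
    proof -
      have "(\<Sum>i\<in>S. P i n) = 0"
        using col[of n] True by simp
      then show ?thesis
        using that nonneg insert.hyps(1) sum_nonneg_eq_0_iff[of S "\<lambda>i. P i n"] by auto
    qed
    have ne: "i \<noteq> n" if "i \<in> S" for i
      using that insert.hyps by auto
    show ?thesis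
      using insert.hyps True z ne
      by (intro exI[of _ "\<lambda>i. if i = n then 1 else 0"])
         (auto simp: if_distrib[of "\<lambda>x. _ * x"] sum.delta cong: if_cong)
  next
    case False
    define q where "q = 1 - P n n"
    have qs: "q = (\<Sum>i\<in>S. P i n)"
      using col[of n] by (simp add: q_def)
    have "0 \<le> q"
      unfolding qs using nonneg by (intro sum_nonneg) auto
    with False have q: "q > 0" by (simp add: q_def)
    \<comment> \<open>The second term accounts for a passage through \<open>n\<close>:
      \<open>P i n / q\<close> is the probability that the chain moves to \<open>i\<close> when it
      finally leaves \<open>n\<close>.\<close>
    define Q where "Q i j = P i j + P i n * P n j / q" for i j
    have "(\<Sum>i\<in>S. Q i j) = 1" if "j \<in> S" for j
    proof -
      have "(\<Sum>i\<in>S. Q i j) = (\<Sum>i\<in>S. P i j) + (\<Sum>i\<in>S. P i n) * P n j / q"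
        by (simp add: Q_def sum.distrib sum_distrib_right sum_divide_distrib)
      also have "\<dots> = (\<Sum>i\<in>S. P i j) + P n j"
        using q by (simp flip: qs)
      finally show ?thesis using col[of j] that by simp
    qed
    moreover have "0 \<le> Q i j" if "i \<in> S" "j \<in> S" for i j
      using nonneg that q by (simp add: Q_def)
    ultimately obtain v where v: "\<And>i. i \<in> S \<Longrightarrow> 0 \<le> v i"
      "\<And>i. i \<in> S \<Longrightarrow> v i = (\<Sum>j\<in>S. Q i j * v j)" "sum v S = 1"
      using insert.IH[of Q] by blast
    \<comment> \<open>The stationarity equation at \<open>n\<close> forces this value. In
      \<open>w\<close> the total mass \<open>1 + c\<close> is scaled to one.\<close>
    define c where "c = (\<Sum>j\<in>S. P n j * v j) / q"
    have c: "c \<ge> 0"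
      unfolding c_def using q nonneg v(1) by (intro divide_nonneg_pos sum_nonneg) auto
    define w where "w i = (if i = n then c else v i) / (1 + c)" for i
    have ne: "i \<noteq> n" if "i \<in> S" for i
      using that insert.hyps by auto
    have wS: "(\<Sum>j\<in>S. f j * w j) = (\<Sum>j\<in>S. f j * v j) / (1 + c)" for f
      unfolding sum_divide_distrib by (intro sum.cong) (auto simp: w_def dest: ne)
    have wn: "w n = c / (1 + c)" by (simp add: w_def)
    have "w i = (\<Sum>j\<in>insert n S. P i j * w j)" if "i \<in> insert n S" for i
    proof (cases "i = n")
      case True
      have "P n n * c + (\<Sum>j\<in>S. P n j * v j) = c"
        using q by (simp add: c_def q_def field_simps)
      then have "P n n * c / (1 + c) + (\<Sum>j\<in>S. P n j * v j) / (1 + c) = c / (1 + c)"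
        by (simp flip: add_divide_distrib)
      with True show ?thesis
        using insert.hyps by (simp add: wS wn)
    next
      case False
      with that have i: "i \<in> S" by simp
      have "v i = (\<Sum>j\<in>S. P i j * v j) + P i n * c"
        unfolding v(2)[OF i] c_def sum_distrib_left sum_divide_distrib sum.distrib[symmetric]
        by (intro sum.cong) (simp_all add: Q_def field_simps)
      then have "v i / (1 + c) = (\<Sum>j\<in>S. P i j * v j) / (1 + c) + P i n * c / (1 + c)"
        by (simp add: add_divide_distrib)
      with False show ?thesis
        using insert.hyps by (simp add: wS wn) (simp add: w_def)
    qed
    moreover have "0 \<le> w i" if "i \<in> insert n S" for i
      using that v(1) c by (auto simp: w_def)
    moreover have "sum w (insert n S) = 1"
      using insert.hyps wS[of "\<lambda>_. 1"] c v(3) by (simp add: wn flip: add_divide_distrib)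
    ultimately show ?thesis by blast
  qed
qed

text \<open>A vanishing sum of nonnegative terms vanishes termwise, so zeros of a stationary vector
  spread against the arcs. This serves both for positivity on a class and for uniqueness.\<close>

lemma stationary_zero_backward:
  fixes v :: "nat \<Rightarrow> real"
  assumes "\<And>i j. i \<in> {1..N} \<Longrightarrow> j \<in> {1..N} \<Longrightarrow> 0 \<le> P i j"
    and "\<And>i j. (j, i) \<in> arcs N \<sigma> \<Longrightarrow> 0 < P i j"
    and "\<And>i. i \<in> {1..N} \<Longrightarrow> 0 \<le> v i"
    and "\<And>i. i \<in> {1..N} \<Longrightarrow> v i = (\<Sum>j\<in>{1..N}. P i j * v j)"
    and "(j, i) \<in> (arcs N \<sigma>)\<^sup>+" "v i = 0"
  shows "v j = 0"
  using assms(5,6)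
proof (induction rule: converse_trancl_induct)
  have arc: "v j = 0" if "(j, i) \<in> arcs N \<sigma>" "v i = 0" for i j
  proof -
    have ij: "i \<in> {1..N}" "j \<in> {1..N}"
      using that by (auto simp: arcs_def)
    have "(\<Sum>j\<in>{1..N}. P i j * v j) = 0"
      using assms(4)[OF ij(1)] that by simp
    then have "P i j * v j = 0"
      using assms(1,3) ij by (subst (asm) sum_nonneg_eq_0_iff) auto
    then show ?thesis
      using assms(2)[OF that(1)] by simp
  qed
  {
    case (base j)
    then show ?case using arc by blast
  next
    case (step j k)
    then show ?case using arc by blast
  }
qed

text \<open>The probability that the chain started at \<open>i\<close> does not visit \<open>j\<close> at the times \<open>1, \<dots>, m\<close>.\<close>

primrec avoid_prob ::
  "nat \<Rightarrow> (nat \<Rightarrow> nat \<Rightarrow> real) \<Rightarrow> nat \<Rightarrow> nat \<Rightarrow> nat \<Rightarrow> real" where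
  "avoid_prob N P j 0 = (\<lambda>i. 1)"
| "avoid_prob N P j (Suc m) = (\<lambda>i. \<Sum>k\<in>{1..N} - {j}. P k i * avoid_prob N P j m k)"

section \<open>Avoidance and return probabilities of the chain\<close>

lemma sets_chain_law: "sets (chain_law N P j) = sets (PiM UNIV (\<lambda>_. count_space UNIV))"
proof -
  interpret IT: Ionescu_Tulcea "chain_kernel N P j" "\<lambda>_::nat. count_space (UNIV :: nat set)"
    by (rule Ionescu_Tulcea_chain_kernel)
  show ?thesis
    unfolding chain_law_def by (rule IT.PF.sets_lim)
qed

lemma space_chain_law: "space (chain_law N P j) = UNIV"
  using sets_eq_imp_space_eq[OF sets_chain_law] by (simp add: space_PiM)

lemma prob_space_chain_law: "prob_space (chain_law N P j)"
  by (rule prob_spaceI)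
     (use chain_law_cylinder_kernel[of N P j 0] in \<open>simp add: space_chain_law\<close>)

lemma coordinatewise_set_in_chain_law: "{\<omega>. \<forall>n. Q n (\<omega> n)} \<in> sets (chain_law N P j)"
proof -
  have "{\<omega>. Q n (\<omega> n)} \<in> sets (chain_law N P j)" for n
  proof -
    have "(\<lambda>\<omega>. \<omega> n) \<in> measurable (PiM UNIV (\<lambda>_. count_space UNIV)) (count_space UNIV)"
      by (rule measurable_component_singleton) simp
    from measurable_sets[OF this, of "{x. Q n x}"] show ?thesis
      by (simp add: sets_chain_law space_PiM vimage_def)
  qed
  then have "(\<Inter>n. {\<omega>. Q n (\<omega> n)}) \<in> sets (chain_law N P j)"
    by (intro sets.countable_INT) auto
  then show ?thesis
    by (simp add: Collect_all_eq)
qed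

locale chain =
  fixes N :: nat and P :: "nat \<Rightarrow> nat \<Rightarrow> real"
  assumes nonneg: "i \<in> {1..N} \<Longrightarrow> j \<in> {1..N} \<Longrightarrow> 0 \<le> P i j"
    and stochastic: "j \<in> {1..N} \<Longrightarrow> (\<Sum>i\<in>{1..N}. P i j) = 1"
begin

lemma avoid_prob_nonneg: "i \<in> {1..N} \<Longrightarrow> 0 \<le> avoid_prob N P j m i"
  by (induction m arbitrary: i) (auto intro!: sum_nonneg mult_nonneg_nonneg nonneg)

text \<open>The prefix \<open>p\<close> is arbitrary so that the induction on \<open>m\<close> can
  fix one more coordinate; the prefix consisting of the initial state alone yields
  \<open>measure_avoid\<close>.\<close>

lemma measure_cylinder_avoid:
  assumes "p ` {..n} \<subseteq> {1..N}" "p 0 = j"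
  shows "measure (chain_law N P j) {\<omega>. (\<forall>k\<le>n. \<omega> k = p k) \<and> (\<forall>k\<in>{Suc n..n + m}. \<omega> k \<noteq> j)} =
    (\<Prod>k<n. P (p (Suc k)) (p k)) * avoid_prob N P j m (p n)"
  using assms
proof (induction m arbitrary: n p)
  case 0
  have "measure (chain_law N P j) {\<omega>. \<forall>k\<le>n. \<omega> k = p k} = (\<Prod>k<n. P (p (Suc k)) (p k))"
    using chain_law_cylinder[of N P p n j] nonneg stochastic 0 by simp
  then show ?case by simp
next
  case (Suc m)
  interpret prob_space "chain_law N P j"
    by (rule prob_space_chain_law)
  let ?M = "chain_law N P j"
  define w where "w = (\<Prod>k<n. P (p (Suc k)) (p k))"
  define D where "D = {\<omega>. (\<forall>k\<le>n. \<omega> k = p k) \<and> (\<forall>k\<in>{Suc n..n + Suc m}. \<omega> k \<noteq> j)}"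
  define Z where "Z = {\<omega>. \<forall>k\<le>n. \<omega> k = p k}"
  define W where "W i = {\<omega>. \<forall>k\<le>Suc n. \<omega> k = (p(Suc n := i)) k}" for i
  define V where "V i = {\<omega>. (\<forall>k\<le>Suc n. \<omega> k = (p(Suc n := i)) k) \<and>
      (\<forall>k\<in>{Suc (Suc n)..Suc n + m}. \<omega> k \<noteq> j)}" for i
  have all_le: "(\<forall>k\<le>Suc n. \<omega> k = (p(Suc n := i)) k) \<longleftrightarrow> (\<forall>k\<le>n. \<omega> k = p k) \<and> \<omega> (Suc n) = i"
    for \<omega> i
    by (auto simp: le_Suc_eq)
  have meas: "D \<in> events" "Z \<in> events" "W i \<in> events" "V i \<in> events" for i
    using coordinatewise_set_in_chain_law[of "\<lambda>k x. (k \<le> n \<longrightarrow> x = p k) \<and> (k \<in> {Suc n..n + Suc m} \<longrightarrow> x \<noteq> j)" N P j]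
      coordinatewise_set_in_chain_law[of "\<lambda>k x. k \<le> n \<longrightarrow> x = p k" N P j]
      coordinatewise_set_in_chain_law[of "\<lambda>k x. k \<le> Suc n \<longrightarrow> x = (p(Suc n := i)) k" N P j]
      coordinatewise_set_in_chain_law[of "\<lambda>k x. (k \<le> Suc n \<longrightarrow> x = (p(Suc n := i)) k) \<and>
        (k \<in> {Suc (Suc n)..Suc n + m} \<longrightarrow> x \<noteq> j)" N P j]
    by (simp_all only: D_def Z_def W_def V_def Ball_def all_conj_distrib)
  have pn: "p n \<in> {1..N}"
    using Suc.prems(1) by auto
  have p': "p(Suc n := i) ` {..Suc n} \<subseteq> {1..N}" if "i \<in> {1..N}" for i
    using Suc.prems(1) that by (auto simp: image_subset_iff le_Suc_eq)
  have p0: "(p(Suc n := i)) 0 = j" for i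
    using Suc.prems(2) by simp
  have w': "(\<Prod>k<Suc n. P ((p(Suc n := i)) (Suc k)) ((p(Suc n := i)) k)) = w * P i (p n)" for i
    unfolding w_def prod.lessThan_Suc by (intro arg_cong2[of _ _ _ _ "(*)"] prod.cong) auto
  have mZ: "prob Z = w"
    using chain_law_cylinder[of N P p n j] nonneg stochastic Suc.prems by (simp add: Z_def w_def)
  have mW: "prob (W i) = w * P i (p n)" if "i \<in> {1..N}" for i
    unfolding W_def
    by (subst chain_law_cylinder[OF nonneg stochastic p'[OF that]]) (auto simp only: p0 w' simp_thms if_True)
  have mV: "prob (V i) = w * P i (p n) * avoid_prob N P j m i" if "i \<in> {1..N}" for i
    unfolding V_def by (subst Suc.IH[OF p'[OF that] p0]) (simp only: w' fun_upd_same)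
  have disj: "disjoint_family_on W I" "disjoint_family_on V I" for I
    by (auto simp: disjoint_family_on_def W_def V_def all_le)
  have sub: "(\<Union>i\<in>{1..N}. W i) \<subseteq> Z"
    by (auto simp: Z_def W_def all_le)
  \<comment> \<open>Paths are sequences of arbitrary natural numbers, so continuations of
    \<open>p\<close> that leave \<open>{1..N}\<close> must be discarded. They form a null set
    because the continuations inside \<open>{1..N}\<close> exhaust the mass of
    \<open>Z\<close>.\<close>
  have "prob (\<Union>i\<in>{1..N}. W i) = (\<Sum>i\<in>{1..N}. prob (W i))"
    using meas by (intro finite_measure_finite_Union disj) auto
  also have "\<dots> = prob Z"
    using stochastic[OF pn] by (simp add: mW mZ flip: sum_distrib_left)
  finally have "prob (Z - (\<Union>i\<in>{1..N}. W i)) = 0"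
    using meas sub by (subst finite_measure_Diff) auto
  then have null: "Z - (\<Union>i\<in>{1..N}. W i) \<in> null_sets (chain_law N P j)"
    using meas by (intro null_setsI) (auto simp: emeasure_eq_measure)
  have split: "(\<forall>k\<in>{Suc n..n + Suc m}. \<omega> k \<noteq> j) \<longleftrightarrow>
      \<omega> (Suc n) \<noteq> j \<and> (\<forall>k\<in>{Suc (Suc n)..Suc n + m}. \<omega> k \<noteq> j)" for \<omega>
    by (subst atLeastAtMost_insertL[symmetric]) auto
  have "D \<union> (Z - (\<Union>i\<in>{1..N}. W i)) =
      (\<Union>i\<in>{1..N} - {j}. V i) \<union> (Z - (\<Union>i\<in>{1..N}. W i))"
    unfolding D_def Z_def W_def V_def all_le split by blast
  then have "prob D = prob (\<Union>i\<in>{1..N} - {j}. V i)"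
    using meas null by (metis (no_types, lifting) finite_Diff finite_atLeastAtMost measure_Un_null_set sets.finite_UN)
  also have "\<dots> = (\<Sum>i\<in>{1..N} - {j}. prob (V i))"
    using meas by (intro finite_measure_finite_Union disj) auto
  also have "\<dots> = w * avoid_prob N P j (Suc m) (p n)"
    by (simp add: mV sum_distrib_left mult.assoc)
  finally show ?case
    by (simp only: D_def w_def)
qed

lemma measure_avoid:
  assumes "j \<in> {1..N}"
  shows "measure (chain_law N P j) {\<omega>. \<forall>k\<in>{1..m}. \<omega> k \<noteq> j} = avoid_prob N P j m j"
proof -
  interpret prob_space "chain_law N P j"
    by (rule prob_space_chain_law)
  have s: "{\<omega>. \<forall>k\<in>{1..m}. \<omega> k \<noteq> j} \<in> events" "{\<omega>. \<omega> 0 = j} \<in> events"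
    using coordinatewise_set_in_chain_law[of "\<lambda>k x. k \<in> {1..m} \<longrightarrow> x \<noteq> j" N P j]
      coordinatewise_set_in_chain_law[of "\<lambda>k x. k = 0 \<longrightarrow> x = j" N P j]
    by (simp_all add: Ball_def)
  \<comment> \<open>The chain starts at \<open>j\<close> only almost surely; intersecting with this
    event makes the cylinder formula applicable.\<close>
  have "prob {\<omega>. \<omega> 0 = j} = 1"
    using chain_law_cylinder[of N P "\<lambda>_. j" 0 j] nonneg stochastic assms by auto
  then have "prob {\<omega>. \<forall>k\<in>{1..m}. \<omega> k \<noteq> j} = prob ({\<omega>. \<omega> 0 = j} \<inter> {\<omega>. \<forall>k\<in>{1..m}. \<omega> k \<noteq> j})"
    using measure_space_inter[OF s] by (simp only: prob_space Int_commute)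
  also have "\<dots> = avoid_prob N P j m j"
    using measure_cylinder_avoid[of "\<lambda>_. j" 0 j m] assms by (simp add: Collect_conj_eq image_subset_iff)
  finally show ?thesis .
qed

text \<open>The events of not returning up to time \<open>m\<close> decrease to the event of never
  returning, so continuity from above replaces the measure on paths by a limit of numbers.\<close>

lemma recurrent_node_iff:
  assumes "j \<in> {1..N}"
  shows "recurrent_node N P j \<longleftrightarrow> (\<lambda>m. avoid_prob N P j m j) \<longlonglongrightarrow> 0"
proof -
  interpret prob_space "chain_law N P j"
    by (rule prob_space_chain_law)
  define D where "D m = {\<omega>. \<forall>k\<in>{1..m}. \<omega> k \<noteq> j}" for m :: nat
  have D: "range D \<subseteq> events"
    using coordinatewise_set_in_chain_law[of "\<lambda>k x. k \<in> {1.._} \<longrightarrow> x \<noteq> j" N P j]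
    by (auto simp: D_def Ball_def)
  have "decseq D"
    by (auto simp: D_def decseq_def)
  with D have lim: "(\<lambda>m. avoid_prob N P j m j) \<longlonglongrightarrow> prob (\<Inter>m. D m)"
    using finite_Lim_measure_decseq[of D] measure_avoid[OF assms] by (simp add: D_def)
  have eq: "{\<omega>. \<exists>n\<ge>1. \<omega> n = j} = space (chain_law N P j) - (\<Inter>m. D m)"
    unfolding D_def space_chain_law
    by (auto simp del: atLeastAtMost_iff) (metis atLeastAtMost_iff order_refl)+
  have "prob {\<omega>. \<exists>n\<ge>1. \<omega> n = j} = 1 - prob (\<Inter>m. D m)"
    unfolding eq using D by (intro prob_compl) auto
  then show ?thesis
    using lim by (auto simp: recurrent_node_def dest: LIMSEQ_unique)
qed

text \<open>
  Stationarity makes the nonnegative sums \<open>\<Sum>i. v i * avoid_prob N P j m i\<close> decrease by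
  \<open>v j * avoid_prob N P j m j\<close> in step \<open>m\<close>, so the decrements are summable.
\<close>

lemma recurrent_if_stationary_pos:
  assumes "j \<in> {1..N}"
    and pos: "\<And>i. i \<in> {1..N} \<Longrightarrow> 0 < v i"
    and stat: "\<And>i. i \<in> {1..N} \<Longrightarrow> v i = (\<Sum>k\<in>{1..N}. P i k * v k)"
  shows "recurrent_node N P j"
proof -
  let ?u = "avoid_prob N P j"
  define S where "S m = (\<Sum>i\<in>{1..N}. v i * ?u m i)" for m
  have step: "S (Suc m) = S m - v j * ?u m j" for m
  proof -
    have "S (Suc m) = (\<Sum>i\<in>{1..N}. \<Sum>k\<in>{1..N} - {j}. P k i * v i * ?u m k)"
      by (simp add: S_def sum_distrib_left mult_ac)
    also have "\<dots> = (\<Sum>k\<in>{1..N} - {j}. (\<Sum>i\<in>{1..N}. P k i * v i) * ?u m k)"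
      by (subst sum.swap) (simp add: sum_distrib_right)
    also have "\<dots> = (\<Sum>k\<in>{1..N} - {j}. v k * ?u m k)"
      using stat by (intro sum.cong) auto
    finally show ?thesis
      using assms(1) by (simp add: S_def sum_diff1)
  qed
  have "S m = S 0 - (\<Sum>k<m. v j * ?u k j)" for m
    by (induction m) (simp_all add: step)
  moreover have "0 \<le> S m" for m
    unfolding S_def using pos avoid_prob_nonneg by (intro sum_nonneg mult_nonneg_nonneg) (auto intro: less_imp_le)
  ultimately have "(\<Sum>k<m. v j * ?u k j) \<le> S 0" for m
    by (metis diff_ge_0_iff_ge)
  then have "summable (\<lambda>m. v j * ?u m j)"
    using pos[OF assms(1)] avoid_prob_nonneg[OF assms(1)]
    by (intro summableI_nonneg_bounded[of _ "S 0"]) (auto intro!: mult_nonneg_nonneg)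
  then have "summable (\<lambda>m. ?u m j)"
    using pos[OF assms(1)] by (simp add: summable_cmult_iff)
  then show ?thesis
    unfolding recurrent_node_iff[OF assms(1)] by (rule summable_LIMSEQ_zero)
qed

text \<open>If \<open>i\<close> did not lead back to \<open>j\<close>, the chain would avoid
  \<open>j\<close> from \<open>i\<close> with probability one. But along a path from the recurrent
  node \<open>j\<close> the avoidance probabilities tend to zero at every node.\<close>

lemma recurrent_returns:
  assumes "recurrent_node N P j" "(j, i) \<in> (arcs N \<sigma>)\<^sup>+"
    and arc_pos: "\<And>i j. (j, i) \<in> arcs N \<sigma> \<Longrightarrow> 0 < P i j"
    and pos_arc: "\<And>i j. i \<in> {1..N} \<Longrightarrow> j \<in> {1..N} \<Longrightarrow> (j, i) \<notin> arcs N \<sigma> \<Longrightarrow> P i j = 0"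
  shows "(i, j) \<in> (arcs N \<sigma>)\<^sup>+"
proof (rule ccontr)
  assume no: "(i, j) \<notin> (arcs N \<sigma>)\<^sup>+"
  let ?u = "avoid_prob N P j"
  have dom: "x \<in> {1..N} \<and> y \<in> {1..N}" if "(x, y) \<in> arcs N \<sigma>" for x y
    using that by (auto simp: arcs_def)
  have j: "j \<in> {1..N}" and i: "i \<in> {1..N}"
    using tranclD[OF assms(2)] tranclD2[OF assms(2)] dom by blast+
  have uj: "(\<lambda>m. ?u m j) \<longlonglongrightarrow> 0"
    using assms(1) recurrent_node_iff[OF j] by simp
  have step: "(\<lambda>m. ?u m l) \<longlonglongrightarrow> 0" if "(k, l) \<in> arcs N \<sigma>" "(\<lambda>m. ?u m k) \<longlonglongrightarrow> 0" for k l
  proof (cases "l = j")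
    case False
    have kl: "k \<in> {1..N}" "l \<in> {1..N}"
      using dom that(1) by auto
    have "(\<lambda>m. ?u (Suc m) k / P l k) \<longlonglongrightarrow> 0"
      by (intro tendsto_divide_zero LIMSEQ_Suc that(2))
    moreover have "?u m l \<le> ?u (Suc m) k / P l k" for m
    proof -
      have "P l k * ?u m l \<le> ?u (Suc m) k"
        unfolding avoid_prob.simps using kl False avoid_prob_nonneg nonneg
        by (intro member_le_sum[where f = "\<lambda>l. P l k * ?u m l"] mult_nonneg_nonneg) blast+
      then show ?thesis
        using arc_pos[OF that(1)] by (simp add: pos_le_divide_eq mult.commute)
    qed
    ultimately show ?thesis
      using avoid_prob_nonneg[OF kl(2)]
      by (intro tendsto_sandwich[of "\<lambda>_. 0" "\<lambda>m. ?u m l" _ "\<lambda>m. ?u (Suc m) k / P l k"]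
          always_eventually allI tendsto_const)
  qed (use uj in simp)
  have "(\<lambda>m. ?u m i) \<longlonglongrightarrow> 0"
    using assms(2) by (induction rule: trancl_induct) (use step uj in blast)+
  \<comment> \<open>Successors of a node that does not lead to \<open>j\<close> do not lead to
    \<open>j\<close> either, so all mass is kept in each step.\<close>
  moreover have "?u m l = 1" if "l \<in> {1..N}" "(l, j) \<notin> (arcs N \<sigma>)\<^sup>+" for m l
    using that
  proof (induction m arbitrary: l)
    case (Suc m)
    have P0: "P j l = 0"
      using Suc.prems j pos_arc by blast
    have "P k l * ?u m k = P k l" if "k \<in> {1..N}" for k
    proof (cases "(l, k) \<in> arcs N \<sigma>")
      case True
      then have "(k, j) \<notin> (arcs N \<sigma>)\<^sup>+"
        using Suc.prems(2) by (meson trancl_into_trancl2)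
      then show ?thesis
        using Suc.IH that by simp
    qed (use Suc.prems that pos_arc in simp)
    then have "?u (Suc m) l = (\<Sum>k\<in>{1..N} - {j}. P k l)"
      unfolding avoid_prob.simps by (intro sum.cong) blast+
    also have "\<dots> = 1"
      using P0 stochastic[OF Suc.prems(1)] j by (simp add: sum_diff1)
    finally show ?case .
  qed simp
  ultimately show False
    using i no by (auto dest: LIMSEQ_unique)
qed

text \<open>Subtract from \<open>v\<close> the largest multiple of \<open>w\<close> that stays below
  it. The difference is nonnegative, stationary and has a zero, so it vanishes by irreducibility;
  comparing total masses shows that the multiple is one.\<close>

lemma stationary_unique:
  assumes arc_pos: "\<And>i j. (j, i) \<in> arcs N \<sigma> \<Longrightarrow> 0 < P i j"
    and irred: "\<And>i j. i \<in> {1..N} \<Longrightarrow> j \<in> {1..N} \<Longrightarrow> i \<noteq> j \<Longrightarrow> (j, i) \<in> (arcs N \<sigma>)\<^sup>+"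
    and v: "\<And>i. i \<in> {1..N} \<Longrightarrow> 0 < v i" "\<And>i. i \<in> {1..N} \<Longrightarrow> v i = (\<Sum>k\<in>{1..N}. P i k * v k)"
      "sum v {1..N} = 1"
    and w: "\<And>i. i \<in> {1..N} \<Longrightarrow> 0 < w i" "\<And>i. i \<in> {1..N} \<Longrightarrow> w i = (\<Sum>k\<in>{1..N}. P i k * w k)"
      "sum w {1..N} = 1"
    and i: "i \<in> {1..N}"
  shows "v i = w i"
proof -
  define r where "r = Min ((\<lambda>k. v k / w k) ` {1..N})"
  have "r \<in> (\<lambda>k. v k / w k) ` {1..N}"
    unfolding r_def using i by (intro Min_in) auto
  then obtain k where k: "k \<in> {1..N}" "r = v k / w k"
    by auto
  have le: "r * w l \<le> v l" if "l \<in> {1..N}" for l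
  proof -
    have "r \<le> v l / w l"
      unfolding r_def using that by (intro Min_le) auto
    then show ?thesis
      using w(1)[OF that] by (simp add: pos_le_divide_eq)
  qed
  define z where "z l = v l - r * w l" for l
  have zk: "z k = 0"
    using k w(1)[OF k(1)] by (simp add: z_def)
  have zs: "z l = (\<Sum>k\<in>{1..N}. P l k * z k)" if "l \<in> {1..N}" for l
    unfolding z_def by (subst (1) v(2)[OF that], subst (1) w(2)[OF that])
      (simp add: right_diff_distrib sum_subtractf sum_distrib_left mult_ac)
  have z: "z l = 0" if "l \<in> {1..N}" for l
  proof (cases "l = k")
    case False
    show ?thesis
      by (rule stationary_zero_backward[OF nonneg arc_pos _ zs irred[OF k(1) that] zk])
         (use le False in \<open>auto simp: z_def\<close>)
  qed (simp add: zk)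
  have "(\<Sum>l\<in>{1..N}. z l) = 1 - r"
    unfolding z_def sum_subtractf sum_distrib_left[symmetric] v(3) w(3) by simp
  then have "r = 1"
    using z by simp
  then show ?thesis
    using z[OF i] by (simp add: z_def)
qed

text \<open>No arc leaves the set \<open>C\<close> of nodes reachable from \<open>j\<close>, so the
  matrix restricted to \<open>C\<close> is stochastic, and a stationary vector on \<open>C\<close>
  extends by zero. The hypothesis \<open>returns\<close> takes the place of recurrence, so that the
  irreducible case is covered as well.\<close>

lemma stationary_of_recurrent:
  assumes arc_pos: "\<And>i j. (j, i) \<in> arcs N \<sigma> \<Longrightarrow> 0 < P i j"
    and pos_arc: "\<And>i j. i \<in> {1..N} \<Longrightarrow> j \<in> {1..N} \<Longrightarrow> (j, i) \<notin> arcs N \<sigma> \<Longrightarrow> P i j = 0"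
    and j: "j \<in> {1..N}"
    and returns: "\<And>i. (j, i) \<in> (arcs N \<sigma>)\<^sup>+ \<Longrightarrow> (i, j) \<in> (arcs N \<sigma>)\<^sup>+"
  obtains v where "\<And>i. i \<in> {1..N} \<Longrightarrow> 0 \<le> v i"
    "\<And>i. i \<in> {1..N} \<Longrightarrow> v i = (\<Sum>k\<in>{1..N}. P i k * v k)" "sum v {1..N} = 1"
    "\<And>i. i \<in> {1..N} \<Longrightarrow> 0 < v i \<longleftrightarrow> i = j \<or> (j, i) \<in> (arcs N \<sigma>)\<^sup>+"
proof -
  define C where "C = insert j {i \<in> {1..N}. (j, i) \<in> (arcs N \<sigma>)\<^sup>+}"
  have C: "C \<subseteq> {1..N}" "finite C" "j \<in> C"
    using j by (auto simp: C_def)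
  have out: "P i k = 0" if "k \<in> C" "i \<in> {1..N} - C" for i k
  proof -
    have "(k, i) \<notin> arcs N \<sigma>"
    proof
      assume *: "(k, i) \<in> arcs N \<sigma>"
      then have "(j, i) \<in> (arcs N \<sigma>)\<^sup>+"
        using that(1) by (cases "k = j") (auto simp: C_def intro: trancl.trancl_into_trancl)
      then show False
        using that(2) by (auto simp: C_def)
    qed
    then show ?thesis
      using pos_arc that C by blast
  qed
  have "(\<Sum>i\<in>C. P i k) = 1" if "k \<in> C" for k
    using sum.mono_neutral_left[of "{1..N}" C "\<lambda>i. P i k"] C out[OF that] stochastic[of k] that
    by auto
  then obtain v where v': "\<forall>i\<in>C. 0 \<le> v i \<and> v i = (\<Sum>k\<in>C. P i k * v k)" and v3: "sum v C = 1"
    using stationary_vector_exists[of C P] C nonneg by blast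
  have v: "0 \<le> v i" "v i = (\<Sum>k\<in>C. P i k * v k)" if "i \<in> C" for i
    using bspec[OF v' that] by blast+
  define w where "w i = (if i \<in> C then v i else 0)" for i
  have w_nonneg: "0 \<le> w i" for i
    using v(1) by (simp add: w_def)
  have w_stat: "w i = (\<Sum>k\<in>{1..N}. P i k * w k)" if "i \<in> {1..N}" for i
  proof -
    have "(\<Sum>k\<in>{1..N}. P i k * w k) = (\<Sum>k\<in>C. P i k * v k)"
      using C by (intro sum.mono_neutral_cong_right) (auto simp: w_def)
    also have "\<dots> = w i"
      using v(2)[of i] out[of _ i] that by (cases "i \<in> C") (simp_all add: w_def)
    finally show ?thesis by simp
  qed
  have w_sum: "sum w {1..N} = 1"
    using C v3 by (subst sum.mono_neutral_cong_right[of _ C _ v]) (auto simp: w_def)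
  have zero: "w i = 0" if "(i, k) \<in> (arcs N \<sigma>)\<^sup>+" "w k = 0" for i k
    by (rule stationary_zero_backward[OF nonneg arc_pos w_nonneg w_stat that]) auto
  \<comment> \<open>Every node of \<open>C\<close> leads to \<open>j\<close>, so a zero at
    \<open>j\<close> would spread to all of \<open>C\<close> and contradict the total mass one.
    Conversely \<open>j\<close> leads to every other node of \<open>C\<close>, so a zero at such a
    node would spread to \<open>j\<close>.\<close>
  have "w j \<noteq> 0"
  proof
    assume "w j = 0"
    then have "w i = 0" if "i \<in> C" for i
      using that zero returns unfolding C_def by blast
    then have "sum w C = 0" by simp
    then show False
      using v3 by (simp add: w_def cong: sum.cong)
  qed
  then have "w i \<noteq> 0" if "i \<in> C" for i
    using that zero unfolding C_def by blast
  then have "0 < w i \<longleftrightarrow> i = j \<or> (j, i) \<in> (arcs N \<sigma>)\<^sup>+" if "i \<in> {1..N}" for i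
    using that w_nonneg[of i] unfolding less_le by (auto simp: w_def C_def)
  with w_nonneg w_stat w_sum show ?thesis
    using that by blast
qed

end

section \<open>Inverse branches and associated maps\<close>

declare One_nat_def [simp del]

section \<open>Partitions of the unit interval\<close>

lemma interval_partition_less:
  assumes "interval_partition N x" "i < j" "j \<le> N"
  shows "x i < x j"
  using assms(2,3)
proof (induction j)
  case (Suc j)
  then have "x j < x (Suc j)"
    using assms(1) by (simp add: interval_partition_def)
  with Suc show ?case
    by (cases "i = j") auto
qed simp

lemma interval_partition_le:
  assumes "interval_partition N x" "i \<le> j" "j \<le> N"
  shows "x i \<le> x j"
  using interval_partition_less[OF assms(1), of i j] assms by (cases "i = j") auto

lemma interval_partition_less_iff:
  assumes "interval_partition N x" "i \<le> N" "j \<le> N"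
  shows "x i < x j \<longleftrightarrow> i < j"
  using interval_partition_less[OF assms(1), of i j] interval_partition_le[OF assms(1), of j i] assms
  by (cases "i < j") auto

lemma interval_partition_eq_iff:
  assumes "interval_partition N x" "i \<le> N" "j \<le> N"
  shows "x i = x j \<longleftrightarrow> i = j"
  using interval_partition_less_iff[OF assms] interval_partition_less_iff[OF assms(1,3,2)] by auto

lemma interval_partition_range:
  assumes "interval_partition N x" "i \<le> N"
  shows "x i \<in> {0..1}"
  using interval_partition_le[OF assms(1), of 0 i] interval_partition_le[OF assms(1), of i N] assms
  by (auto simp: interval_partition_def)

lemma interval_partition_step:
  assumes "interval_partition N x" "i \<in> {1..N}"
  shows "x (i - 1) < x i"
  using assms by (intro interval_partition_less) auto

lemma piece_subset:
  assumes "interval_partition N x" "i \<in> {1..N}"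
  shows "piece x i \<subseteq> {0..1}"
  using interval_partition_range[OF assms(1), of i] interval_partition_range[OF assms(1), of "i - 1"] assms(2)
  by (auto simp: piece_def)

text \<open>Stated for a stretch between two partition points because the image of a piece is such a
  stretch; the bounds on \<open>j\<close> then say that an entry of \<open>A_star\<close> is
  one.\<close>

lemma interval_partition_cover:
  assumes "interval_partition N x" "m < n" "n \<le> N" "x m \<le> w" "w \<le> x n"
  shows "\<exists>j. m < j \<and> j \<le> n \<and> w \<in> piece x j"
  using assms(2-)
proof (induction n)
  case (Suc n)
  show ?case
  proof (cases "x n \<le> w")
    case True
    with Suc.prems show ?thesis
      by (intro exI[of _ "Suc n"]) (auto simp: piece_def)
  next
    case False
    with Suc.prems have "m < n"
      by (metis le_less_trans less_antisym not_less)
    with Suc False show ?thesis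
      by (metis Suc_leD le_Suc_eq nless_le not_less)
  qed
qed simp

lemma piece_cover:
  assumes "interval_partition N x" "y \<in> {0..1}"
  obtains i where "i \<in> {1..N}" "y \<in> piece x i"
proof -
  have "N \<noteq> 0"
    using assms(1) by (intro notI) (auto simp: interval_partition_def)
  then obtain j where "0 < j" "j \<le> N" "y \<in> piece x j"
    using interval_partition_cover[OF assms(1), of 0 N y] assms
    by (auto simp: interval_partition_def)
  then show ?thesis
    by (intro that[of j]) auto
qed

lemma piece_Int:
  assumes "interval_partition N x" "i \<in> {1..N}" "j \<in> {1..N}" "i < j" "y \<in> piece x i" "y \<in> piece x j"
  shows "y = x i" "j = Suc i"
proof -
  have "x i \<le> x (j - 1)"
    using assms by (intro interval_partition_le[OF assms(1)]) auto
  then have "y = x i" and "x i = x (j - 1)"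
    using assms by (auto simp: piece_def)
  then show "y = x i" "j = Suc i"
    using assms interval_partition_eq_iff[OF assms(1), of i "j - 1"] by auto
qed

text \<open>Besides monotonicity this gives expansion: \<open>f\<close> expands by \<open>c\<close>
  in the positive direction exactly if \<open>f z - c * z\<close> is increasing, and that can be
  checked piece by piece.\<close>

lemma increasing_from_pieces:
  fixes h :: "real \<Rightarrow> real"
  assumes "interval_partition N x" "0 \<le> p" "p \<le> q" "q \<le> 1"
    and "\<And>i u v. i \<in> {1..N} \<Longrightarrow> u \<in> piece x i \<Longrightarrow> v \<in> piece x i \<Longrightarrow> p \<le> u \<Longrightarrow> u \<le> v \<Longrightarrow> v \<le> q \<Longrightarrow> h u \<le> h v"
  shows "h p \<le> h q"
proof -
  \<comment> \<open>Partition points moved into \<open>[p, q]\<close>. Consecutive ones coincide or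
    bound a part of a single piece.\<close>
  define c where "c k = max p (min q (x k))" for k
  have "h p \<le> h (c k)" if "k \<le> N" for k
    using that
  proof (induction k)
    case 0
    have "c 0 = p"
      using assms(1-3) by (simp add: c_def interval_partition_def)
    then show ?case by simp
  next
    case (Suc k)
    have "x k < x (Suc k)"
      using assms(1) Suc.prems by (simp add: interval_partition_def)
    then have "c k = c (Suc k) \<or> (x k \<le> c k \<and> c (Suc k) \<le> x (Suc k)) \<and> c k \<le> c (Suc k)"
      using assms(3) unfolding c_def by linarith
    moreover have "p \<le> c k" "c (Suc k) \<le> q"
      using assms(3) by (auto simp: c_def)
    ultimately have "h (c k) \<le> h (c (Suc k))"
      using assms(5)[of "Suc k" "c k" "c (Suc k)"] Suc.prems by (auto simp: piece_def)
    with Suc show ?case by simp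
  qed
  from this[of N] show ?thesis
    using assms(1,3,4) by (simp add: c_def interval_partition_def)
qed

text \<open>The length of the part of the \<open>k\<close>-th piece below \<open>w\<close>. Linear
  combinations of ramps describe continuous piecewise affine functions without case distinctions at
  the break points.\<close>

definition ramp :: "(nat \<Rightarrow> real) \<Rightarrow> nat \<Rightarrow> real \<Rightarrow> real" where
  "ramp x k w = max (x (k - 1)) (min (x k) w) - x (k - 1)"

lemma ramp_mono: "u \<le> v \<Longrightarrow> ramp x k u \<le> ramp x k v"
  by (auto simp: ramp_def)

lemma continuous_on_ramp [continuous_intros]: "continuous_on S (ramp x k)"
  unfolding ramp_def by (intro continuous_intros)

lemma sum_ramp:
  assumes "interval_partition N x" "n \<le> N"
  shows "(\<Sum>k\<in>{1..n}. ramp x k w) = max 0 (min (x n) w)"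
  using assms(2)
proof (induction n)
  case 0
  then show ?case
    using assms(1) by (simp add: interval_partition_def)
next
  case (Suc n)
  have "x n < x (Suc n)" "0 \<le> x n"
    using assms(1) Suc.prems interval_partition_range[OF assms(1), of n] by (auto simp: interval_partition_def)
  with Suc show ?case
    by (simp add: ramp_def)
qed

lemma sum_ramp_unit:
  assumes "interval_partition N x" "w \<in> {0..1}"
  shows "(\<Sum>k\<in>{1..N}. ramp x k w) = w"
  using sum_ramp[OF assms(1) order_refl, of w] assms by (simp add: interval_partition_def)

lemma ramp_partition_point:
  assumes "interval_partition N x" "k \<in> {1..N}" "m \<le> N"
  shows "ramp x k (x m) = (if k \<le> m then x k - x (k - 1) else 0)"
proof (cases "k \<le> m")
  case True
  then show ?thesis
    using interval_partition_le[OF assms(1), of k m] interval_partition_step[OF assms(1,2)] assms(3)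
    by (auto simp: ramp_def)
next
  case False
  then have "x m \<le> x (k - 1)"
    using assms(2) by (intro interval_partition_le[OF assms(1)]) auto
  with False show ?thesis
    by (auto simp: ramp_def)
qed

lemma ramp_other_piece:
  assumes "interval_partition N x" "k \<in> {1..N}" "j \<in> {1..N}" "k \<noteq> j" "u \<in> piece x j" "v \<in> piece x j"
  shows "ramp x k u = ramp x k v"
proof -
  have "x k \<le> x (j - 1) \<or> x j \<le> x (k - 1)"
  proof (cases "k < j")
    case True
    then show ?thesis using assms by (intro disjI1 interval_partition_le[OF assms(1)]) auto
  next
    case False
    then show ?thesis using assms by (intro disjI2 interval_partition_le[OF assms(1)]) auto
  qed
  then show ?thesis
    using interval_partition_step[OF assms(1,2)] assms(5,6) by (auto simp: ramp_def piece_def)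
qed

lemma ramp_own_piece: "u \<in> piece x j \<Longrightarrow> ramp x j u = u - x (j - 1)"
  by (auto simp: ramp_def piece_def)

lemma ramp_less_imp:
  assumes "ramp x k u < ramp x k v"
  shows "u < x k" "x (k - 1) < v"
  using assms by (auto simp: ramp_def min_def max_def split: if_splits)

section \<open>Slope families and their inverse branches\<close>

locale slope_family =
  fixes N :: nat and \<sigma> :: "nat \<Rightarrow> nat" and a :: "nat \<Rightarrow> nat \<Rightarrow> real"
  assumes sigma_le: "i \<le> N \<Longrightarrow> \<sigma> i \<le> N"
    and two_preimages: "j \<in> {1..N} \<Longrightarrow> 1 < (\<Sum>i\<in>{1..N}. A_star \<sigma> i j)"
    and admissible: "admissible_slopes N \<sigma> a"
    and column_sum: "j \<in> {1..N} \<Longrightarrow> (\<Sum>i\<in>{1..N}. A_mat \<sigma> a i j) = 1"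
begin

definition lo :: "nat \<Rightarrow> nat" where "lo i = min (\<sigma> (i - 1)) (\<sigma> i)"

definition hi :: "nat \<Rightarrow> nat" where "hi i = max (\<sigma> (i - 1)) (\<sigma> i)"

text \<open>The sign of the slopes in row \<open>i\<close>. For equal end values it follows the case
  distinction in \<open>admissible_slopes\<close>; the row of the matrix is then zero.\<close>

definition orient :: "nat \<Rightarrow> real" where "orient i = (if \<sigma> (i - 1) < \<sigma> i then 1 else -1)"

lemma A_star_iff: "A_star \<sigma> i j = 1 \<longleftrightarrow> lo i < j \<and> j \<le> hi i"
  by (simp add: A_star_def lo_def hi_def)

lemma hi_le: "i \<in> {1..N} \<Longrightarrow> hi i \<le> N"
  using sigma_le[of i] sigma_le[of "i - 1"] by (auto simp: hi_def)

lemma lo_le: "i \<in> {1..N} \<Longrightarrow> lo i \<le> N"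
  using sigma_le[of i] by (auto simp: lo_def)

lemma orient_abs [simp]: "\<bar>orient i\<bar> = 1"
  by (simp add: orient_def)

lemma A_mat_zero: "A_star \<sigma> i j \<noteq> 1 \<Longrightarrow> A_mat \<sigma> a i j = 0"
  by (simp add: A_mat_def)

lemma A_mat_eq:
  assumes "i \<in> {1..N}" "j \<in> {1..N}" "A_star \<sigma> i j = 1"
  shows "A_mat \<sigma> a i j = orient i * inverse (a i j)" "a i j \<noteq> 0"
proof -
  have "if \<sigma> (i - 1) < \<sigma> i then a i j > 0 else a i j < 0"
    using assms admissible unfolding admissible_slopes_def by blast
  then show "A_mat \<sigma> a i j = orient i * inverse (a i j)" "a i j \<noteq> 0"
    using assms(3) by (auto simp: A_mat_def orient_def split: if_splits)
qed

lemma A_mat_nonneg: "0 \<le> A_mat \<sigma> a i j"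
  by (simp add: A_mat_def)

lemma A_mat_pos:
  assumes "i \<in> {1..N}" "j \<in> {1..N}" "A_star \<sigma> i j = 1"
  shows "0 < A_mat \<sigma> a i j"
  using A_mat_eq(2)[OF assms] assms(3) by (simp add: A_mat_def)

lemma A_mat_less_1:
  assumes "i \<in> {1..N}" "j \<in> {1..N}"
  shows "A_mat \<sigma> a i j < 1"
proof -
  obtain i' where i': "i' \<in> {1..N} - {i}" "A_star \<sigma> i' j = 1"
  proof (rule ccontr)
    assume "\<not> thesis"
    with that have "A_star \<sigma> i' j = 0" if "i' \<in> {1..N} - {i}" for i'
      using that by (metis A_star_def)
    then have "(\<Sum>i'\<in>{1..N} - {i}. A_star \<sigma> i' j) = 0"
      by simp
    then have "(\<Sum>i'\<in>{1..N}. A_star \<sigma> i' j) = A_star \<sigma> i j"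
      using assms(1) by (subst sum.remove[of _ i]) auto
    also have "\<dots> \<le> 1"
      by (simp add: A_star_def)
    finally show False
      using two_preimages[OF assms(2)] by simp
  qed
  have "0 < A_mat \<sigma> a i' j"
    using i' assms by (intro A_mat_pos) auto
  also have "\<dots> \<le> (\<Sum>i'\<in>{1..N} - {i}. A_mat \<sigma> a i' j)"
    using i' by (intro member_le_sum) (auto intro: A_mat_nonneg)
  also have "\<dots> = 1 - A_mat \<sigma> a i j"
    using column_sum[OF assms(2)] assms(1) by (simp add: sum_diff1)
  finally show ?thesis by simp
qed

text \<open>A common contraction rate of all branches. The inserted \<open>1 / 2\<close> keeps the
  set nonempty and the maximum positive, so that \<open>inverse contr\<close> can serve as an
  expansion constant.\<close>

definition contr :: real where
  "contr = Max (insert (1 / 2) ((\<lambda>(i, j). A_mat \<sigma> a i j) ` ({1..N} \<times> {1..N})))"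

lemma contr_bounds: "0 < contr" "contr < 1"
proof -
  have "1 / 2 \<le> contr"
    unfolding contr_def by (intro Max_ge) auto
  then show "0 < contr" by simp
  show "contr < 1"
    unfolding contr_def by (subst Max_less_iff) (auto intro!: A_mat_less_1)
qed

lemma A_mat_le_contr: "i \<in> {1..N} \<Longrightarrow> j \<in> {1..N} \<Longrightarrow> A_mat \<sigma> a i j \<le> contr"
  unfolding contr_def by (intro Max_ge) auto

text \<open>The inverse of an associated map on the \<open>i\<close>-th piece, if \<open>x\<close> is its partition.\<close>

definition branch :: "(nat \<Rightarrow> real) \<Rightarrow> nat \<Rightarrow> real \<Rightarrow> real" where
  "branch x i w = x (i - 1) +
     orient i * (\<Sum>k\<in>{1..N}. A_mat \<sigma> a i k * (ramp x k w - ramp x k (x (\<sigma> (i - 1)))))"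

lemma branch_diff:
  "branch x i v - branch x i u = orient i * (\<Sum>k\<in>{1..N}. A_mat \<sigma> a i k * (ramp x k v - ramp x k u))"
  by (simp add: branch_def right_diff_distrib sum_subtractf)

lemma continuous_on_branch: "continuous_on S (branch x i)"
  unfolding branch_def by (intro continuous_intros)

lemma branch_start: "branch x i (x (\<sigma> (i - 1))) = x (i - 1)"
  by (simp add: branch_def)

lemma branch_mono:
  assumes "u \<le> v"
  shows "orient i * branch x i u \<le> orient i * branch x i v"
proof -
  have "0 \<le> (\<Sum>k\<in>{1..N}. A_mat \<sigma> a i k * (ramp x k v - ramp x k u))"
    using ramp_mono[OF assms] by (intro sum_nonneg mult_nonneg_nonneg A_mat_nonneg) simp
  also have "\<dots> = orient i * (branch x i v - branch x i u)"
    unfolding branch_diff by (simp add: orient_def)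
  finally show ?thesis by (simp add: right_diff_distrib)
qed

context
  fixes x :: "nat \<Rightarrow> real"
  assumes part: "interval_partition N x"
begin

text \<open>Between the images of the two ends exactly the ramps with a positive entry in row
  \<open>i\<close> change, each by its full length, and \<open>orient\<close> cancels the direction
  of travel. So the branch ends at \<open>x i\<close> precisely if the lengths are stationary in row
  \<open>i\<close>.\<close>

lemma branch_end:
  assumes "i \<in> {1..N}"
  shows "branch x i (x (\<sigma> i)) = x (i - 1) + (\<Sum>k\<in>{1..N}. A_mat \<sigma> a i k * (x k - x (k - 1)))"
proof -
  have le: "\<sigma> i \<le> N" "\<sigma> (i - 1) \<le> N"
    using sigma_le[of i] sigma_le[of "i - 1"] assms by auto
  have "orient i * (A_mat \<sigma> a i k * (ramp x k (x (\<sigma> i)) - ramp x k (x (\<sigma> (i - 1))))) =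
      A_mat \<sigma> a i k * (x k - x (k - 1))" if "k \<in> {1..N}" for k
    using le unfolding ramp_partition_point[OF part that le(1)] ramp_partition_point[OF part that le(2)]
    by (auto simp: A_mat_def A_star_def orient_def min_def max_def split: if_splits)
  then show ?thesis
    unfolding branch_def sum_distrib_left by (intro arg_cong2[where f = "(+)"] refl sum.cong)
qed

text \<open>Each ramp has weight at most \<open>contr\<close>, and together the ramps form the
  projection to \<open>[0,1]\<close>, which does not increase distances.\<close>

lemma branch_lipschitz:
  assumes "i \<in> {1..N}"
  shows "\<bar>branch x i u - branch x i v\<bar> \<le> contr * \<bar>u - v\<bar>"
proof -
  have *: "\<bar>branch x i v - branch x i u\<bar> \<le> contr * \<bar>v - u\<bar>" if "u \<le> v" for u v
  proof -
    have "\<bar>branch x i v - branch x i u\<bar> = \<bar>\<Sum>k\<in>{1..N}. A_mat \<sigma> a i k * (ramp x k v - ramp x k u)\<bar>"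
      by (simp add: branch_diff abs_mult)
    also have "\<dots> = (\<Sum>k\<in>{1..N}. A_mat \<sigma> a i k * (ramp x k v - ramp x k u))"
      using ramp_mono[OF that] by (intro abs_of_nonneg sum_nonneg mult_nonneg_nonneg A_mat_nonneg) simp
    also have "\<dots> \<le> (\<Sum>k\<in>{1..N}. contr * (ramp x k v - ramp x k u))"
      using ramp_mono[OF that] A_mat_le_contr[OF assms] by (intro sum_mono mult_right_mono) simp_all
    also have "\<dots> = contr * (max 0 (min (x N) v) - max 0 (min (x N) u))"
      by (simp add: sum_subtractf sum_ramp[OF part order_refl, simplified] flip: sum_distrib_left)
    also have "\<dots> \<le> contr * (v - u)"
      using that contr_bounds by (intro mult_left_mono) auto
    finally show ?thesis using that by simp
  qed
  show ?thesis
    using *[of u v] *[of v u] by (cases "u \<le> v") (auto simp: abs_minus_commute)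
qed

lemma branch_affine:
  assumes "i \<in> {1..N}" "j \<in> {1..N}" "A_star \<sigma> i j = 1" "u \<in> piece x j" "v \<in> piece x j"
  shows "branch x i u - branch x i v = inverse (a i j) * (u - v)"
proof -
  have "(\<Sum>k\<in>{1..N}. A_mat \<sigma> a i k * (ramp x k u - ramp x k v)) = A_mat \<sigma> a i j * (u - v)"
    using ramp_other_piece[OF part _ assms(2) _ assms(4,5)] assms
    by (subst sum.remove[of _ j]) (auto simp: ramp_own_piece intro!: sum.neutral)
  then show ?thesis
    by (simp add: branch_diff A_mat_eq(1)[OF assms(1-3)]) (simp add: orient_def)
qed

text \<open>Some ramp grows strictly from \<open>u\<close> to \<open>v\<close>. Its piece meets the
  stretch between \<open>lo i\<close> and \<open>hi i\<close>, so its weight in row \<open>i\<close>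
  is positive.\<close>

lemma branch_strict_mono:
  assumes "i \<in> {1..N}" "x (lo i) \<le> u" "u < v" "v \<le> x (hi i)"
  shows "orient i * branch x i u < orient i * branch x i v"
proof -
  have uv: "u \<in> {0..1}" "v \<in> {0..1}"
    using assms interval_partition_range[OF part hi_le[OF assms(1)]]
      interval_partition_range[OF part lo_le[OF assms(1)]] by auto
  have "(\<Sum>k\<in>{1..N}. ramp x k u) < (\<Sum>k\<in>{1..N}. ramp x k v)"
    using assms(3) by (simp only: sum_ramp_unit[OF part] uv)
  then obtain k where k: "k \<in> {1..N}" "ramp x k u < ramp x k v"
    by (meson not_less sum_mono)
  have "x (lo i) < x k" "x (k - 1) < x (hi i)"
    using ramp_less_imp[OF k(2)] assms by auto
  then have "lo i < k" "k \<le> hi i"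
    using k interval_partition_less_iff[OF part] lo_le[OF assms(1)] hi_le[OF assms(1)]
    by fastforce+
  then have "0 < A_mat \<sigma> a i k"
    using k assms(1) by (intro A_mat_pos) (auto simp: A_star_iff)
  then have "0 < A_mat \<sigma> a i k * (ramp x k v - ramp x k u)"
    using k by simp
  also have "\<dots> \<le> (\<Sum>k\<in>{1..N}. A_mat \<sigma> a i k * (ramp x k v - ramp x k u))"
    using k assms(3) by (intro member_le_sum mult_nonneg_nonneg A_mat_nonneg) (auto intro: ramp_mono)
  also have "\<dots> = orient i * (branch x i v - branch x i u)"
    unfolding branch_diff by (simp add: orient_def)
  finally show ?thesis by (simp add: right_diff_distrib)
qed

lemma branch_inj:
  assumes "i \<in> {1..N}"
  shows "inj_on (branch x i) {x (lo i)..x (hi i)}"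
proof (rule inj_onI)
  fix u v
  assume uv: "u \<in> {x (lo i)..x (hi i)}" "v \<in> {x (lo i)..x (hi i)}" "branch x i u = branch x i v"
  then have "\<not> u < v" "\<not> v < u"
    using branch_strict_mono[OF assms, of u v] branch_strict_mono[OF assms, of v u] by auto
  then show "u = v" by simp
qed

end

section \<open>Associated maps with an explicit partition\<close>

definition assoc_with :: "(nat \<Rightarrow> real) \<Rightarrow> (real \<Rightarrow> real) \<Rightarrow> bool" where
  "assoc_with x t \<longleftrightarrow> cont_interval_map t \<and> interval_partition N x \<and>
     (\<forall>i\<le>N. t (x i) = x (\<sigma> i)) \<and>
     (\<forall>i\<in>{1..N}. monotone_map_on (piece x i) t) \<and>
     (\<forall>i\<in>{1..N}. \<forall>j\<in>{1..N}. A_star \<sigma> i j = 1 \<longrightarrow>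
        affine_with_slope_on (a i j) (piece x i \<inter> t -` piece x j) t)"

lemma associated_iff: "associated N \<sigma> a t \<longleftrightarrow> (\<exists>x. assoc_with x t)"
  by (auto simp: associated_def assoc_with_def)

definition stationary_lengths :: "(nat \<Rightarrow> real) \<Rightarrow> bool" where
  "stationary_lengths x \<longleftrightarrow>
     (\<forall>i\<in>{1..N}. x i - x (i - 1) = (\<Sum>k\<in>{1..N}. A_mat \<sigma> a i k * (x k - x (k - 1))))"

lemma stationary_nonconstant:
  assumes "interval_partition N x" "stationary_lengths x" "i \<in> {1..N}"
  shows "\<sigma> (i - 1) \<noteq> \<sigma> i"
proof
  assume "\<sigma> (i - 1) = \<sigma> i"
  then have "A_mat \<sigma> a i k = 0" for k
    by (intro A_mat_zero) (simp add: A_star_def)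
  then have "x i - x (i - 1) = 0"
    using assms(2,3) by (simp add: stationary_lengths_def)
  then show False
    using interval_partition_step[OF assms(1,3)] by simp
qed

lemma assoc_with_range:
  assumes "assoc_with x t" "i \<in> {1..N}" "z \<in> piece x i"
  shows "x (lo i) \<le> t z" "t z \<le> x (hi i)"
proof -
  have part: "interval_partition N x" and ends: "t (x (i - 1)) = x (\<sigma> (i - 1))" "t (x i) = x (\<sigma> i)"
    and mon: "monotone_map_on (piece x i) t"
    using assms(1,2) by (auto simp: assoc_with_def)
  have "x (i - 1) \<in> piece x i" "x i \<in> piece x i"
    using interval_partition_step[OF part assms(2)] by (auto simp: piece_def)
  then have "t z \<in> {min (t (x (i - 1))) (t (x i))..max (t (x (i - 1))) (t (x i))}"
    using mon assms(3) unfolding monotone_map_on_def monotone_on_def piece_def by auto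
  moreover have "x (lo i) \<le> min (x (\<sigma> (i - 1))) (x (\<sigma> i))" "max (x (\<sigma> (i - 1))) (x (\<sigma> i)) \<le> x (hi i)"
    using interval_partition_le[OF part, of "\<sigma> i" "\<sigma> (i - 1)"]
      interval_partition_le[OF part, of "\<sigma> (i - 1)" "\<sigma> i"] sigma_le[of i] sigma_le[of "i - 1"] assms(2)
    by (auto simp: lo_def hi_def min_def max_def)
  ultimately show "x (lo i) \<le> t z" "t z \<le> x (hi i)"
    using ends by auto
qed

text \<open>
  The difference of the two sides is continuous and constant on each of the finitely many closed
  sets on which the map is affine, hence constant.
\<close>

lemma branch_assoc_with:
  assumes "assoc_with x t" "i \<in> {1..N}" "\<sigma> (i - 1) \<noteq> \<sigma> i" "z \<in> piece x i"
  shows "branch x i (t z) = z"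
proof -
  have part: "interval_partition N x" and start: "t (x (i - 1)) = x (\<sigma> (i - 1))"
    and cont: "continuous_on {0..1} t"
    and aff: "\<And>j. j \<in> {1..N} \<Longrightarrow> A_star \<sigma> i j = 1 \<Longrightarrow>
        affine_with_slope_on (a i j) (piece x i \<inter> t -` piece x j) t"
    using assms(1,2) by (auto simp: assoc_with_def cont_interval_map_def)
  define D where "D z = branch x i (t z) - z" for z
  define J where "J = {j \<in> {1..N}. A_star \<sigma> i j = 1}"
  have "continuous_on (piece x i) t"
    using cont piece_subset[OF part assms(2)] by (rule continuous_on_subset)
  then have "continuous_on (piece x i) D"
    unfolding D_def
    by (intro continuous_intros continuous_on_compose2[OF continuous_on_branch[of UNIV]]) auto
  moreover have "finite (D ` piece x i)"
  proof -
    have "D ` piece x i \<subseteq> (\<Union>j\<in>J. D ` (piece x i \<inter> t -` piece x j))"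
    proof
      fix y assume "y \<in> D ` piece x i"
      then obtain z where z: "z \<in> piece x i" "y = D z" by auto
      have "lo i < hi i"
        using assms(3) by (simp add: lo_def hi_def)
      then obtain j where j: "lo i < j" "j \<le> hi i" "t z \<in> piece x j"
        using interval_partition_cover[OF part, of "lo i" "hi i" "t z"]
          assoc_with_range[OF assms(1,2) z(1)] hi_le[OF assms(2)]
        by blast
      then have "j \<in> J"
        using hi_le[OF assms(2)] by (auto simp: J_def A_star_iff)
      with j z show "y \<in> (\<Union>j\<in>J. D ` (piece x i \<inter> t -` piece x j))"
        by blast
    qed
    moreover have "finite (D ` (piece x i \<inter> t -` piece x j))" if "j \<in> J" for j
    proof -
      have j: "j \<in> {1..N}" "A_star \<sigma> i j = 1"
        using that by (auto simp: J_def)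
      have "D u = D v" if "u \<in> piece x i \<inter> t -` piece x j" "v \<in> piece x i \<inter> t -` piece x j" for u v
      proof -
        have "t u - t v = a i j * (u - v)"
        proof -
          obtain b where "\<forall>y\<in>piece x i \<inter> t -` piece x j. t y = a i j * y + b"
            using aff[OF j] by (auto simp: affine_with_slope_on_def)
          then have "t u = a i j * u + b" "t v = a i j * v + b"
            using that by blast+
          then show ?thesis
            by (simp add: right_diff_distrib)
        qed
        moreover have "branch x i (t u) - branch x i (t v) = inverse (a i j) * (t u - t v)"
          using that by (intro branch_affine[OF part assms(2) j]) auto
        ultimately have "branch x i (t u) - branch x i (t v) = u - v"
          using A_mat_eq(2)[OF assms(2) j] by (simp flip: mult.assoc)
        then show ?thesis
          by (simp add: D_def)
      qed
      then have "\<exists>c. D ` (piece x i \<inter> t -` piece x j) \<subseteq> {c}"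
        by blast
      then show ?thesis
        using finite_subset by blast
    qed
    moreover have "finite J"
      by (simp add: J_def)
    ultimately show ?thesis
      using finite_subset[of "D ` piece x i"] by blast
  qed
  ultimately have "D constant_on piece x i"
    by (intro continuous_finite_range_constant) (auto simp: piece_def)
  moreover have "x (i - 1) \<in> piece x i"
    using interval_partition_step[OF part assms(2)] by (auto simp: piece_def)
  moreover have "D (x (i - 1)) = 0"
    by (simp add: D_def start branch_start)
  ultimately have "D z = 0"
    using assms(4) unfolding constant_on_def by metis
  then show ?thesis by (simp add: D_def)
qed

text \<open>
  The lengths sum up to the same number on both sides, so the constant pieces, which would
  contribute a positive length on one side only, do not exist.
\<close>

lemma assoc_with_stationary:
  assumes "assoc_with x t"
  shows "stationary_lengths x"
proof -
  have part: "interval_partition N x"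
    using assms by (simp add: assoc_with_def)
  define l where "l i = x i - x (i - 1)" for i
  define f where "f i = (\<Sum>k\<in>{1..N}. A_mat \<sigma> a i k * l k)" for i
  have le: "f i \<le> l i" if i: "i \<in> {1..N}" for i
  proof (cases "\<sigma> (i - 1) = \<sigma> i")
    case True
    then have "f i = 0"
      unfolding f_def by (intro sum.neutral ballI) (simp add: A_mat_def A_star_def)
    then show ?thesis
      using interval_partition_step[OF part i] by (simp add: l_def)
  next
    case False
    have "x i \<in> piece x i"
      using interval_partition_step[OF part i] by (auto simp: piece_def)
    moreover have "t (x i) = x (\<sigma> i)"
      using assms i by (simp add: assoc_with_def)
    ultimately have "branch x i (x (\<sigma> i)) = x i"
      using branch_assoc_with[OF assms i False, of "x i"] by simp
    then show ?thesis
      using branch_end[OF part i] by (simp add: f_def l_def)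
  qed
  have "sum f {1..N} = (\<Sum>k\<in>{1..N}. (\<Sum>i\<in>{1..N}. A_mat \<sigma> a i k) * l k)"
    unfolding f_def by (subst sum.swap) (simp add: sum_distrib_right)
  also have "\<dots> = sum l {1..N}"
    using column_sum by (intro sum.cong) auto
  finally have eq: "f i = l i" if "i \<in> {1..N}" for i
    using sum_mono_inv[of f "{1..N}" l i] le that by auto
  show ?thesis
    unfolding stationary_lengths_def
  proof
    fix i
    assume "i \<in> {1..N}"
    from eq[OF this, symmetric] show "x i - x (i - 1) = (\<Sum>k\<in>{1..N}. A_mat \<sigma> a i k * (x k - x (k - 1)))"
      by (simp only: f_def l_def)
  qed
qed

text \<open>Both values at a point are sent to that point by the same injective branch, since no
  piece is constant.\<close>

lemma assoc_with_unique:
  assumes "assoc_with x t" "assoc_with x t'"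
  shows "t = t'"
proof (rule extensionalityI[of _ "{0..1}"])
  show "t \<in> extensional {0..1}" "t' \<in> extensional {0..1}"
    using assms by (auto simp: assoc_with_def cont_interval_map_def PiE_iff)
  fix z :: real assume z: "z \<in> {0..1}"
  have part: "interval_partition N x"
    using assms by (simp add: assoc_with_def)
  obtain i where i: "i \<in> {1..N}" "z \<in> piece x i"
    using piece_cover[OF part z] .
  have "\<sigma> (i - 1) \<noteq> \<sigma> i"
    using stationary_nonconstant[OF part assoc_with_stationary[OF assms(1)] i(1)] .
  then have "branch x i (t z) = branch x i (t' z)"
    using branch_assoc_with[OF assms(1) i(1) _ i(2)] branch_assoc_with[OF assms(2) i(1) _ i(2)] by simp
  then show "t z = t' z"
    by (rule inj_onD[OF branch_inj[OF part i(1)]])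
      (simp_all add: assoc_with_range[OF assms(1) i] assoc_with_range[OF assms(2) i])
qed

end

lemma Union_piece:
  assumes "interval_partition N x"
  shows "(\<Union>i\<in>{1..N}. piece x i) = {0..1}"
proof
  show "{0..1} \<subseteq> (\<Union>i\<in>{1..N}. piece x i)"
  proof
    fix y :: real
    assume "y \<in> {0..1}"
    then obtain i where "i \<in> {1..N}" "y \<in> piece x i"
      using piece_cover[OF assms] by blast
    then show "y \<in> (\<Union>i\<in>{1..N}. piece x i)" by blast
  qed
qed (use piece_subset[OF assms] in blast)

context slope_family begin

text \<open>The graph of \<open>t\<close> is the union of the graphs of the branches with the
  coordinates exchanged. Stationarity makes branch \<open>i\<close> end where branch
  \<open>i + 1\<close> starts, which glues them to a function.\<close>

lemma assoc_with_exists: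
  assumes part: "interval_partition N x" and stat: "stationary_lengths x"
  shows "\<exists>t. assoc_with x t"
proof -
  note nonconst = stationary_nonconstant[OF part stat]
  have end': "branch x i (x (\<sigma> i)) = x i" if "i \<in> {1..N}" for i
    using branch_end[OF part that] bspec[OF stat[unfolded stationary_lengths_def] that] by linarith
  have mem: "x (\<sigma> i) \<in> {x (lo i)..x (hi i)}" "x (\<sigma> (i - 1)) \<in> {x (lo i)..x (hi i)}"
    if "i \<in> {1..N}" for i
    using interval_partition_le[OF part] sigma_le[of i] sigma_le[of "i - 1"] that
    by (auto simp: lo_def hi_def)
  \<comment> \<open>Connectedness shows that the branch covers its piece, and monotonicity that it
    does not leave it.\<close>
  have image: "branch x i ` {x (lo i)..x (hi i)} = piece x i" if i: "i \<in> {1..N}" for i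
  proof -
    let ?S = "{x (lo i)..x (hi i)}"
    have le: "x (i - 1) \<le> x i"
      using interval_partition_step[OF part i] by simp
    have "connected (branch x i ` ?S)"
      by (intro connected_continuous_image continuous_on_branch) auto
    moreover have "x i \<in> branch x i ` ?S" "x (i - 1) \<in> branch x i ` ?S"
      using mem[OF i] end'[OF i] branch_start[of x i] by (metis image_eqI)+
    ultimately have "piece x i \<subseteq> branch x i ` ?S"
      unfolding piece_def by (metis connected_contains_Icc)
    moreover have "branch x i w \<in> piece x i" if w: "w \<in> ?S" for w
    proof (cases "\<sigma> (i - 1) < \<sigma> i")
      case True
      then have lh: "lo i = \<sigma> (i - 1)" "hi i = \<sigma> i" "orient i = 1"
        by (auto simp: lo_def hi_def orient_def)
      then show ?thesis
        using branch_mono[of "x (lo i)" w i x] branch_mono[of w "x (hi i)" i x] w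
          branch_start[of x i] end'[OF i] by (auto simp: piece_def)
    next
      case False
      with nonconst[OF i] have lh: "lo i = \<sigma> i" "hi i = \<sigma> (i - 1)" "orient i = -1"
        by (auto simp: lo_def hi_def orient_def)
      then show ?thesis
        using branch_mono[of "x (lo i)" w i x] branch_mono[of w "x (hi i)" i x] w
          branch_start[of x i] end'[OF i] by (auto simp: piece_def)
    qed
    ultimately show ?thesis by blast
  qed
  define R where "R z w \<longleftrightarrow> (\<exists>i\<in>{1..N}. w \<in> {x (lo i)..x (hi i)} \<and> branch x i w = z)" for z w
  have end_unique: "w = x (\<sigma> i)" if "i \<in> {1..N}" "w \<in> {x (lo i)..x (hi i)}" "branch x i w = x i" for i w
    by (rule inj_onD[OF branch_inj[OF part that(1)] _ that(2) mem(1)[OF that(1)]])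
      (simp only: that(3) end'[OF that(1)])
  have start_unique: "w = x (\<sigma> (i - 1))" if "i \<in> {1..N}" "w \<in> {x (lo i)..x (hi i)}" "branch x i w = x (i - 1)" for i w
    by (rule inj_onD[OF branch_inj[OF part that(1)] _ that(2) mem(2)[OF that(1)]])
      (simp only: that(3) branch_start)
  \<comment> \<open>Two different pieces share at most a common end point \<open>x i\<close>, and
    there both branches have the argument \<open>x (\<sigma> i)\<close>.\<close>
  have lt: "w = w'" if "i < j" and i: "i \<in> {1..N}" "w \<in> {x (lo i)..x (hi i)}" "branch x i w = z"
    and j: "j \<in> {1..N}" "w' \<in> {x (lo j)..x (hi j)}" "branch x j w' = z" for i j w w' z
  proof -
    have "z \<in> piece x i" "z \<in> piece x j"
      using image[OF i(1)] i(2,3) image[OF j(1)] j(2,3) by (metis imageI)+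
    then have "z = x i" "j = Suc i"
      using piece_Int[OF part i(1) j(1) that(1)] by auto
    then show ?thesis
      using end_unique[OF i(1,2)] start_unique[OF j(1,2)] i j by simp
  qed
  have R_unique: "w = w'" if "R z w" "R z w'" for z w w'
  proof -
    obtain i j where ij: "i \<in> {1..N}" "w \<in> {x (lo i)..x (hi i)}" "branch x i w = z"
        "j \<in> {1..N}" "w' \<in> {x (lo j)..x (hi j)}" "branch x j w' = z"
      using \<open>R z w\<close> \<open>R z w'\<close> unfolding R_def by blast
    consider "i < j" | "j < i" | "i = j" by linarith
    then show ?thesis
    proof cases
      case 3
      then show ?thesis using inj_onD[OF branch_inj[OF part ij(1)] _ ij(2)] ij by metis
    qed (use lt[of i j] lt[of j i] ij in metis)+
  qed
  define t where "t z = (if z \<in> {0..1} then THE w. R z w else undefined)" for z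
  have t_branch: "t (branch x i w) = w" if "i \<in> {1..N}" "w \<in> {x (lo i)..x (hi i)}" for i w
  proof -
    have "R (branch x i w) w"
      using that by (auto simp: R_def)
    moreover have "branch x i w \<in> {0..1}"
      using image[OF that(1)] piece_subset[OF part that(1)] that(2) by blast
    ultimately show ?thesis
      unfolding t_def using R_unique by (auto intro!: the_equality)
  qed
  have t: "t z \<in> {x (lo i)..x (hi i)}" "branch x i (t z) = z" if i: "i \<in> {1..N}" and z: "z \<in> piece x i" for i z
  proof -
    obtain w where "w \<in> {x (lo i)..x (hi i)}" "branch x i w = z"
      using z unfolding image[OF i, symmetric] by blast
    then show "t z \<in> {x (lo i)..x (hi i)}" "branch x i (t z) = z"
      using t_branch[OF i] by auto
  qed
  \<comment> \<open>On each piece \<open>t\<close> is the inverse of a continuous injection on a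
    compact interval, hence continuous; finitely many closed pieces cover the interval.\<close>
  have "continuous_on (\<Union>i\<in>{1..N}. piece x i) t"
  proof (rule continuous_on_closed_Union)
    show "closed (piece x i)" for i by (simp add: piece_def)
    show "continuous_on (piece x i) t" if "i \<in> {1..N}" for i
      unfolding image[OF that, symmetric]
      by (rule continuous_on_inv) (use t_branch[OF that] continuous_on_branch in auto)
  qed auto
  moreover have "(\<Union>i\<in>{1..N}. piece x i) = {0..1}"
    by (rule Union_piece[OF part])
  ultimately have "continuous_on {0..1} t" by simp
  moreover have "t \<in> {0..1} \<rightarrow>\<^sub>E {0..1}"
  proof (rule PiE_I)
    fix z :: real assume "z \<in> {0..1}"
    then obtain i where i: "i \<in> {1..N}" "z \<in> piece x i"
      by (rule piece_cover[OF part])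
    show "t z \<in> {0..1}"
      using t(1)[OF i] interval_partition_range[OF part] hi_le[OF i(1)] lo_le[OF i(1)] by fastforce
  qed (auto simp: t_def)
  moreover have "t (x i) = x (\<sigma> i)" if "i \<le> N" for i
  proof (cases "i = 0")
    case True
    have "N \<noteq> 0"
      using part by (intro notI) (auto simp: interval_partition_def)
    then show ?thesis
      using t_branch[of 1 "x (\<sigma> 0)"] mem(2)[of 1] branch_start[of x 1] True by simp
  next
    case False
    then show ?thesis
      using t_branch[of i "x (\<sigma> i)"] mem(1)[of i] end'[of i] that by simp
  qed
  moreover have "monotone_map_on (piece x i) t" if i: "i \<in> {1..N}" for i
  proof -
    have *: "orient i * u < orient i * v" if "u \<in> piece x i" "v \<in> piece x i" "t u < t v" for u v
      using branch_strict_mono[OF part i, of "t u" "t v"] t[OF i] that by auto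
    show ?thesis
    proof (cases "\<sigma> (i - 1) < \<sigma> i")
      case True
      then have "mono_on (piece x i) t"
        using * by (intro mono_onI) (force simp: orient_def not_less[symmetric])
      then show ?thesis by (simp add: monotone_map_on_def)
    next
      case False
      then have "antimono_on (piece x i) t"
        using * by (intro monotone_onI) (force simp: orient_def not_less[symmetric])
      then show ?thesis by (simp add: monotone_map_on_def)
    qed
  qed
  moreover have "affine_with_slope_on (a i j) (piece x i \<inter> t -` piece x j) t"
    if ij: "i \<in> {1..N}" "j \<in> {1..N}" "A_star \<sigma> i j = 1" for i j
  proof -
    have "t u - t v = a i j * (u - v)" if "u \<in> piece x i \<inter> t -` piece x j" "v \<in> piece x i \<inter> t -` piece x j" for u v
      using branch_affine[OF part ij, of "t u" "t v"] t(2)[OF ij(1)] that A_mat_eq(2)[OF ij]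
      by (auto simp: field_simps)
    note diff = this
    show ?thesis
    proof (cases "piece x i \<inter> t -` piece x j = {}")
      case False
      then obtain v where v: "v \<in> piece x i \<inter> t -` piece x j" by blast
      have "t u = a i j * u + (t v - a i j * v)" if "u \<in> piece x i \<inter> t -` piece x j" for u
        using diff[OF that v] by (simp add: right_diff_distrib)
      then show ?thesis
        unfolding affine_with_slope_on_def by blast
    qed (simp add: affine_with_slope_on_def)
  qed
  ultimately show ?thesis
    using part unfolding assoc_with_def cont_interval_map_def by blast
qed

lemma assoc_with_onto:
  assumes "assoc_with x t" "i \<in> {1..N}" "w \<in> {x (lo i)..x (hi i)}"
  shows "branch x i w \<in> piece x i" "t (branch x i w) = w"
proof -
  have part: "interval_partition N x" and ends: "t (x (i - 1)) = x (\<sigma> (i - 1))" "t (x i) = x (\<sigma> i)"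
    and cont: "continuous_on {0..1} t"
    using assms(1,2) by (auto simp: assoc_with_def cont_interval_map_def)
  have "connected (t ` piece x i)"
    using continuous_on_subset[OF cont piece_subset[OF part assms(2)]]
    by (intro connected_continuous_image) (auto simp: piece_def)
  moreover have "x (i - 1) \<in> piece x i" "x i \<in> piece x i"
    using interval_partition_step[OF part assms(2)] by (auto simp: piece_def)
  then have "x (\<sigma> (i - 1)) \<in> t ` piece x i" "x (\<sigma> i) \<in> t ` piece x i"
    by (simp_all flip: ends)
  then have "x (lo i) \<in> t ` piece x i" "x (hi i) \<in> t ` piece x i"
    by (simp_all add: lo_def hi_def min_def max_def)
  ultimately obtain z where z: "z \<in> piece x i" "w = t z"
    using assms(3) by (meson connected_contains_Icc imageE subsetD)
  have "branch x i w = z"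
    using branch_assoc_with[OF assms(1,2) _ z(1)] z(2)
      stationary_nonconstant[OF part assoc_with_stationary[OF assms(1)] assms(2)] by simp
  with z show "branch x i w \<in> piece x i" "t (branch x i w) = w"
    by auto
qed

lemma assoc_with_expands:
  assumes "assoc_with x t" "i \<in> {1..N}" "y \<in> piece x i" "z \<in> piece x i"
  shows "\<bar>y - z\<bar> \<le> contr * \<bar>t y - t z\<bar>"
proof -
  have part: "interval_partition N x"
    using assms(1) by (simp add: assoc_with_def)
  have nc: "\<sigma> (i - 1) \<noteq> \<sigma> i"
    using stationary_nonconstant[OF part assoc_with_stationary[OF assms(1)] assms(2)] .
  show ?thesis
    using branch_lipschitz[OF part assms(2), of "t y" "t z"]
      branch_assoc_with[OF assms(1,2) nc assms(3)] branch_assoc_with[OF assms(1,2) nc assms(4)] by simp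
qed

lemma assoc_with_expanding_Markov:
  assumes "assoc_with x t"
  shows "expanding_Markov t"
proof -
  have part: "interval_partition N x" and pts: "\<forall>i\<le>N. t (x i) = x (\<sigma> i)"
    and mon: "\<forall>i\<in>{1..N}. monotone_map_on (piece x i) t" and cont: "cont_interval_map t"
    using assms by (auto simp: assoc_with_def)
  have "(t ^^ k) (x i) \<in> x ` {..N}" if "i \<le> N" for k i
    using that pts sigma_le by (induction k) auto
  then have "endpoint_orbits N x t \<subseteq> x ` {..N}"
    by (auto simp: endpoint_orbits_def)
  then have "finite (endpoint_orbits N x t)"
    by (rule finite_subset) simp
  moreover have "inverse contr * \<bar>y - z\<bar> \<le> \<bar>t y - t z\<bar>"
    if "i \<in> {1..N}" "y \<in> piece x i" "z \<in> piece x i" for i y z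
    using assoc_with_expands[OF assms that] contr_bounds by (simp add: field_simps)
  moreover have "inverse contr > 1"
    using contr_bounds by (simp add: one_less_inverse)
  ultimately show ?thesis
    using part mon cont unfolding expanding_Markov_def piecewise_monotone_wrt_def by blast
qed

lemma assoc_with_inj:
  assumes "assoc_with x t" "i \<in> {1..N}"
  shows "inj_on t (piece x i)"
proof (rule inj_onI)
  fix y z
  assume "y \<in> piece x i" "z \<in> piece x i" "t y = t z"
  then show "y = z"
    using assoc_with_expands[OF assms, of y z] by simp
qed

end

section \<open>Preservation of Lebesgue measure\<close>

lemma interval_partition_of_finite:
  fixes B :: "real set"
  assumes "finite B" "B \<subseteq> {0..1}" "0 \<in> B" "1 \<in> B"
  obtains n y where "interval_partition n y" "y ` {..n} = B"
proof -
  define xs where "xs = sorted_list_of_set B"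
  have set: "set xs = B" and sorted: "sorted_wrt (<) xs"
    using assms(1) by (simp_all add: xs_def)
  have len: "length xs > 0"
    using set assms(3) by auto
  define n where "n = length xs - 1"
  have n: "i < length xs \<longleftrightarrow> i \<le> n" for i
    using len unfolding n_def by arith
  have less: "xs ! i < xs ! j" if "i < j" "j \<le> n" for i j
    using sorted_wrt_nth_less[OF sorted that(1)] that n by simp
  have le: "xs ! i \<le> xs ! j" if "i \<le> j" "j \<le> n" for i j
    using less[of i j] that by (cases "i = j") auto
  have img: "(!) xs ` {..n} = B"
    using set n by (auto simp: set_conv_nth image_iff)
  obtain i j where ij: "i \<le> n" "xs ! i = 0" "j \<le> n" "xs ! j = 1"
    using img assms(3,4) by (metis (mono_tags, lifting) atMost_iff imageE)
  have "xs ! 0 \<in> B" "xs ! n \<in> B"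
    using img by auto
  then have "xs ! 0 \<in> {0..1}" "xs ! n \<in> {0..1}"
    using assms(2) by auto
  moreover have "xs ! 0 \<le> 0" "1 \<le> xs ! n"
    using le[of 0 i] le[of j n] ij by auto
  ultimately have "xs ! 0 = 0" "xs ! n = 1"
    by auto
  then have "interval_partition n ((!) xs)"
    using less by (auto simp: interval_partition_def)
  then show ?thesis
    using img that by blast
qed

text \<open>Different open pieces are disjoint, and what they omit is finite, hence negligible for
  the measure.\<close>

definition open_piece :: "(nat \<Rightarrow> real) \<Rightarrow> nat \<Rightarrow> real set" where
  "open_piece x i = {x (i - 1)<..<x i}"

lemma open_piece_cover:
  assumes "interval_partition N x" "w \<in> {0..1}" "w \<notin> x ` {..N}"
  obtains j where "j \<in> {1..N}" "w \<in> open_piece x j"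
proof -
  obtain j where j: "j \<in> {1..N}" "w \<in> piece x j"
    using piece_cover[OF assms(1,2)] .
  then have "w \<noteq> x j" "w \<noteq> x (j - 1)"
    using assms(3) by auto
  with j show ?thesis
    by (intro that[of j]) (auto simp: open_piece_def piece_def)
qed

lemma open_piece_partition_point:
  assumes "interval_partition N x" "j \<in> {1..N}" "m \<le> N"
  shows "x m \<notin> open_piece x j"
proof (cases "j \<le> m")
  case True
  then show ?thesis
    using interval_partition_le[OF assms(1) _ assms(3)] by (force simp: open_piece_def)
next
  case False
  with assms(2) have "x m \<le> x (j - 1)"
    by (intro interval_partition_le[OF assms(1)]) auto
  then show ?thesis
    by (auto simp: open_piece_def)
qed

lemma open_piece_Int:
  assumes "interval_partition N x" "i \<in> {1..N}" "j \<in> {1..N}" "i \<noteq> j"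
  shows "open_piece x i \<inter> open_piece x j = {}"
proof -
  have "open_piece x i \<inter> open_piece x j = {}" if "i < j" "i \<in> {1..N}" "j \<in> {1..N}" for i j
  proof -
    have "x i \<le> x (j - 1)"
      using that by (intro interval_partition_le[OF assms(1)]) auto
    then show ?thesis
      by (auto simp: open_piece_def)
  qed
  from this[of i j] this[of j i] show ?thesis
    using assms by (cases "i < j") auto
qed

lemma emeasure_lborel_affine_image:
  assumes "S \<in> sets borel" "c \<noteq> 0"
  shows "(\<lambda>w. c * w + d) ` S \<in> sets borel"
    "emeasure lborel ((\<lambda>w. c * w + d) ` S) = ennreal \<bar>c\<bar> * emeasure lborel (S :: real set)"
proof -
  have "(\<lambda>w. c * w + d) ` S = (\<lambda>z. (z - d) / c) -` S"
    using assms(2) by (auto simp: image_iff intro!: bexI[of _ "(_ - d) / c"])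
  also have "\<dots> \<in> sets borel"
    using assms(1) by (intro measurable_sets_borel[OF _ assms(1)]) measurable
  finally show *: "(\<lambda>w. c * w + d) ` S \<in> sets borel" .
  have "emeasure lebesgue ((\<lambda>w. c * w + d) ` S) = ennreal \<bar>c\<bar> * emeasure lebesgue S"
    using emeasure_lebesgue_affine[of c d S] by simp
  then show "emeasure lborel ((\<lambda>w. c * w + d) ` S) = ennreal \<bar>c\<bar> * emeasure lborel S"
    using * assms(1) by simp
qed

context slope_family begin

context
  fixes x t
  assumes assoc: "assoc_with x t"
begin

lemma assoc_part: "interval_partition N x"
  using assoc by (simp add: assoc_with_def)

lemma assoc_nonconstant: "i \<in> {1..N} \<Longrightarrow> \<sigma> (i - 1) \<noteq> \<sigma> i"
  using stationary_nonconstant[OF assoc_part assoc_with_stationary[OF assoc]] .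

lemma assoc_unit: "z \<in> {0..1} \<Longrightarrow> t z \<in> {0..1}"
  using assoc by (auto simp: assoc_with_def cont_interval_map_def)

lemma assoc_continuous: "continuous_on {0..1} t"
  using assoc by (simp add: assoc_with_def cont_interval_map_def)

text \<open>Affinity is prescribed only where a piece is mapped into a single piece, so the
  candidates for break points are the preimages of partition points.\<close>

definition breaks :: "real set" where
  "breaks = {z \<in> {0..1}. t z \<in> x ` {..N}}"

lemma partition_breaks: "x ` {..N} \<subseteq> breaks"
  using assoc sigma_le interval_partition_range[OF assoc_part]
  by (auto simp: breaks_def assoc_with_def)

lemma finite_breaks: "finite breaks"
proof -
  have "breaks \<subseteq> (\<Union>i\<in>{1..N}. t -` (x ` {..N}) \<inter> piece x i)"
    using Union_piece[OF assoc_part] by (auto simp: breaks_def)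
  moreover have "finite (\<Union>i\<in>{1..N}. t -` (x ` {..N}) \<inter> piece x i)"
    using assoc_with_inj[OF assoc] by (intro finite_UN_I finite_vimage_IntI) auto
  ultimately show ?thesis
    by (rule finite_subset)
qed

text \<open>If \<open>t\<close> left the piece between \<open>m\<close> and \<open>w\<close>, it
  would take the value \<open>x j\<close> or \<open>x (j - 1)\<close> strictly between
  \<open>u\<close> and \<open>v\<close>, at a break. The case of an end point \<open>w\<close> is
  included since only values other than \<open>t w\<close> are used.\<close>

lemma image_in_piece:
  assumes "0 \<le> u" "v \<le> 1" "{u<..<v} \<inter> breaks = {}" "m \<in> {u<..<v}" "j \<in> {1..N}" "t m \<in> piece x j" "w \<in> {u..v}"
  shows "t w \<in> piece x j"
proof -
  define S where "S = {min w m..max w m}"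
  have "S \<subseteq> {0..1}"
    using assms by (auto simp: S_def)
  then have "connected (t ` S)"
    using continuous_on_subset[OF assoc_continuous] by (intro connected_continuous_image) (auto simp: S_def)
  then have ivt: "{min (t w) (t m)..max (t w) (t m)} \<subseteq> t ` S"
    by (intro connected_contains_Icc) (auto simp: S_def min_def max_def)
  have *: False if k: "k \<le> N" "x k \<in> {min (t w) (t m)..max (t w) (t m)}" "x k \<noteq> t w" for k
  proof -
    obtain y where y: "y \<in> S" "t y = x k"
      using ivt k(2) by (metis imageE subsetD)
    then have "y \<noteq> w"
      using k(3) by auto
    with y(1) have "y \<in> {u<..<v}"
      using assms by (auto simp: S_def min_def max_def split: if_splits)
    moreover have "y \<in> breaks"
      using y k(1) \<open>S \<subseteq> {0..1}\<close> by (auto simp: breaks_def)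
    ultimately show False
      using assms(3) by blast
  qed
  show ?thesis
    using *[of j] *[of "j - 1"] assms(5,6) by (fastforce simp: piece_def)
qed

lemma assoc_with_piecewise_affine: "\<exists>n y. piecewise_affine_wrt n y t"
proof -
  have "0 \<in> x ` {..N}" "1 \<in> x ` {..N}"
    using assoc_part by (force simp: interval_partition_def)+
  then obtain n y where y: "interval_partition n y" "y ` {..n} = breaks"
    using interval_partition_of_finite[of breaks] finite_breaks partition_breaks
    by (metis (no_types, lifting) breaks_def mem_Collect_eq subsetD subsetI)
  have "\<exists>m. affine_with_slope_on m (piece y k) t" if k: "k \<in> {1..n}" for k
  proof -
    let ?u = "y (k - 1)" and ?v = "y k"
    have uv: "?u < ?v" "0 \<le> ?u" "?v \<le> 1"
      using interval_partition_step[OF y(1) k] interval_partition_range[OF y(1), of k]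
        interval_partition_range[OF y(1), of "k - 1"] k by auto
    have gap: "{?u<..<?v} \<inter> breaks = {}"
    proof (rule ccontr)
      assume "{?u<..<?v} \<inter> breaks \<noteq> {}"
      then obtain b where b: "b \<in> y ` {..n}" "b \<in> {?u<..<?v}"
        unfolding y(2) by blast
      then obtain l where "l \<le> n" "b = y l" by blast
      with b(2) show False
        using open_piece_partition_point[OF y(1) k, of l] unfolding open_piece_def by simp
    qed
    \<comment> \<open>An interior point of the gap selects \<open>i\<close> and \<open>j\<close>,
      because the end points of the gap may belong to two pieces.\<close>
    define m where "m = (?u + ?v) / 2"
    have m: "m \<in> {?u<..<?v}" "m \<in> {0..1}"
      using uv by (auto simp: m_def)
    obtain i where i: "i \<in> {1..N}" "m \<in> piece x i"
      using piece_cover[OF assoc_part m(2)] .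
    have "x i \<in> breaks" "x (i - 1) \<in> breaks"
      using partition_breaks i(1) by auto
    with gap have "x i \<notin> {?u<..<?v}" "x (i - 1) \<notin> {?u<..<?v}"
      by blast+
    then have sub: "piece y k \<subseteq> piece x i"
      using i(2) m by (auto simp: piece_def)
    have "lo i < hi i"
      using assoc_nonconstant[OF i(1)] by (simp add: lo_def hi_def)
    then obtain j where j: "lo i < j" "j \<le> hi i" "t m \<in> piece x j"
      using interval_partition_cover[OF assoc_part, of "lo i" "hi i" "t m"]
        assoc_with_range[OF assoc i] hi_le[OF i(1)] by blast
    then have j': "j \<in> {1..N}" "A_star \<sigma> i j = 1"
      using hi_le[OF i(1)] by (auto simp: A_star_iff)
    have "piece y k \<subseteq> piece x i \<inter> t -` piece x j"
      using sub image_in_piece[OF uv(2,3) gap m(1) j'(1) j(3)] by (auto simp: piece_def)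
    moreover have "affine_with_slope_on (a i j) (piece x i \<inter> t -` piece x j) t"
      using assoc i j' by (auto simp: assoc_with_def)
    ultimately show ?thesis
      unfolding affine_with_slope_on_def by blast
  qed
  with y(1) show ?thesis
    unfolding piecewise_affine_wrt_def by blast
qed

text \<open>Up to the finite set \<open>breaks\<close>, the preimage of \<open>A\<close> is the
  disjoint union of the cells \<open>T (i, j)\<close>, which are affine images of \<open>S j\<close>
  scaled by \<open>A_mat \<sigma> a i j\<close>. Summing over \<open>i\<close> first leaves the
  measure of \<open>S j\<close>.\<close>

lemma assoc_with_preserves:
  assumes A: "A \<in> sets borel" "A \<subseteq> {0..1}"
  shows "emeasure lborel (t -` A \<inter> {0..1}) = emeasure lborel A"
proof -
  define Q where "Q = {(i, j) \<in> {1..N} \<times> {1..N}. A_star \<sigma> i j = 1}"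
  define S where "S j = A \<inter> open_piece x j" for j
  define T where "T = (\<lambda>(i, j). piece x i \<inter> t -` S j)"
  have S: "S j \<in> sets borel" for j
    using A(1) by (auto simp: S_def open_piece_def)
  have T: "T p \<in> sets borel"
    "emeasure lborel (T p) = ennreal (A_mat \<sigma> a (fst p) (snd p)) * emeasure lborel (S (snd p))"
    if pQ: "p \<in> Q" for p
  proof -
    obtain i j where p: "p = (i, j)" and ij: "i \<in> {1..N}" "j \<in> {1..N}" "A_star \<sigma> i j = 1"
      using pQ by (auto simp: Q_def)
    have open_sub: "open_piece x j \<subseteq> piece x j"
      by (auto simp: open_piece_def piece_def)
    have range: "piece x j \<subseteq> {x (lo i)..x (hi i)}"
      using ij(3) interval_partition_le[OF assoc_part, of "lo i" "j - 1"]
        interval_partition_le[OF assoc_part, of j "hi i"] hi_le[OF ij(1)] ij(2)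
      by (auto simp: A_star_iff piece_def)
    have "T p = branch x i ` S j"
    proof
      show "T p \<subseteq> branch x i ` S j"
      proof
        fix z assume "z \<in> T p"
        then have z: "z \<in> piece x i" "t z \<in> S j"
          by (simp_all add: T_def p)
        then show "z \<in> branch x i ` S j"
          using branch_assoc_with[OF assoc ij(1) assoc_nonconstant[OF ij(1)] z(1)]
          by (intro image_eqI[of z _ "t z"]) simp_all
      qed
      show "branch x i ` S j \<subseteq> T p"
      proof
        fix z assume "z \<in> branch x i ` S j"
        then obtain w where w: "z = branch x i w" "w \<in> S j" by blast
        then have "w \<in> {x (lo i)..x (hi i)}"
          using range open_sub by (auto simp: S_def)
        with w show "z \<in> T p"
          using assoc_with_onto[OF assoc ij(1), of w] by (simp add: T_def p)
      qed
    qed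
    also have "\<dots> = (\<lambda>w. inverse (a i j) * w + (branch x i (x j) - inverse (a i j) * x j)) ` S j"
    proof (rule image_cong)
      fix w assume "w \<in> S j"
      moreover have "x j \<in> piece x j"
        using interval_partition_step[OF assoc_part ij(2)] by (auto simp: piece_def)
      ultimately have "branch x i w - branch x i (x j) = inverse (a i j) * (w - x j)"
        using open_sub by (intro branch_affine[OF assoc_part ij]) (auto simp: S_def)
      then show "branch x i w = inverse (a i j) * w + (branch x i (x j) - inverse (a i j) * x j)"
        by (simp add: right_diff_distrib)
    qed simp
    finally have Tp: "T p = \<dots>" .
    have nz: "inverse (a i j) \<noteq> 0"
      using A_mat_eq(2)[OF ij] by simp
    show "T p \<in> sets borel"
      unfolding Tp by (rule emeasure_lborel_affine_image(1)[OF S nz])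
    have "A_mat \<sigma> a i j = \<bar>inverse (a i j)\<bar>"
      using ij(3) by (simp add: A_mat_def)
    then show "emeasure lborel (T p) = ennreal (A_mat \<sigma> a (fst p) (snd p)) * emeasure lborel (S (snd p))"
      unfolding Tp emeasure_lborel_affine_image(2)[OF S nz] by (simp add: p)
  qed
  \<comment> \<open>Cells with different \<open>j\<close> have disjoint images under
    \<open>t\<close>. Cells with the same \<open>j\<close> could meet only in a partition point,
    whose image is a partition point and so not in an open piece.\<close>
  have disjT: "disjoint_family_on T Q"
    unfolding disjoint_family_on_def
  proof (intro ballI impI)
    fix p q assume pq: "p \<in> Q" "q \<in> Q" "p \<noteq> q"
    obtain i j i' j' where p: "p = (i, j)" "q = (i', j')" and ij: "i \<in> {1..N}" "j \<in> {1..N}"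
      "i' \<in> {1..N}" "j' \<in> {1..N}"
      using pq by (auto simp: Q_def)
    have False if z: "z \<in> T p" "z \<in> T q" for z
    proof -
      have tz: "t z \<in> open_piece x j" "t z \<in> open_piece x j'"
        and zi: "z \<in> piece x i" "z \<in> piece x i'"
        using z by (auto simp: T_def p S_def)
      have "j = j'"
        using open_piece_Int[OF assoc_part ij(2,4)] tz by blast
      with pq p have "i \<noteq> i'" by simp
      then have "z \<in> x ` {..N}"
        using piece_Int(1)[OF assoc_part ij(1,3) _ zi] piece_Int(1)[OF assoc_part ij(3,1) _ zi(2,1)] ij
        by (cases "i < i'") auto
      then have "t z \<in> x ` {..N}"
        using partition_breaks by (auto simp: breaks_def)
      then show False
        using open_piece_partition_point[OF assoc_part ij(2)] tz(1) by auto
    qed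
    then show "T p \<inter> T q = {}" by blast
  qed
  have "t -` A \<inter> {0..1} = (\<Union>p\<in>Q. T p) \<union> (t -` A \<inter> breaks)"
  proof
    show "(\<Union>p\<in>Q. T p) \<union> (t -` A \<inter> breaks) \<subseteq> t -` A \<inter> {0..1}"
      using piece_subset[OF assoc_part] by (fastforce simp: T_def S_def Q_def breaks_def)
    show "t -` A \<inter> {0..1} \<subseteq> (\<Union>p\<in>Q. T p) \<union> (t -` A \<inter> breaks)"
    proof
      fix z assume z: "z \<in> t -` A \<inter> {0..1}"
      show "z \<in> (\<Union>p\<in>Q. T p) \<union> (t -` A \<inter> breaks)"
      proof (cases "z \<in> breaks")
        case False
        obtain i where i: "i \<in> {1..N}" "z \<in> piece x i"
          using piece_cover[OF assoc_part, of z] z by auto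
        have "t z \<notin> x ` {..N}"
          using False z by (auto simp: breaks_def)
        then obtain j where j: "j \<in> {1..N}" "t z \<in> open_piece x j"
          using open_piece_cover[OF assoc_part assoc_unit] z by blast
        have "x (lo i) < x j" "x (j - 1) < x (hi i)"
          using assoc_with_range[OF assoc i] j(2) by (auto simp: open_piece_def)
        then have "lo i < j" "j - 1 < hi i"
          using interval_partition_less_iff[OF assoc_part] lo_le[OF i(1)] hi_le[OF i(1)] j(1)
          by auto
        then have "A_star \<sigma> i j = 1"
          by (simp add: A_star_iff)
        then have "(i, j) \<in> Q" "z \<in> T (i, j)"
          using i j z by (auto simp: Q_def T_def S_def)
        then show ?thesis by blast
      qed (use z in simp)
    qed
  qed
  moreover have "t -` A \<inter> breaks \<in> null_sets lborel"
    using finite_breaks by (intro finite_imp_null_set_lborel) auto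
  moreover have "finite Q"
    by (rule finite_subset[of _ "{1..N} \<times> {1..N}"]) (auto simp: Q_def)
  ultimately have "emeasure lborel (t -` A \<inter> {0..1}) = (\<Sum>p\<in>Q. emeasure lborel (T p))"
    using T(1) disjT by (subst sum_emeasure) (auto intro!: emeasure_Un_null_set)
  also have "\<dots> = (\<Sum>(i, j)\<in>Q. ennreal (A_mat \<sigma> a i j) * emeasure lborel (S j))"
    by (intro sum.cong refl) (use T(2) in force)
  also have "\<dots> = (\<Sum>(i, j)\<in>{1..N} \<times> {1..N}. ennreal (A_mat \<sigma> a i j) * emeasure lborel (S j))"
    by (intro sum.mono_neutral_left) (auto simp: Q_def A_mat_def split: if_splits)
  also have "\<dots> = (\<Sum>j\<in>{1..N}. \<Sum>i\<in>{1..N}. ennreal (A_mat \<sigma> a i j) * emeasure lborel (S j))"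
    by (subst sum.swap) (simp add: sum.cartesian_product)
  also have "\<dots> = (\<Sum>j\<in>{1..N}. emeasure lborel (S j))"
    by (intro sum.cong refl)
      (simp add: sum_ennreal A_mat_nonneg column_sum flip: sum_distrib_right)
  also have "\<dots> = emeasure lborel (\<Union>j\<in>{1..N}. S j)"
    using S open_piece_Int[OF assoc_part] by (intro sum_emeasure) (fastforce simp: disjoint_family_on_def S_def)+
  also have "\<dots> = emeasure lborel ((\<Union>j\<in>{1..N}. S j) \<union> (A \<inter> x ` {..N}))"
    using S by (intro emeasure_Un_null_set[symmetric] finite_imp_null_set_lborel) auto
  also have "(\<Union>j\<in>{1..N}. S j) \<union> (A \<inter> x ` {..N}) = A"
  proof
    show "A \<subseteq> (\<Union>j\<in>{1..N}. S j) \<union> (A \<inter> x ` {..N})"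
    proof
      fix w assume w: "w \<in> A"
      show "w \<in> (\<Union>j\<in>{1..N}. S j) \<union> (A \<inter> x ` {..N})"
      proof (cases "w \<in> x ` {..N}")
        case False
        then obtain j where "j \<in> {1..N}" "w \<in> open_piece x j"
          using open_piece_cover[OF assoc_part, of w] w A(2) by blast
        then show ?thesis
          using w by (auto simp: S_def)
      qed (use w in simp)
    qed
  qed (auto simp: S_def)
  finally show ?thesis .
qed

lemma assoc_with_PA_lambda: "t \<in> PA_lambda"
  using assoc assoc_with_piecewise_affine assoc_with_preserves
  by (auto simp: PA_lambda_def assoc_with_def)

end

end

section \<open>Topological conjugacy\<close>

lemma gap_in_piece:
  assumes "interval_partition N y" "0 \<le> u" "u < v" "v \<le> 1" "\<And>k. k \<le> N \<Longrightarrow> y k \<notin> {u<..<v}"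
  obtains j where "j \<in> {1..N}" "u \<in> piece y j" "v \<in> piece y j"
proof -
  have "(u + v) / 2 \<in> {0..1}"
    using assms(2-4) by auto
  then obtain j where j: "j \<in> {1..N}" "(u + v) / 2 \<in> piece y j"
    using piece_cover[OF assms(1)] by blast
  have "j \<le> N" "j - 1 \<le> N"
    using j(1) by auto
  then have "y j \<notin> {u<..<v}" "y (j - 1) \<notin> {u<..<v}"
    using assms(5) by blast+
  with j show ?thesis
    using assms(3) by (intro that[of j]) (auto simp: piece_def not_less)
qed

text \<open>An element above \<open>Sup Q / c\<close> would be followed by one above the
  supremum.\<close>

lemma bounded_growth_empty:
  fixes Q :: "real set"
  assumes "c > 1" "\<And>q. q \<in> Q \<Longrightarrow> 0 < q \<and> q \<le> M" "\<And>q. q \<in> Q \<Longrightarrow> \<exists>q'\<in>Q. c * q \<le> q'"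
  shows "Q = {}"
proof (rule ccontr)
  assume Q: "Q \<noteq> {}"
  have bdd: "bdd_above Q"
    using assms(2) by (meson bdd_aboveI)
  obtain q where q: "q \<in> Q" using Q by blast
  have pos: "0 < Sup Q"
    using cSup_upper[OF q bdd] assms(2)[OF q] by linarith
  then have "Sup Q / c < Sup Q"
    using assms(1) by (simp add: divide_less_eq)
  then obtain q where q: "q \<in> Q" "Sup Q / c < q"
    using less_cSupE[OF _ Q] by blast
  then obtain q' where q': "q' \<in> Q" "c * q \<le> q'"
    using assms(3) by blast
  have "Sup Q < c * q"
    using q(2) assms(1) by (simp add: divide_less_eq mult.commute)
  then show False
    using cSup_upper[OF q'(1) bdd] q'(2) by linarith
qed

section \<open>The semiconjugacy from \<open>s\<close> to the associated map\<close>

locale markov_pair = slope_family +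
  fixes x y :: "nat \<Rightarrow> real" and s :: "real \<Rightarrow> real"
  assumes px: "interval_partition N x" and stat: "stationary_lengths x"
    and py: "interval_partition N y"
    and s_cont: "cont_interval_map s"
    and s_points: "i \<le> N \<Longrightarrow> s (y i) = y (\<sigma> i)"
    and s_mono: "i \<in> {1..N} \<Longrightarrow> monotone_map_on (piece y i) s"
begin

lemma nonconstant: "i \<in> {1..N} \<Longrightarrow> \<sigma> (i - 1) \<noteq> \<sigma> i"
  using stationary_nonconstant[OF px stat] .

lemma end_points: "i \<in> {1..N} \<Longrightarrow> y (i - 1) \<in> piece y i \<and> y i \<in> piece y i"
  using interval_partition_step[OF py] by (force simp: piece_def)

lemma s_unit: "z \<in> {0..1} \<Longrightarrow> s z \<in> {0..1}"
  using s_cont by (auto simp: cont_interval_map_def)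

text \<open>Monotonicity of \<open>s\<close> leaves the direction open. The values at the two ends
  of the piece differ by stationarity of \<open>x\<close>, and they decide it.\<close>

lemma s_orient:
  assumes i: "i \<in> {1..N}" and uv: "u \<in> piece y i" "v \<in> piece y i" "u \<le> v"
  shows "orient i * s u \<le> orient i * s v"
proof -
  have le: "y (i - 1) \<le> y i"
    using interval_partition_step[OF py i] by simp
  have ends: "s (y (i - 1)) = y (\<sigma> (i - 1))" "s (y i) = y (\<sigma> i)"
    using s_points i by auto
  have sig: "\<sigma> (i - 1) \<le> N" "\<sigma> i \<le> N"
    using sigma_le[of i] sigma_le[of "i - 1"] i by auto
  show ?thesis
  proof (cases "\<sigma> (i - 1) < \<sigma> i")
    case True
    then have "s (y (i - 1)) < s (y i)"
      using interval_partition_less[OF py True] sig ends by simp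
    then have "\<not> antimono_on (piece y i) s"
      using end_points[OF i] le by (force simp: monotone_on_def)
    then show ?thesis
      using s_mono[OF i] uv True by (auto simp: monotone_map_on_def monotone_on_def orient_def)
  next
    case False
    then have "\<sigma> i < \<sigma> (i - 1)"
      using nonconstant[OF i] by simp
    then have "s (y i) < s (y (i - 1))"
      using interval_partition_less[OF py] sig ends by simp
    then have "\<not> mono_on (piece y i) s"
      using end_points[OF i] le by (force simp: monotone_on_def)
    then show ?thesis
      using s_mono[OF i] uv False by (auto simp: monotone_map_on_def monotone_on_def orient_def)
  qed
qed

lemma s_range:
  assumes i: "i \<in> {1..N}" and z: "z \<in> piece y i"
  shows "s z \<in> {y (lo i)..y (hi i)}"
proof -
  have ends: "s (y (i - 1)) = y (\<sigma> (i - 1))" "s (y i) = y (\<sigma> i)"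
    using s_points i by auto
  have "orient i * y (\<sigma> (i - 1)) \<le> orient i * s z" "orient i * s z \<le> orient i * y (\<sigma> i)"
    using s_orient[OF i, of "y (i - 1)" z] s_orient[OF i, of z "y i"] end_points[OF i] z ends
    by (auto simp: piece_def)
  then show ?thesis
    using nonconstant[OF i] by (auto simp: orient_def lo_def hi_def min_def max_def split: if_splits)
qed

lemma branch_end': "i \<in> {1..N} \<Longrightarrow> branch x i (x (\<sigma> i)) = x i"
  using branch_end[OF px, of i] bspec[OF stat[unfolded stationary_lengths_def], of i] by linarith

text \<open>The candidates for a semiconjugacy, a class preserved by \<open>pull\<close>. That
  partition points correspond makes the branches fit together.\<close>

definition good :: "(real \<Rightarrow> real) \<Rightarrow> bool" where
  "good h \<longleftrightarrow> continuous_on {0..1} h \<and> (\<forall>u v. 0 \<le> u \<and> u \<le> v \<and> v \<le> 1 \<longrightarrow> h u \<le> h v) \<and>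
     (\<forall>i\<le>N. h (y i) = x i)"

lemma goodD:
  assumes "good h"
  shows "continuous_on {0..1} h" "0 \<le> u \<Longrightarrow> u \<le> v \<Longrightarrow> v \<le> 1 \<Longrightarrow> h u \<le> h v" "i \<le> N \<Longrightarrow> h (y i) = x i"
  using assms by (auto simp: good_def)

lemma good_ends:
  assumes "good h"
  shows "h 0 = 0" "h 1 = 1"
  using goodD(3)[OF assms, of 0] goodD(3)[OF assms, of N] px py by (auto simp: interval_partition_def)

lemma good_unit:
  assumes "good h" "z \<in> {0..1}"
  shows "h z \<in> {0..1}"
  using goodD(2)[OF assms(1), of 0 z] goodD(2)[OF assms(1), of z 1] good_ends[OF assms(1)] assms(2) by auto

definition pull :: "(real \<Rightarrow> real) \<Rightarrow> real \<Rightarrow> real" where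
  "pull h z = branch x (LEAST i. i \<in> {1..N} \<and> z \<in> piece y i) (h (s z))"

text \<open>The choice made by \<open>LEAST\<close> matters only at a common end point
  \<open>y k\<close>. There \<open>h (s z) = x (\<sigma> k)\<close>, and both adjacent branches send
  this to \<open>x k\<close>.\<close>

lemma pull_eq:
  assumes h: "good h" and i: "i \<in> {1..N}" "z \<in> piece y i"
  shows "pull h z = branch x i (h (s z))"
proof -
  define k where "k = (LEAST i. i \<in> {1..N} \<and> z \<in> piece y i)"
  have k: "k \<in> {1..N}" "z \<in> piece y k"
    using LeastI[of "\<lambda>i. i \<in> {1..N} \<and> z \<in> piece y i" i] i by (auto simp: k_def)
  have "k \<le> i"
    unfolding k_def using i by (intro Least_le) auto
  show ?thesis
  proof (cases "k = i")
    case False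
    with \<open>k \<le> i\<close> have "k < i" by simp
    then have z: "z = y k" "i = Suc k"
      using piece_Int[OF py k(1) i(1) _ k(2) i(2)] by auto
    then have hs: "h (s z) = x (\<sigma> k)"
      using s_points[of k] goodD(3)[OF h, of "\<sigma> k"] sigma_le[of k] k(1) by simp
    have "branch x k (h (s z)) = x k"
      using branch_end'[OF k(1)] hs by simp
    also have "\<dots> = branch x i (h (s z))"
      using branch_start[of x i] hs z(2) by simp
    finally show ?thesis
      by (simp add: pull_def k_def)
  qed (simp add: pull_def k_def)
qed

lemma good_pull:
  assumes h: "good h"
  shows "good (pull h)"
proof -
  have "continuous_on (\<Union>i\<in>{1..N}. piece y i) (pull h)"
  proof (rule continuous_on_closed_Union)
    show "closed (piece y i)" for i by (simp add: piece_def)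
    show "continuous_on (piece y i) (pull h)" if i: "i \<in> {1..N}" for i
    proof -
      have sub: "piece y i \<subseteq> {0..1}"
        using piece_subset[OF py i] .
      have cs: "continuous_on (piece y i) s"
        using s_cont continuous_on_subset[OF _ sub] by (auto simp: cont_interval_map_def)
      have "continuous_on (piece y i) (\<lambda>z. h (s z))"
        using sub s_unit by (intro continuous_on_compose2[OF goodD(1)[OF h] cs]) auto
      then have "continuous_on (piece y i) (\<lambda>z. branch x i (h (s z)))"
        by (intro continuous_on_compose2[OF continuous_on_branch[of UNIV]]) auto
      then show ?thesis
        using pull_eq[OF h i] by (simp cong: continuous_on_cong)
    qed
  qed simp
  then have "continuous_on {0..1} (pull h)"
    by (simp only: Union_piece[OF py])
  moreover have "pull h u \<le> pull h v" if "0 \<le> u" "u \<le> v" "v \<le> 1" for u v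
  proof (rule increasing_from_pieces[OF py that])
    fix i u v assume i: "i \<in> {1..N}" and uv: "u \<in> piece y i" "v \<in> piece y i" "u \<le> v"
    have "s u \<in> {0..1}" "s v \<in> {0..1}"
      using s_unit piece_subset[OF py i] uv by blast+
    \<comment> \<open>The orientation of \<open>s\<close> on the piece and that of the branch are
      the same, so the signs cancel.\<close>
    then have "orient i * h (s u) \<le> orient i * h (s v)"
      using s_orient[OF i uv] goodD(2)[OF h, of "s u" "s v"] goodD(2)[OF h, of "s v" "s u"]
      by (auto simp: orient_def)
    then have "branch x i (h (s u)) \<le> branch x i (h (s v))"
      using branch_mono[of "h (s u)" "h (s v)" i x] branch_mono[of "h (s v)" "h (s u)" i x]
      by (auto simp: orient_def split: if_splits)
    then show "pull h u \<le> pull h v"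
      using pull_eq[OF h i] uv by simp
  qed
  moreover have "pull h (y i) = x i" if "i \<le> N" for i
  proof (cases "i = 0")
    case True
    have "N \<noteq> 0"
      using px by (intro notI) (auto simp: interval_partition_def)
    then have 1: "1 \<in> {1..N}" by simp
    have "pull h (y 0) = branch x 1 (x (\<sigma> (1 - 1)))"
      using pull_eq[OF h 1, of "y 0"] end_points[OF 1] s_points[of 0] goodD(3)[OF h, of "\<sigma> 0"] sigma_le[of 0]
      by simp
    then show ?thesis
      using True by (simp only: branch_start) simp
  next
    case False
    with that have i: "i \<in> {1..N}" by simp
    then show ?thesis
      using pull_eq[OF h i, of "y i"] end_points[OF i] s_points[of i] goodD(3)[OF h, of "\<sigma> i"] sigma_le[of i]
        branch_end'[OF i] by simp
  qed
  ultimately show ?thesis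
    by (auto simp: good_def)
qed

text \<open>The piecewise linear interpolation that sends each \<open>y i\<close> to
  \<open>x i\<close>.\<close>

definition start :: "real \<Rightarrow> real" where
  "start z = (\<Sum>k\<in>{1..N}. (x k - x (k - 1)) / (y k - y (k - 1)) * ramp y k z)"

lemma good_start: "good start"
proof -
  have "continuous_on {0..1} start"
    unfolding start_def by (intro continuous_intros)
  moreover have "start u \<le> start v" if "u \<le> v" for u v
    unfolding start_def
    using interval_partition_step[OF px] interval_partition_step[OF py] ramp_mono[OF that]
    by (intro sum_mono mult_left_mono divide_nonneg_nonneg) (auto simp: less_imp_le)
  moreover have "start (y i) = x i" if i: "i \<le> N" for i
  proof -
    have "start (y i) = (\<Sum>k\<in>{1..N}. ramp x k (x i))"
      unfolding start_def
    proof (rule sum.cong)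
      fix k assume k: "k \<in> {1..N}"
      show "(x k - x (k - 1)) / (y k - y (k - 1)) * ramp y k (y i) = ramp x k (x i)"
        using interval_partition_step[OF py k]
        by (simp add: ramp_partition_point[OF px k i] ramp_partition_point[OF py k i])
    qed simp
    then show ?thesis
      using sum_ramp_unit[OF px interval_partition_range[OF px i]] by simp
  qed
  ultimately show ?thesis
    by (simp add: good_def)
qed

definition approx :: "nat \<Rightarrow> real \<Rightarrow> real" where
  "approx n = (pull ^^ n) start"

lemma good_approx: "good (approx n)"
  unfolding approx_def by (induction n) (auto intro: good_start good_pull)

lemma approx_Suc:
  assumes "i \<in> {1..N}" "z \<in> piece y i"
  shows "approx (Suc n) z = branch x i (approx n (s z))"
  using pull_eq[OF good_approx[of n] assms] by (simp add: approx_def)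

lemma approx_close:
  assumes "z \<in> {0..1}"
  shows "\<bar>approx (Suc n) z - approx n z\<bar> \<le> contr ^ n"
  using assms
proof (induction n arbitrary: z)
  case 0
  then show ?case
    using good_unit[OF good_approx, of z 0] good_unit[OF good_approx, of z "Suc 0"] by (auto simp: abs_le_iff)
next
  case (Suc n)
  obtain i where i: "i \<in> {1..N}" "z \<in> piece y i"
    using piece_cover[OF py Suc.prems] .
  have "\<bar>approx (Suc (Suc n)) z - approx (Suc n) z\<bar> \<le> contr * \<bar>approx (Suc n) (s z) - approx n (s z)\<bar>"
    unfolding approx_Suc[OF i] by (rule branch_lipschitz[OF px i(1)])
  also have "\<dots> \<le> contr * contr ^ n"
    using Suc.IH[OF s_unit[OF Suc.prems]] contr_bounds by (intro mult_left_mono) auto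
  finally show ?case by simp
qed

lemma semiconjugacy:
  obtains g where "good g" "\<And>i z. i \<in> {1..N} \<Longrightarrow> z \<in> piece y i \<Longrightarrow> g z = branch x i (g (s z))"
proof -
  \<comment> \<open>The approximations are partial sums of a telescoping series dominated by the
    powers of \<open>contr\<close>, hence they converge uniformly.\<close>
  define f where "f n z = approx (Suc n) z - approx n z" for n z
  define g where "g z = approx 0 z + (\<Sum>n. f n z)" for z
  have sum_f: "approx 0 z + (\<Sum>i<n. f i z) = approx n z" for n z
    unfolding f_def by (subst sum_lessThan_telescope) simp
  have "uniform_limit {0..1} (\<lambda>n z. \<Sum>i<n. f i z) (\<lambda>z. \<Sum>n. f n z) sequentially"
    using approx_close contr_bounds
    by (intro Weierstrass_m_test[of _ _ "\<lambda>n. contr ^ n"]) (auto simp: f_def intro!: summable_geometric)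
  then have "uniform_limit {0..1} (\<lambda>n z. approx 0 z + (\<Sum>i<n. f i z)) g sequentially"
    unfolding g_def by (intro uniform_limit_add uniform_limit_const)
  then have lim: "uniform_limit {0..1} approx g sequentially"
    unfolding sum_f by simp
  have ptw: "(\<lambda>n. approx n z) \<longlonglongrightarrow> g z" if "z \<in> {0..1}" for z
    by (rule tendsto_uniform_limitI[OF lim that])
  have "continuous_on {0..1} g"
    using lim goodD(1)[OF good_approx] by (intro uniform_limit_theorem[OF _ lim]) auto
  moreover have "g u \<le> g v" if "0 \<le> u" "u \<le> v" "v \<le> 1" for u v
    using goodD(2)[OF good_approx that] that by (intro LIMSEQ_le[OF ptw ptw]) auto
  moreover have "g (y i) = x i" if "i \<le> N" for i
  proof -
    have "(\<lambda>n. approx n (y i)) \<longlonglongrightarrow> x i"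
      by (simp add: goodD(3)[OF good_approx that])
    then show ?thesis
      using LIMSEQ_unique ptw[OF interval_partition_range[OF py that]] by blast
  qed
  ultimately have "good g"
    by (simp add: good_def)
  moreover have "g z = branch x i (g (s z))" if i: "i \<in> {1..N}" and z: "z \<in> piece y i" for i z
  proof -
    have z01: "z \<in> {0..1}"
      using piece_subset[OF py i] z by blast
    have "isCont (branch x i) (g (s z))"
      using continuous_on_branch[of UNIV x i] by (simp add: continuous_on_eq_continuous_at)
    then have "(\<lambda>n. branch x i (approx n (s z))) \<longlonglongrightarrow> branch x i (g (s z))"
      using ptw[OF s_unit[OF z01]] by (rule isCont_tendsto_compose)
    then have "(\<lambda>n. approx (Suc n) z) \<longlonglongrightarrow> branch x i (g (s z))"
      by (simp only: approx_Suc[OF i z])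
    then show ?thesis
      using LIMSEQ_Suc[OF ptw[OF z01]] LIMSEQ_unique by blast
  qed
  ultimately show ?thesis
    using that by blast
qed

text \<open>
  Expansion with respect to a metric that is rescaled by the factor \<open>w i\<close> on the \<open>i\<close>-th piece.
  The rescaling matters for linear Markov maps, which may have slopes of absolute value at most one.
\<close>

definition weighted_expanding :: "(nat \<Rightarrow> real) \<Rightarrow> real \<Rightarrow> bool" where
  "weighted_expanding w c \<longleftrightarrow> c > 1 \<and> (\<forall>i\<in>{1..N}. w i > 0) \<and>
     (\<forall>i\<in>{1..N}. \<forall>j\<in>{1..N}. \<forall>u\<in>piece y i. \<forall>v\<in>piece y i. u < v \<longrightarrow> s u \<in> piece y j \<longrightarrow> s v \<in> piece y j \<longrightarrow>
        c * (w i * (v - u)) \<le> w j * \<bar>s u - s v\<bar>)"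

lemma semiconjugacy_inj:
  assumes W: "weighted_expanding w c" and g: "good g"
    and eq: "\<And>i z. i \<in> {1..N} \<Longrightarrow> z \<in> piece y i \<Longrightarrow> g z = branch x i (g (s z))"
  shows "inj_on g {0..1}"
proof -
  define F where "F u v \<longleftrightarrow> 0 \<le> u \<and> u < v \<and> v \<le> 1 \<and> g u = g v" for u v
  have c: "c > 1" and w: "\<And>i. i \<in> {1..N} \<Longrightarrow> w i > 0"
    using W by (auto simp: weighted_expanding_def)
  have expand: "c * (w i * (v - u)) \<le> w j * \<bar>s u - s v\<bar>"
    if "i \<in> {1..N}" "j \<in> {1..N}" "u \<in> piece y i" "v \<in> piece y i" "u < v" "s u \<in> piece y j" "s v \<in> piece y j" for i j u v
    using W that unfolding weighted_expanding_def by blast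
  have const: "g p = g u" if "F u v" "p \<in> {u..v}" for u v p
    using goodD(2)[OF g, of u p] goodD(2)[OF g, of p v] that by (auto simp: F_def)
  have one_point: "k = l" if "F u v" "k \<le> N" "l \<le> N" "y k \<in> {u..v}" "y l \<in> {u..v}" for u v k l
    using const[OF that(1,4)] const[OF that(1,5)] goodD(3)[OF g] that(2,3)
      interval_partition_eq_iff[OF px that(2,3)] by simp
  have image: "F (min (s u) (s v)) (max (s u) (s v))"
    if uv: "F u v" "i \<in> {1..N}" "u \<in> piece y i" "v \<in> piece y i" for u v i
  proof -
    have "s u \<in> {y (lo i)..y (hi i)}" "s v \<in> {y (lo i)..y (hi i)}"
      using s_range uv by blast+
    moreover have "y (lo i) \<in> {0..1}" "y (hi i) \<in> {0..1}"
      using interval_partition_range[OF py] lo_le hi_le uv(2) by blast+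
    moreover have "g (y (lo i)) = x (lo i)" "g (y (hi i)) = x (hi i)"
      using goodD(3)[OF g] lo_le hi_le uv(2) by blast+
    ultimately have range: "g (s u) \<in> {x (lo i)..x (hi i)}" "g (s v) \<in> {x (lo i)..x (hi i)}"
      using goodD(2)[OF g, of "y (lo i)" "s u"] goodD(2)[OF g, of "s u" "y (hi i)"]
        goodD(2)[OF g, of "y (lo i)" "s v"] goodD(2)[OF g, of "s v" "y (hi i)"] by auto
    have "branch x i (g (s u)) = branch x i (g (s v))"
      using eq[OF uv(2,3)] eq[OF uv(2,4)] uv(1) by (simp add: F_def)
    from inj_onD[OF branch_inj[OF px uv(2)] this range] have "g (s u) = g (s v)" .
    moreover have s01: "s u \<in> {0..1}" "s v \<in> {0..1}"
      using s_unit uv(1) by (auto simp: F_def)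
    \<comment> \<open>Equal images lie in a common piece, and the expansion estimate would then
      bound a positive length by zero.\<close>
    moreover have "s u \<noteq> s v"
    proof
      assume "s u = s v"
      moreover obtain j where "j \<in> {1..N}" "s u \<in> piece y j"
        using piece_cover[OF py s01(1)] .
      ultimately have "c * (w i * (v - u)) \<le> 0"
        using expand[of i j u v] uv by (auto simp: F_def)
      moreover have "0 < c * (w i * (v - u))"
        using c w[OF uv(2)] uv(1) by (auto simp: F_def)
      ultimately show False by simp
    qed
    ultimately show ?thesis
      by (auto simp: F_def min_def max_def)
  qed
  have fits: "\<exists>j\<in>{1..N}. u \<in> piece y j \<and> v \<in> piece y j"
    if "F u v" "\<And>k. k \<le> N \<Longrightarrow> y k \<notin> {u<..<v}" for u v
    using gap_in_piece[OF py, of u v] that by (metis F_def)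
  have grow: "\<exists>j\<in>{1..N}. min (s u) (s v) \<in> piece y j \<and> max (s u) (s v) \<in> piece y j \<and>
        c * (w i * (v - u)) \<le> w j * (max (s u) (s v) - min (s u) (s v))"
    if uv: "F u v" "i \<in> {1..N}" "u \<in> piece y i" "v \<in> piece y i"
      and no: "\<And>k. k \<le> N \<Longrightarrow> y k \<notin> {min (s u) (s v)<..<max (s u) (s v)}" for u v i
  proof -
    obtain j where j: "j \<in> {1..N}" "min (s u) (s v) \<in> piece y j" "max (s u) (s v) \<in> piece y j"
      using fits[OF image[OF uv] no] by blast
    then have "s u \<in> piece y j" "s v \<in> piece y j"
      by (auto simp: min_def max_def split: if_splits)
    moreover have "max (s u) (s v) - min (s u) (s v) = \<bar>s u - s v\<bar>"
      by (auto simp: min_def max_def)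
    ultimately show ?thesis
      using j expand[of i j u v] uv by (auto simp: F_def)
  qed
  have bound: "0 < w i * (v - u) \<and> w i * (v - u) \<le> sum w {1..N}" if "F u v" "i \<in> {1..N}" for u v i
  proof -
    have uv: "0 < v - u" "v - u \<le> 1"
      using that(1) by (auto simp: F_def)
    have "w i * (v - u) \<le> w i * 1"
      using w[OF that(2)] uv(2) by (intro mult_left_mono) auto
    also have "w i * 1 = w i"
      by simp
    also have "w i \<le> sum w {1..N}"
      using w that(2) by (intro member_le_sum) (auto intro: less_imp_le)
    finally show ?thesis
      using w[OF that(2)] uv(1) by simp
  qed
  have no_end: False if uv: "F u v" "u \<in> y ` {..N} \<or> v \<in> y ` {..N}" for u v
  proof -
    define Q where "Q = {w i * (v - u) | i u v. F u v \<and> (u \<in> y ` {..N} \<or> v \<in> y ` {..N}) \<and> i \<in> {1..N} \<and>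
        u \<in> piece y i \<and> v \<in> piece y i}"
    have interior: "y k \<notin> {u<..<v}" if uv: "F u v" and ends: "u \<in> y ` {..N} \<or> v \<in> y ` {..N}" and k: "k \<le> N" for u v k
    proof
      assume yk: "y k \<in> {u<..<v}"
      obtain l where "l \<le> N" "y l = u \<or> y l = v"
        using ends by auto
      then show False
        using one_point[OF uv k, of l] uv yk by (auto simp: F_def)
    qed
    have "Q = {}"
    proof (rule bounded_growth_empty[OF c, of _ "sum w {1..N}"])
      show "0 < q \<and> q \<le> sum w {1..N}" if "q \<in> Q" for q
        using that bound unfolding Q_def by blast
      fix q assume "q \<in> Q"
      then obtain i u v where q: "q = w i * (v - u)" and uv: "F u v" "i \<in> {1..N}" "u \<in> piece y i" "v \<in> piece y i"
        and ends: "u \<in> y ` {..N} \<or> v \<in> y ` {..N}"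
        unfolding Q_def by blast
      have "s z \<in> y ` {..N}" if z: "z \<in> y ` {..N}" for z
      proof -
        obtain k where "k \<le> N" "z = y k"
          using z by auto
        then show ?thesis
          using s_points[of k] sigma_le[of k] by simp
      qed
      then have "s u \<in> y ` {..N} \<or> s v \<in> y ` {..N}"
        using ends by blast
      then have ends': "min (s u) (s v) \<in> y ` {..N} \<or> max (s u) (s v) \<in> y ` {..N}"
        by (auto simp: min_def max_def)
      show "\<exists>q'\<in>Q. c * q \<le> q'"
        using grow[OF uv interior[OF image[OF uv] ends']] image[OF uv] ends' unfolding q Q_def by blast
    qed
    moreover obtain j where "j \<in> {1..N}" "u \<in> piece y j" "v \<in> piece y j"
      using fits[OF uv(1) interior[OF uv]] by blast
    ultimately show False
      using uv unfolding Q_def by blast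
  qed
  \<comment> \<open>A partition point inside would cut off an interval of constancy that ends at
    it.\<close>
  have interior: "y k \<notin> {u<..<v}" if "F u v" "k \<le> N" for u v k
  proof
    assume k: "y k \<in> {u<..<v}"
    then have "F u (y k)"
      using that(1) const[OF that(1), of "y k"] by (auto simp: F_def)
    then show False
      using no_end that(2) by blast
  qed
  define Q where "Q = {w i * (v - u) | i u v. F u v \<and> i \<in> {1..N} \<and> u \<in> piece y i \<and> v \<in> piece y i}"
  have "Q = {}"
  proof (rule bounded_growth_empty[OF c, of _ "sum w {1..N}"])
    show "0 < q \<and> q \<le> sum w {1..N}" if "q \<in> Q" for q
      using that bound unfolding Q_def by blast
    fix q assume "q \<in> Q"
    then obtain i u v where q: "q = w i * (v - u)" and uv: "F u v" "i \<in> {1..N}" "u \<in> piece y i" "v \<in> piece y i"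
      unfolding Q_def by blast
    show "\<exists>q'\<in>Q. c * q \<le> q'"
      using grow[OF uv interior[OF image[OF uv]]] image[OF uv] unfolding q Q_def by blast
  qed
  then have noF: "\<not> F u v" for u v
    using fits[OF _ interior] unfolding Q_def by blast
  show ?thesis
  proof (rule inj_onI)
    fix u v :: real
    assume "u \<in> {0..1}" "v \<in> {0..1}" "g u = g v"
    then show "u = v"
      using noF[of u v] noF[of v u] by (auto simp: F_def)
  qed
qed

lemma conjugate_if_weighted_expanding:
  assumes W: "weighted_expanding w c" and assoc: "assoc_with x t"
  shows "topologically_conjugate t s"
proof -
  obtain g where g: "good g"
    and eq: "\<And>i z. i \<in> {1..N} \<Longrightarrow> z \<in> piece y i \<Longrightarrow> g z = branch x i (g (s z))"
    using semiconjugacy by blast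
  have "connected (g ` {0..1})"
    using goodD(1)[OF g] by (intro connected_continuous_image) auto
  moreover have "0 \<in> g ` {0..1}" "1 \<in> g ` {0..1}"
    using good_ends[OF g] by (auto intro: image_eqI[of _ _ 0] image_eqI[of _ _ 1])
  ultimately have "{0..1} \<subseteq> g ` {0..1}"
    by (rule connected_contains_Icc)
  moreover have "g ` {0..1} \<subseteq> {0..1}"
    using good_unit[OF g] by blast
  ultimately obtain k where k: "homeomorphism {0..1} {0..1} g k"
    using homeomorphism_compact[OF compact_Icc goodD(1)[OF g], of "{0..1}"] semiconjugacy_inj[OF W g eq]
    by blast
  \<comment> \<open>This comes from \<open>t (g z) = g (s z)\<close>; so it is the inverse
    \<open>k\<close> of \<open>g\<close> that conjugates \<open>t\<close> to
    \<open>s\<close>.\<close>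
  have "s z = k (t (g z))" if z: "z \<in> {0..1}" for z
  proof -
    obtain i where i: "i \<in> {1..N}" "z \<in> piece y i"
      using piece_cover[OF py z] .
    have "s z \<in> {y (lo i)..y (hi i)}"
      using s_range[OF i] .
    moreover have "y (lo i) \<in> {0..1}" "y (hi i) \<in> {0..1}"
      using interval_partition_range[OF py] lo_le hi_le i(1) by blast+
    moreover have "g (y (lo i)) = x (lo i)" "g (y (hi i)) = x (hi i)"
      using goodD(3)[OF g] lo_le hi_le i(1) by blast+
    ultimately have "g (s z) \<in> {x (lo i)..x (hi i)}"
      using goodD(2)[OF g, of "y (lo i)" "s z"] goodD(2)[OF g, of "s z" "y (hi i)"] by auto
    from assoc_with_onto(2)[OF assoc i(1) this] have "t (g z) = g (s z)"
      using eq[OF i] by simp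
    then show ?thesis
      using k s_unit[OF z] by (simp add: homeomorphism_def)
  qed
  then show ?thesis
    using homeomorphism_sym[THEN iffD1, OF k] unfolding topologically_conjugate_def by blast
qed

text \<open>The partition \<open>p\<close> on which \<open>s\<close> is known to expand may differ
  from \<open>y\<close>. Within a piece of \<open>y\<close> the direction of \<open>s\<close> is
  fixed, so the estimates on the cells of \<open>p\<close> add up.\<close>

lemma expanding_Markov_weighted:
  assumes "expanding_Markov s"
  obtains c where "weighted_expanding (\<lambda>_. 1) c"
proof -
  obtain n p c where p: "interval_partition n p" and c: "c > 1"
    and exp: "\<And>i u v. i \<in> {1..n} \<Longrightarrow> u \<in> piece p i \<Longrightarrow> v \<in> piece p i \<Longrightarrow> c * \<bar>u - v\<bar> \<le> \<bar>s u - s v\<bar>"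
    using assms unfolding expanding_Markov_def piecewise_monotone_wrt_def by blast
  have "c * (v - u) \<le> \<bar>s u - s v\<bar>" if i: "i \<in> {1..N}" and uv: "u \<in> piece y i" "v \<in> piece y i" "u < v" for i u v
  proof -
    have "orient i * s u - c * u \<le> orient i * s v - c * v"
    proof (rule increasing_from_pieces[OF p, where p = u and q = v and h = "\<lambda>z. orient i * s z - c * z"])
      show "0 \<le> u" "u \<le> v" "v \<le> 1"
        using piece_subset[OF py i] uv by auto
      fix j a b assume ab: "j \<in> {1..n}" "a \<in> piece p j" "b \<in> piece p j" "u \<le> a" "a \<le> b" "b \<le> v"
      have "a \<in> piece y i" "b \<in> piece y i"
        using uv ab by (auto simp: piece_def)
      from s_orient[OF i this ab(5)] exp[OF ab(1-3)] ab(5)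
      show "orient i * s a - c * a \<le> orient i * s b - c * b"
        by (auto simp: orient_def right_diff_distrib split: if_splits)
    qed
    then show ?thesis
      by (auto simp: orient_def right_diff_distrib split: if_splits)
  qed
  then have "weighted_expanding (\<lambda>_. 1) c"
    using c by (simp add: weighted_expanding_def)
  then show ?thesis
    using that by blast
qed

text \<open>
  On a piece that is mapped onto a single piece the factor \<open>1 + d * l i\<close> provides the strict
  expansion, because stationarity makes the lengths \<open>l\<close> increase along such pieces.
\<close>

lemma linear_Markov_weighted:
  assumes "piecewise_affine_wrt N y s"
  obtains w c where "weighted_expanding w c"
proof -
  define l where "l i = x i - x (i - 1)" for i
  define m where "m i = y i - y (i - 1)" for i
  have l: "0 < l i" "l i \<le> 1" and m: "0 < m i" "m i \<le> 1" if "i \<in> {1..N}" for i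
  proof -
    have "i \<le> N" "i - 1 \<le> N"
      using that by auto
    then show "0 < l i" "l i \<le> 1" "0 < m i" "m i \<le> 1"
      using interval_partition_step[OF px that] interval_partition_step[OF py that]
        interval_partition_range[OF px, of i] interval_partition_range[OF px, of "i - 1"]
        interval_partition_range[OF py, of i] interval_partition_range[OF py, of "i - 1"]
      by (auto simp: l_def m_def)
  qed
  define \<mu> where "\<mu> = Min (insert 1 (m ` {1..N}))"
  have mu: "0 < \<mu>"
    unfolding \<mu>_def using m by (subst Min_gr_iff) auto
  have mu_le: "\<mu> \<le> m i" if "i \<in> {1..N}" for i
    unfolding \<mu>_def using that by (intro Min_le) auto
  \<comment> \<open>Small enough that the factor \<open>1 + d * l i\<close> stays below
    \<open>1 + \<mu>\<close>, the least gain from covering a second piece.\<close>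
  define d where "d = \<mu> / 2"
  have d: "0 < d" using mu by (simp add: d_def)
  \<comment> \<open>Division by \<open>m i\<close> would give all pieces length one; the numerator
    is the correction for pieces covering just one piece.\<close>
  define w where "w i = (1 + d * l i) / m i" for i
  have w: "0 < w i" if "i \<in> {1..N}" for i
    using l[OF that] m[OF that] d by (auto simp: w_def intro!: divide_pos_pos add_pos_pos)
  define Q where "Q = {(i, j) \<in> {1..N} \<times> {1..N}. A_star \<sigma> i j = 1}"
  \<comment> \<open>The rescaled slope of \<open>s\<close> from piece \<open>i\<close> to piece
    \<open>j\<close>, that is, \<open>w j / w i\<close> times the absolute slope on piece
    \<open>i\<close>.\<close>
  define R where "R = (\<lambda>(i, j). (1 + d * l j) * (y (hi i) - y (lo i)) / (m j * (1 + d * l i)))"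
  have R: "1 < R (i, j)" if Q: "(i, j) \<in> Q" for i j
  proof -
    have ij: "i \<in> {1..N}" "j \<in> {1..N}" "lo i < j" "j \<le> hi i" and A: "A_star \<sigma> i j = 1"
      using Q by (auto simp: Q_def A_star_iff)
    have hiN: "hi i \<le> N"
      using hi_le[OF ij(1)] .
    have pos: "0 < 1 + d * l i" "0 < m j"
      using l[OF ij(1)] m[OF ij(2)] d by (auto intro!: add_pos_pos)
    \<comment> \<open>If piece \<open>i\<close> covers only piece \<open>j\<close>, the weights must
      help, and \<open>l i < l j\<close> does it. Otherwise the image contains a further piece, of
      length at least \<open>\<mu>\<close>.\<close>
    have "(1 + d * l i) * m j < (1 + d * l j) * (y (hi i) - y (lo i))"
    proof (cases "hi i = j \<and> j - 1 = lo i")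
      case True
      have "l i = (\<Sum>k\<in>{1..N}. A_mat \<sigma> a i k * l k)"
        using stat ij(1) unfolding stationary_lengths_def l_def by blast
      also have "\<dots> = A_mat \<sigma> a i j * l j"
      proof -
        have "j = Suc (lo i)" "hi i = Suc (lo i)"
          using True ij by auto
        then have "A_star \<sigma> i k \<noteq> 1" if "k \<in> {1..N} - {j}" for k
          using that by (auto simp: A_star_iff)
        then show ?thesis
          using ij by (subst sum.remove[of _ j]) (auto simp: A_mat_zero intro!: sum.neutral)
      qed
      also have "\<dots> < l j"
        using A_mat_less_1[OF ij(1,2)] l[OF ij(2)] by simp
      finally have "(1 + d * l i) * m j < (1 + d * l j) * m j"
        using d pos(2) by simp
      then show ?thesis
        using True by (simp add: m_def)
    next
      case False
      have "m j + \<mu> \<le> y (hi i) - y (lo i)"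
      proof (cases "hi i = j")
        case True
        with False ij have k: "lo i \<le> j - 1 - 1" "j - 1 \<in> {1..N}" "j - 1 - 1 \<le> N"
          by auto
        then show ?thesis
          using True mu_le[OF k(2)] interval_partition_le[OF py k(1,3)] by (simp add: m_def)
      next
        case False
        with ij hiN have k: "j + 1 \<in> {1..N}" "j + 1 \<le> hi i" "lo i \<le> j - 1" "j - 1 \<le> N"
          by auto
        then show ?thesis
          using mu_le[OF k(1)] interval_partition_le[OF py k(2) hiN] interval_partition_le[OF py k(3,4)]
          by (simp add: m_def)
      qed
      moreover have "m j * (1 + \<mu>) \<le> m j + \<mu>"
        using m[OF ij(2)] mu by (simp add: distrib_left)
      ultimately have D: "m j * (1 + \<mu>) \<le> y (hi i) - y (lo i)"
        by simp
      have "d * l i \<le> d"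
        using l[OF ij(1)] d by simp
      then have "1 + d * l i < 1 + \<mu>"
        using mu by (simp add: d_def)
      then have "(1 + d * l i) * m j < (1 + \<mu>) * m j"
        using pos(2) by (rule mult_strict_right_mono)
      also have "\<dots> \<le> y (hi i) - y (lo i)"
        using D by (simp add: mult.commute)
      also have "\<dots> \<le> (1 + d * l j) * (y (hi i) - y (lo i))"
        using D l[OF ij(2)] d mu pos(2)
        by (simp add: distrib_right) (smt (verit) mult_nonneg_nonneg mult_pos_pos)
      finally show ?thesis .
    qed
    then show ?thesis
      using pos by (simp add: R_def less_divide_eq mult.commute)
  qed
  have finQ: "finite Q"
    by (rule finite_subset[of _ "{1..N} \<times> {1..N}"]) (auto simp: Q_def)
  define c where "c = Min (insert 2 (R ` Q))"
  have c: "1 < c"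
    unfolding c_def using finQ R by (subst Min_gr_iff) auto
  have cR: "c \<le> R p" if "p \<in> Q" for p
    unfolding c_def using finQ that by (intro Min_le) auto
  have "c * (w i * (v - u)) \<le> w j * \<bar>s u - s v\<bar>"
    if ij: "i \<in> {1..N}" "j \<in> {1..N}" and uv: "u \<in> piece y i" "v \<in> piece y i" "u < v"
      and suv: "s u \<in> piece y j" "s v \<in> piece y j" for i j u v
  proof -
    obtain r b where aff: "\<And>z. z \<in> piece y i \<Longrightarrow> s z = r * z + b"
      using assms ij(1) unfolding piecewise_affine_wrt_def affine_with_slope_on_def by blast
    have "i - 1 \<le> N" "i \<le> N"
      using ij(1) by auto
    then have "\<bar>r\<bar> * m i = \<bar>y (\<sigma> i) - y (\<sigma> (i - 1))\<bar>"
      using aff[of "y i"] aff[of "y (i - 1)"] end_points[OF ij(1)] s_points[of i] s_points[of "i - 1"] m[OF ij(1)]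
      by (simp add: m_def abs_mult_pos flip: right_diff_distrib)
    also have "\<dots> = y (hi i) - y (lo i)"
      using interval_partition_le[OF py, of "\<sigma> i" "\<sigma> (i - 1)"] interval_partition_le[OF py, of "\<sigma> (i - 1)" "\<sigma> i"]
        sigma_le[of i] sigma_le[of "i - 1"] \<open>i - 1 \<le> N\<close> \<open>i \<le> N\<close> by (auto simp: hi_def lo_def min_def max_def)
    finally have rm: "\<bar>r\<bar> * m i = y (hi i) - y (lo i)" .
    have "lo i < hi i"
      using nonconstant[OF ij(1)] by (simp add: lo_def hi_def)
    then have "y (lo i) < y (hi i)"
      using interval_partition_less[OF py] hi_le[OF ij(1)] by blast
    then have "r \<noteq> 0"
      using rm by auto
    have diff: "\<bar>s u - s v\<bar> = \<bar>r\<bar> * (v - u)"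
      using aff[OF uv(1)] aff[OF uv(2)] uv(3) by (simp add: abs_mult flip: right_diff_distrib)
    then have "s u \<noteq> s v"
      using \<open>r \<noteq> 0\<close> uv(3) by auto
    then have "y (lo i) < y j" "y (j - 1) < y (hi i)"
      using s_range[OF ij(1) uv(1)] s_range[OF ij(1) uv(2)] suv by (auto simp: piece_def)
    then have "lo i < j" "j - 1 < hi i"
      using interval_partition_less_iff[OF py, of "lo i" j] interval_partition_less_iff[OF py, of "j - 1" "hi i"]
        lo_le[OF ij(1)] hi_le[OF ij(1)] ij(2) by auto
    then have "(i, j) \<in> Q"
      using ij by (simp add: Q_def A_star_iff)
    from cR[OF this] have cle: "c * w i \<le> R (i, j) * w i"
      using w[OF ij(1)] by simp
    have "0 < 1 + d * l i"
      using l[OF ij(1)] d by (simp add: add_pos_pos)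
    then have "R (i, j) * w i = w j * \<bar>r\<bar>"
      using m[OF ij(1)] m[OF ij(2)] by (simp add: R_def w_def rm[symmetric])
    with cle have "c * w i * (v - u) \<le> w j * \<bar>r\<bar> * (v - u)"
      using uv(3) by simp
    then show ?thesis
      by (simp add: diff mult.assoc)
  qed
  then have "weighted_expanding w c"
    using c w by (simp add: weighted_expanding_def)
  then show ?thesis
    using that by blast
qed

lemma conjugate:
  assumes "linear_Markov_with_partition N y s \<or> expanding_Markov s" "assoc_with x t"
  shows "topologically_conjugate t s"
  using assms conjugate_if_weighted_expanding expanding_Markov_weighted linear_Markov_weighted
  unfolding linear_Markov_with_partition_def by metis

end

section \<open>Maps and stationary vectors\<close>

lemma sum_lengths:
  fixes x :: "nat \<Rightarrow> real"
  shows "(\<Sum>i\<in>{1..n}. x i - x (i - 1)) = x n - x 0"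
  by (induction n) auto

lemma interval_partition_partial_sums:
  fixes v :: "nat \<Rightarrow> real"
  assumes "\<And>i. i \<in> {1..N} \<Longrightarrow> 0 < v i" "sum v {1..N} = 1"
  shows "interval_partition N (\<lambda>i. sum v {1..i})"
  using assms by (auto simp: interval_partition_def)

context slope_family begin

text \<open>Pairing an associated map with itself makes the facts on the direction of
  \<open>s\<close> available for \<open>t\<close>.\<close>

lemma assoc_with_markov_pair:
  assumes "assoc_with x t"
  shows "markov_pair N \<sigma> a x x t"
  using assms assoc_with_stationary[OF assms] slope_family_axioms
  by (auto simp: markov_pair_def markov_pair_axioms_def assoc_with_def)

lemma assoc_with_cong:
  assumes "assoc_with x t" and eq: "\<And>i. i \<le> N \<Longrightarrow> x i = x' i"
  shows "assoc_with x' t"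
proof -
  have p: "piece x' i = piece x i" if "i \<in> {1..N}" for i
  proof -
    have "i \<le> N" "i - 1 \<le> N"
      using that by auto
    then show ?thesis
      by (simp add: piece_def eq)
  qed
  have part: "interval_partition N x'"
    using assms(1) eq by (simp add: assoc_with_def interval_partition_def)
  have pts: "t (x' i) = x' (\<sigma> i)" if "i \<le> N" for i
  proof -
    have "t (x i) = x (\<sigma> i)"
      using assms(1) that by (simp add: assoc_with_def)
    then show ?thesis
      using eq[OF that] eq[OF sigma_le[OF that]] by simp
  qed
  show ?thesis
    using assms(1) part pts unfolding assoc_with_def by (simp add: p)
qed

section \<open>A map determines its partition\<close>

definition turning :: "nat \<Rightarrow> bool" where
  "turning k \<longleftrightarrow> 0 < k \<and> k < N \<and> orient k \<noteq> orient (Suc k)"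

text \<open>No partition occurs here, so the property can be derived from one partition of a map and
  refuted with another.\<close>

definition expands_on :: "(real \<Rightarrow> real) \<Rightarrow> real \<Rightarrow> real \<Rightarrow> bool" where
  "expands_on t u v \<longleftrightarrow> (\<forall>p q. u \<le> p \<and> p \<le> q \<and> q \<le> v \<longrightarrow> q - p \<le> contr * \<bar>t q - t p\<bar>)"

text \<open>Without a turning point in between, all pieces have the same orientation, so the
  increments over the pieces do not cancel.\<close>

lemma expands_between_turning:
  assumes assoc: "assoc_with x t" and mn: "m \<le> n" "n \<le> N"
    and no: "\<And>k. m < k \<Longrightarrow> k < n \<Longrightarrow> \<not> turning k"
  shows "expands_on t (x m) (x n)"
  unfolding expands_on_def
proof (intro allI impI)
  fix p q assume pq: "x m \<le> p \<and> p \<le> q \<and> q \<le> x n"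
  have part: "interval_partition N x"
    using assoc_part[OF assoc] .
  interpret mp: markov_pair N \<sigma> a x x t
    by (rule assoc_with_markov_pair[OF assoc])
  define e where "e = orient (Suc m)"
  have e: "orient k = e" if "m < k" "k \<le> n" for k
    using that
  proof (induction k)
    case (Suc k)
    show ?case
    proof (cases "k = m")
      case False
      then have "orient k = e" "\<not> turning k"
        using Suc no[of k] by auto
      then show ?thesis
        using Suc.prems False mn by (simp add: turning_def)
    qed (simp add: e_def)
  qed simp
  have "contr * (e * t p) - p \<le> contr * (e * t q) - q"
  proof (rule increasing_from_pieces[OF part, where h = "\<lambda>z. contr * (e * t z) - z"])
    show "0 \<le> p" "p \<le> q" "q \<le> 1"
      using pq interval_partition_range[OF part, of m] interval_partition_range[OF part, of n] mn by auto
    fix i u v assume i: "i \<in> {1..N}" and uv: "u \<in> piece x i" "v \<in> piece x i" "p \<le> u" "u \<le> v" "v \<le> q"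
    \<comment> \<open>Pieces outside the range from \<open>m\<close> to \<open>n\<close> meet
      \<open>[p, q]\<close> in at most one point.\<close>
    consider "i \<le> m" | "n < i" | "m < i" "i \<le> n" by linarith
    then show "contr * (e * t u) - u \<le> contr * (e * t v) - v"
    proof cases
      case 1
      then have "x i \<le> x m"
        using interval_partition_le[OF part] mn by simp
      then have "u = v"
        using uv pq by (auto simp: piece_def)
      then show ?thesis by simp
    next
      case 2
      then have "x n \<le> x (i - 1)"
        using interval_partition_le[OF part, of n "i - 1"] i by simp
      then have "u = v"
        using uv pq by (auto simp: piece_def)
      then show ?thesis by simp
    next
      case 3
      have "e * t u \<le> e * t v"
        using mp.s_orient[OF i uv(1,2,4)] e[OF 3] by simp
      moreover have "\<bar>e\<bar> = 1"
        by (simp add: e_def)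
      ultimately have "\<bar>t u - t v\<bar> = e * t v - e * t u"
        by (metis abs_minus_commute abs_mult abs_of_nonneg diff_ge_0_iff_ge mult_1 right_diff_distrib)
      then show ?thesis
        using assoc_with_expands[OF assoc i uv(1,2)] uv(4) by (simp add: right_diff_distrib)
    qed
  qed
  then have "q - p \<le> contr * (e * (t q - t p))"
    by (simp add: right_diff_distrib)
  also have "\<dots> \<le> contr * \<bar>e * (t q - t p)\<bar>"
    using contr_bounds by (intro mult_left_mono) auto
  finally show "q - p \<le> contr * \<bar>t q - t p\<bar>"
    by (simp add: abs_mult e_def)
qed

text \<open>Expansion implies injectivity, and a continuous injection of an interval is strictly
  monotone, which contradicts the change of direction.\<close>

lemma not_expands_at_turning:
  assumes assoc: "assoc_with x t" and k: "turning k" and uv: "u < x k" "x k < v" "0 \<le> u" "v \<le> 1"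
  shows "\<not> expands_on t u v"
proof
  assume ex: "expands_on t u v"
  have part: "interval_partition N x"
    using assoc_part[OF assoc] .
  interpret mp: markov_pair N \<sigma> a x x t
    by (rule assoc_with_markov_pair[OF assoc])
  have kN: "k \<in> {1..N}" "Suc k \<in> {1..N}"
    using k by (auto simp: turning_def)
  define p where "p = max u (x (k - 1))"
  define q where "q = min v (x (Suc k))"
  have pq: "p < x k" "x k < q" "u \<le> p" "q \<le> v"
    using uv interval_partition_step[OF part kN(1)] interval_partition_step[OF part kN(2)]
    by (auto simp: p_def q_def)
  have "inj_on t {p..q}"
  proof (rule inj_onI)
    have le: "z - y \<le> contr * \<bar>t z - t y\<bar>" if "y \<le> z" "y \<in> {p..q}" "z \<in> {p..q}" for y z
      by (rule ex[unfolded expands_on_def, rule_format]) (use pq that in auto)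
    have *: "y = z" if "y \<le> z" "y \<in> {p..q}" "z \<in> {p..q}" "t y = t z" for y z
      using le[OF that(1-3)] that(1) unfolding that(4) by simp
    fix y z assume "y \<in> {p..q}" "z \<in> {p..q}" "t y = t z"
    then show "y = z"
      using *[of y z] *[of z y, symmetric] by (metis linear)
  qed
  moreover have "continuous_on {p..q} t"
    using continuous_on_subset[OF assoc_continuous[OF assoc]] pq uv by simp
  ultimately have "t p < t (x k) \<and> t (x k) < t q \<or> t q < t (x k) \<and> t (x k) < t p"
    using continuous_inj_imp_mono[OF pq(1,2)] by blast
  moreover have "p \<in> piece x k" "x k \<in> piece x k" "x k \<in> piece x (Suc k)" "q \<in> piece x (Suc k)"
    using pq by (auto simp: p_def q_def piece_def)
  then have "orient k * t p \<le> orient k * t (x k)" "orient (Suc k) * t (x k) \<le> orient (Suc k) * t q"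
    using mp.s_orient[OF kN(1), of p "x k"] mp.s_orient[OF kN(2), of "x k" q] pq by auto
  ultimately show False
    using k by (auto simp: turning_def orient_def split: if_splits)
qed

text \<open>
  The turning points and the ends of the interval are determined by the map. Between them
  the map expands, so that the largest distance of corresponding partition points is zero.
\<close>

lemma assoc_with_partition_unique:
  assumes assoc: "assoc_with x t" "assoc_with x' t" and iN: "i \<le> N"
  shows "x i = x' i"
proof -
  define P where "P k \<longleftrightarrow> turning k \<or> k = 0 \<or> k = N" for k
  have below: "\<exists>m\<le>k. P m \<and> (\<forall>j. m < j \<and> j \<le> k \<longrightarrow> \<not> P j)" for k
  proof (induction k)
    case (Suc k)
    then show ?case
      by (cases "P (Suc k)") (auto simp: le_Suc_eq)
  qed (auto simp: P_def)
  have above: "\<exists>n\<ge>k. n \<le> N \<and> P n \<and> (\<forall>j. k \<le> j \<and> j < n \<longrightarrow> \<not> P j)" if "k \<le> N" for k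
  proof -
    define n where "n = (LEAST n. k \<le> n \<and> P n)"
    have "k \<le> n \<and> P n"
      unfolding n_def by (rule LeastI[of _ N]) (use that in \<open>simp add: P_def\<close>)
    moreover have "n \<le> N"
      unfolding n_def by (rule Least_le) (use that in \<open>simp add: P_def\<close>)
    moreover have "\<not> P j" if "k \<le> j" "j < n" for j
      using not_less_Least[of j "\<lambda>n. k \<le> n \<and> P n"] that by (auto simp: n_def)
    ultimately show ?thesis by blast
  qed
  \<comment> \<open>Otherwise the turning point \<open>x k\<close> of one partition would lie
    strictly inside a stretch on which, by the other partition, the map expands. The statement is
    symmetric in the partitions and is used both ways.\<close>
  have not_less: "\<not> x k < x' k" if assoc: "assoc_with x t" "assoc_with x' t" and k: "turning k"
    and IH: "\<And>j. j < k \<Longrightarrow> P j \<Longrightarrow> x j = x' j" for x x' k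
  proof
    assume less: "x k < x' k"
    have kN: "0 < k" "k \<le> N"
      using k by (auto simp: turning_def)
    obtain m where m: "m \<le> k - 1" "P m" "\<And>j. m < j \<Longrightarrow> j \<le> k - 1 \<Longrightarrow> \<not> P j"
      using below by blast
    have mk: "m < k"
      using m(1) kN(1) by simp
    have "\<not> turning j" if "m < j" "j < k" for j
      using m(3)[of j] that by (auto simp: P_def)
    then have "expands_on t (x' m) (x' k)"
      using mk kN by (intro expands_between_turning[OF assoc(2)]) auto
    moreover have "x' m < x k"
      using IH[OF mk m(2)] interval_partition_less[OF assoc_part[OF assoc(1)] mk kN(2)] by simp
    moreover have "0 \<le> x' m" "x' k \<le> 1"
      using interval_partition_range[OF assoc_part[OF assoc(2)], of m]
        interval_partition_range[OF assoc_part[OF assoc(2)], of k] mk kN by auto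
    ultimately show False
      using not_expands_at_turning[OF assoc(1) k _ less] by blast
  qed
  have P_eq: "x k = x' k" if "P k" for k
    using that
  proof (induction k rule: less_induct)
    case (less k)
    show ?case
    proof (cases "turning k")
      case True
      have "\<not> x k < x' k" "\<not> x' k < x k"
        using not_less[OF assoc True] not_less[OF assoc(2,1) True] less.IH by metis+
      then show ?thesis by simp
    next
      case False
      then show ?thesis
        using less.prems assoc_part[OF assoc(1)] assoc_part[OF assoc(2)]
        by (auto simp: P_def interval_partition_def)
    qed
  qed
  \<comment> \<open>Both \<open>x i\<close> and \<open>x' i\<close> lie between the same two points
    with indices \<open>m\<close> and \<open>n\<close>, so the map expands their distance and takes
    them to points with index \<open>\<sigma> i\<close>.\<close>
  have close: "\<bar>x i - x' i\<bar> \<le> contr * \<bar>x (\<sigma> i) - x' (\<sigma> i)\<bar>" if iN: "i \<le> N" for i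
  proof (cases "P i")
    case True
    then show ?thesis
      using P_eq contr_bounds by simp
  next
    case False
    obtain m where m: "m \<le> i" "P m" "\<And>j. m < j \<Longrightarrow> j \<le> i \<Longrightarrow> \<not> P j"
      using below by blast
    obtain n where n: "i \<le> n" "n \<le> N" "P n" "\<And>j. i \<le> j \<Longrightarrow> j < n \<Longrightarrow> \<not> P j"
      using above[OF iN] by blast
    have "\<not> turning j" if "m < j" "j < n" for j
      using m(3)[of j] n(4)[of j] that by (cases "j \<le> i") (auto simp: P_def)
    then have "expands_on t (x m) (x n)"
      using m n by (intro expands_between_turning[OF assoc(1)]) auto
    then have ex: "q - p \<le> contr * \<bar>t q - t p\<bar>" if "x m \<le> p" "p \<le> q" "q \<le> x n" for p q
      using that unfolding expands_on_def by blast
    have "x m \<le> x i" "x i \<le> x n" "x' m \<le> x' i" "x' i \<le> x' n"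
      using interval_partition_le[OF assoc_part[OF assoc(1)]] interval_partition_le[OF assoc_part[OF assoc(2)]]
        m n iN by auto
    moreover have "t (x i) = x (\<sigma> i)" "t (x' i) = x' (\<sigma> i)"
      using assoc iN by (auto simp: assoc_with_def)
    ultimately show ?thesis
      using ex[of "x i" "x' i"] ex[of "x' i" "x i"] P_eq[OF m(2)] P_eq[OF n(3)]
      by (cases "x i \<le> x' i") (simp_all add: abs_minus_commute)
  qed
  define Q where "Q = {\<bar>x i - x' i\<bar> | i. i \<le> N \<and> x i \<noteq> x' i}"
  have "Q = {}"
  proof (rule bounded_growth_empty[of "inverse contr" _ 1])
    show "1 < inverse contr"
      using contr_bounds by (simp add: one_less_inverse)
    fix q assume "q \<in> Q"
    then obtain i where i: "q = \<bar>x i - x' i\<bar>" "i \<le> N" "x i \<noteq> x' i"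
      by (auto simp: Q_def)
    show "0 < q \<and> q \<le> 1"
      using i interval_partition_range[OF assoc_part[OF assoc(1)] i(2)]
        interval_partition_range[OF assoc_part[OF assoc(2)] i(2)] by auto
    have le: "inverse contr * q \<le> \<bar>x (\<sigma> i) - x' (\<sigma> i)\<bar>"
      using close[OF i(2)] contr_bounds i(1) by (simp add: field_simps)
    moreover have "0 < inverse contr * q"
      using i contr_bounds by simp
    ultimately have "\<bar>x (\<sigma> i) - x' (\<sigma> i)\<bar> \<in> Q"
      using sigma_le[OF i(2)] unfolding Q_def by force
    with le show "\<exists>q'\<in>Q. inverse contr * q \<le> q'"
      by blast
  qed
  then show ?thesis
    using iN by (auto simp: Q_def)
qed

section \<open>Positive stationary vectors and the number of associated maps\<close>

lemma chain_A_mat: "chain N (A_mat \<sigma> a)"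
  by unfold_locales (use A_mat_nonneg column_sum in auto)

lemma arc_A_mat_pos: "(j, i) \<in> arcs N \<sigma> \<Longrightarrow> 0 < A_mat \<sigma> a i j"
  by (auto simp: arcs_def intro: A_mat_pos)

lemma no_arc_A_mat: "i \<in> {1..N} \<Longrightarrow> j \<in> {1..N} \<Longrightarrow> (j, i) \<notin> arcs N \<sigma> \<Longrightarrow> A_mat \<sigma> a i j = 0"
  by (auto simp: arcs_def intro: A_mat_zero)

definition positive_stationary :: "(nat \<Rightarrow> real) \<Rightarrow> bool" where
  "positive_stationary v \<longleftrightarrow> sum v {1..N} = 1 \<and>
     (\<forall>i\<in>{1..N}. 0 < v i \<and> v i = (\<Sum>k\<in>{1..N}. A_mat \<sigma> a i k * v k))"

lemma positive_stationaryD: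
  assumes "positive_stationary v"
  shows "sum v {1..N} = 1" "i \<in> {1..N} \<Longrightarrow> 0 < v i"
    "i \<in> {1..N} \<Longrightarrow> v i = (\<Sum>k\<in>{1..N}. A_mat \<sigma> a i k * v k)"
  using assms unfolding positive_stationary_def by blast+

lemma positive_stationary_lengths:
  assumes "assoc_with x t"
  shows "positive_stationary (\<lambda>i. x i - x (i - 1))"
  unfolding positive_stationary_def
proof (intro conjI ballI)
  show "(\<Sum>i\<in>{1..N}. x i - x (i - 1)) = 1"
    unfolding sum_lengths using assoc_part[OF assms] by (simp add: interval_partition_def)
  fix i assume i: "i \<in> {1..N}"
  show "0 < x i - x (i - 1)"
    using interval_partition_step[OF assoc_part[OF assms] i] by simp
  show "x i - x (i - 1) = (\<Sum>k\<in>{1..N}. A_mat \<sigma> a i k * (x k - x (k - 1)))"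
    using assoc_with_stationary[OF assms] i unfolding stationary_lengths_def by blast
qed

lemma assoc_with_partial_sums:
  assumes "positive_stationary v"
  shows "\<exists>t. assoc_with (\<lambda>i. sum v {1..i}) t"
proof (rule assoc_with_exists)
  show "interval_partition N (\<lambda>i. sum v {1..i})"
    using positive_stationaryD[OF assms] by (intro interval_partition_partial_sums) auto
  have "sum v {1..i} - sum v {1..i - 1} = v i" if "i \<in> {1..N}" for i
    using that by (cases i) auto
  then have *: "(\<Sum>k\<in>{1..N}. A_mat \<sigma> a i k * (sum v {1..k} - sum v {1..k - 1})) =
      (\<Sum>k\<in>{1..N}. A_mat \<sigma> a i k * v k)" "i \<in> {1..N} \<Longrightarrow> sum v {1..i} - sum v {1..i - 1} = v i" for i
    by (auto intro: sum.cong)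
  show "stationary_lengths (\<lambda>i. sum v {1..i})"
    unfolding stationary_lengths_def *(1)
  proof
    fix i assume i: "i \<in> {1..N}"
    show "sum v {1..i} - sum v {1..i - 1} = (\<Sum>k\<in>{1..N}. A_mat \<sigma> a i k * v k)"
      using *(2)[OF i] positive_stationaryD(3)[OF assms i] by (rule trans)
  qed
qed

text \<open>Its contrapositive excludes associated maps as soon as some node is transient.\<close>

lemma recurrent_if_associated:
  assumes "associated N \<sigma> a t" "j \<in> {1..N}"
  shows "recurrent_node N (A_mat \<sigma> a) j"
proof -
  obtain x where "assoc_with x t"
    using assms(1) by (auto simp: associated_iff)
  note v = positive_stationaryD[OF positive_stationary_lengths[OF this]]
  show ?thesis
    by (rule chain.recurrent_if_stationary_pos[OF chain_A_mat assms(2) v(2,3)])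
qed

lemma associated_iff_positive_stationary:
  "associated N \<sigma> a t \<longleftrightarrow> (\<exists>v. positive_stationary v \<and> assoc_with (\<lambda>i. sum v {1..i}) t)"
proof
  assume "associated N \<sigma> a t"
  then obtain x where x: "assoc_with x t"
    by (auto simp: associated_iff)
  have "x 0 = 0"
    using assoc_part[OF x] by (simp add: interval_partition_def)
  then have "x i = (\<Sum>k\<in>{1..i}. x k - x (k - 1))" for i
    by (simp add: sum_lengths)
  then have "assoc_with (\<lambda>i. \<Sum>k\<in>{1..i}. x k - x (k - 1)) t"
    by (rule assoc_with_cong[OF x])
  then show "\<exists>v. positive_stationary v \<and> assoc_with (\<lambda>i. sum v {1..i}) t"
    using positive_stationary_lengths[OF x] by blast
qed (auto simp: associated_iff)

lemma associated_unique:
  assumes irred: "\<And>i j. i \<in> {1..N} \<Longrightarrow> j \<in> {1..N} \<Longrightarrow> i \<noteq> j \<Longrightarrow> (j, i) \<in> (arcs N \<sigma>)\<^sup>+"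
    and "associated N \<sigma> a t" "associated N \<sigma> a t'"
  shows "t = t'"
proof -
  obtain v v' where v: "positive_stationary v" "assoc_with (\<lambda>i. sum v {1..i}) t"
    and v': "positive_stationary v'" "assoc_with (\<lambda>i. sum v' {1..i}) t'"
    using assms(2,3) by (auto simp: associated_iff_positive_stationary)
  have "v i = v' i" if "i \<in> {1..N}" for i
    by (rule chain.stationary_unique[OF chain_A_mat arc_A_mat_pos irred positive_stationaryD(2)[OF v(1)]
          positive_stationaryD(3)[OF v(1)] positive_stationaryD(1)[OF v(1)] positive_stationaryD(2)[OF v'(1)]
          positive_stationaryD(3)[OF v'(1)] positive_stationaryD(1)[OF v'(1)] that])
  then have "sum v {1..i} = sum v' {1..i}" if "i \<le> N" for i
    using that by (intro sum.cong) auto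
  then show ?thesis
    using assoc_with_unique[OF assoc_with_cong[OF v(2)] v'(2)] by blast
qed

lemma positive_stationary_if_irreducible:
  assumes irred: "\<And>i j. i \<in> {1..N} \<Longrightarrow> j \<in> {1..N} \<Longrightarrow> i \<noteq> j \<Longrightarrow> (j, i) \<in> (arcs N \<sigma>)\<^sup>+"
    and "0 < N"
  obtains v where "positive_stationary v"
proof -
  have 1: "1 \<in> {1..N}"
    using assms(2) by simp
  have returns: "(i, 1) \<in> (arcs N \<sigma>)\<^sup>+" if "(1, i) \<in> (arcs N \<sigma>)\<^sup>+" for i
  proof (cases "i = 1")
    case False
    moreover have "i \<in> {1..N}"
      using tranclD2[OF that] by (auto simp: arcs_def)
    ultimately show ?thesis
      using irred 1 by blast
  qed (use that in simp)
  obtain v where v: "\<And>i. i \<in> {1..N} \<Longrightarrow> 0 \<le> v i"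
    "\<And>i. i \<in> {1..N} \<Longrightarrow> v i = (\<Sum>k\<in>{1..N}. A_mat \<sigma> a i k * v k)" "sum v {1..N} = 1"
    "\<And>i. i \<in> {1..N} \<Longrightarrow> 0 < v i \<longleftrightarrow> i = 1 \<or> (1, i) \<in> (arcs N \<sigma>)\<^sup>+"
    by (rule chain.stationary_of_recurrent[OF chain_A_mat arc_A_mat_pos no_arc_A_mat 1 returns]) (assumption | rule that)+
  have "0 < v i" if "i \<in> {1..N}" for i
    using v(4)[OF that] irred[OF that 1] by blast
  with v(2,3) have "positive_stationary v"
    unfolding positive_stationary_def by blast
  then show ?thesis
    using that by blast
qed

text \<open>Every node carries a stationary vector supported on the nodes reachable from it. Their
  sum \<open>u\<close> is positive everywhere and stays so when multiples of the vector of
  \<open>p\<close>, which misses \<open>q\<close>, are added.\<close>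

lemma infinitely_many_associated:
  assumes rec: "\<And>j. j \<in> {1..N} \<Longrightarrow> recurrent_node N (A_mat \<sigma> a) j"
    and pq: "p \<in> {1..N}" "q \<in> {1..N}" "p \<noteq> q" "(p, q) \<notin> (arcs N \<sigma>)\<^sup>+"
  shows "infinite {t. associated N \<sigma> a t}"
proof -
  define S where "S j v \<longleftrightarrow> (\<forall>i\<in>{1..N}. 0 \<le> v i) \<and> (\<forall>i\<in>{1..N}. v i = (\<Sum>k\<in>{1..N}. A_mat \<sigma> a i k * v k)) \<and>
      sum v {1..N} = 1 \<and> (\<forall>i\<in>{1..N}. 0 < v i \<longleftrightarrow> i = j \<or> (j, i) \<in> (arcs N \<sigma>)\<^sup>+)" for j v
  have "\<exists>v. S j v" if j: "j \<in> {1..N}" for j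
  proof -
    have returns: "(i, j) \<in> (arcs N \<sigma>)\<^sup>+" if "(j, i) \<in> (arcs N \<sigma>)\<^sup>+" for i
      by (rule chain.recurrent_returns[OF chain_A_mat rec[OF j] that arc_A_mat_pos no_arc_A_mat])
    obtain v where "\<And>i. i \<in> {1..N} \<Longrightarrow> 0 \<le> v i"
      "\<And>i. i \<in> {1..N} \<Longrightarrow> v i = (\<Sum>k\<in>{1..N}. A_mat \<sigma> a i k * v k)" "sum v {1..N} = 1"
      "\<And>i. i \<in> {1..N} \<Longrightarrow> 0 < v i \<longleftrightarrow> i = j \<or> (j, i) \<in> (arcs N \<sigma>)\<^sup>+"
      by (rule chain.stationary_of_recurrent[OF chain_A_mat arc_A_mat_pos no_arc_A_mat j returns]) (assumption | rule that)+
    then have "S j v"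
      unfolding S_def by blast
    then show ?thesis by blast
  qed
  then have "\<forall>j\<in>{1..N}. \<exists>v. S j v" by blast
  then obtain V where "\<forall>j\<in>{1..N}. S j (V j)"
    using bchoice by blast
  then have V: "0 \<le> V j i" "V j i = (\<Sum>k\<in>{1..N}. A_mat \<sigma> a i k * V j k)" "sum (V j) {1..N} = 1"
    "0 < V j i \<longleftrightarrow> i = j \<or> (j, i) \<in> (arcs N \<sigma>)\<^sup>+" if "j \<in> {1..N}" "i \<in> {1..N}" for j i
    using that unfolding S_def by blast+
  define u where "u i = (\<Sum>j\<in>{1..N}. V j i)" for i
  have u_pos: "0 < u i" if i: "i \<in> {1..N}" for i
  proof -
    have "0 < V i i"
      using V(4)[OF i i] by simp
    also have "\<dots> \<le> u i"
      unfolding u_def using V(1) i by (intro member_le_sum) auto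
    finally show ?thesis .
  qed
  have u_stat: "u i = (\<Sum>k\<in>{1..N}. A_mat \<sigma> a i k * u k)" if i: "i \<in> {1..N}" for i
  proof -
    have "u i = (\<Sum>j\<in>{1..N}. \<Sum>k\<in>{1..N}. A_mat \<sigma> a i k * V j k)"
      unfolding u_def by (intro sum.cong refl) (use V(2) i in blast)
    also have "\<dots> = (\<Sum>k\<in>{1..N}. A_mat \<sigma> a i k * u k)"
      unfolding u_def sum_distrib_left by (rule sum.swap)
    finally show ?thesis .
  qed
  have u_sum: "sum u {1..N} = N"
    unfolding u_def by (subst sum.swap) (simp add: V(3))
  \<comment> \<open>These vectors are pairwise different because \<open>V p\<close> vanishes at \<open>q\<close> and \<open>u\<close> does not.\<close>
  define v where "v n i = (u i + real n * V p i) / (real N + real n)" for n i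
  have N: "0 < real N + real n" for n
    using pq(1) by (simp add: add_pos_nonneg)
  have v: "positive_stationary (v n)" for n
    unfolding positive_stationary_def
  proof (intro conjI ballI)
    show "sum (v n) {1..N} = 1"
      using N[of n] by (simp add: v_def sum.distrib u_sum V(3)[OF pq(1,1)] flip: sum_divide_distrib sum_distrib_left)
    fix i assume i: "i \<in> {1..N}"
    show "0 < v n i"
      using u_pos[OF i] V(1)[OF pq(1) i] N[of n] by (simp add: v_def add_pos_nonneg)
    have "(\<Sum>k\<in>{1..N}. A_mat \<sigma> a i k * v n k) =
        ((\<Sum>k\<in>{1..N}. A_mat \<sigma> a i k * u k) + real n * (\<Sum>k\<in>{1..N}. A_mat \<sigma> a i k * V p k)) / (real N + real n)"
      unfolding sum_distrib_left sum.distrib[symmetric] sum_divide_distrib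
      by (intro sum.cong refl) (simp add: v_def distrib_left mult_ac)
    also have "\<dots> = v n i"
      unfolding u_stat[OF i, symmetric] V(2)[OF pq(1) i, symmetric] v_def ..
    finally show "v n i = (\<Sum>k\<in>{1..N}. A_mat \<sigma> a i k * v n k)" ..
  qed
  obtain T where T: "assoc_with (\<lambda>i. sum (v n) {1..i}) (T n)" for n
    using assoc_with_partial_sums[OF v] by metis
  have "inj T"
  proof (rule injI)
    fix m n assume "T m = T n"
    then have *: "sum (v m) {1..i} = sum (v n) {1..i}" if "i \<le> N" for i
      using assoc_with_partition_unique[OF T[of m] _ that] T[of n] by simp
    have "q \<le> N" "q - 1 \<le> N"
      using pq(2) by auto
    have step: "v k q = sum (v k) {1..q} - sum (v k) {1..q - 1}" for k
      using pq(2) by (cases q) auto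
    \<comment> \<open>Equal maps have equal partitions, hence equal lengths at \<open>q\<close>; but
      these are \<open>u q / (N + n)\<close>, which determines \<open>n\<close>.\<close>
    have "v m q = v n q"
      unfolding step *[OF \<open>q \<le> N\<close>] *[OF \<open>q - 1 \<le> N\<close>] ..
    moreover have "V p q = 0"
      using V(4)[OF pq(1,2)] V(1)[OF pq(1,2)] pq(3,4) by auto
    ultimately show "m = n"
      using N[of m] N[of n] u_pos[OF pq(2)] by (simp add: v_def frac_eq_eq)
  qed
  then have "infinite (range T)"
    by (simp add: range_inj_infinite)
  moreover have "range T \<subseteq> {t. associated N \<sigma> a t}"
    using T by (auto simp: associated_iff)
  ultimately show ?thesis
    using infinite_super by blast
qed

end

section \<open>Index maps and communicating classes\<close>

lemma index_map_eq:
  assumes "interval_partition N x" "i \<le> N" "\<exists>j\<le>N. s (x i) = x j"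
  shows "index_map N x s i \<le> N" "s (x i) = x (index_map N x s i)"
proof -
  have "\<exists>!j. j \<le> N \<and> s (x i) = x j"
    using assms interval_partition_eq_iff[OF assms(1)] by auto
  from theI'[OF this] show "index_map N x s i \<le> N" "s (x i) = x (index_map N x s i)"
    by (simp_all add: index_map_def)
qed

lemma irreducible_reachable:
  assumes "irreducible_A_star N \<sigma>" "i \<in> {1..N}" "j \<in> {1..N}" "i \<noteq> j"
  shows "(j, i) \<in> (arcs N \<sigma>)\<^sup>+"
proof -
  let ?f = "\<lambda>i. insert i {j \<in> {1..N}. (i, j) \<in> (arcs N \<sigma>)\<^sup>+ \<and> (j, i) \<in> (arcs N \<sigma>)\<^sup>+}"
  have "card (?f ` {1..N}) = 1"
    using assms(1) by (simp add: irreducible_A_star_def communicating_classes_iff)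
  then have "?f i = ?f j"
    using assms(2,3) by (metis (no_types, lifting) card_1_singletonE image_eqI singletonD)
  then have "i \<in> ?f j" by blast
  then show ?thesis
    using assms(4) by simp
qed

lemma not_reachable_if_several_classes:
  assumes "card (communicating_classes N \<sigma>) > 1"
  obtains p q where "p \<in> {1..N}" "q \<in> {1..N}" "p \<noteq> q" "(p, q) \<notin> (arcs N \<sigma>)\<^sup>+"
proof (rule ccontr)
  assume "\<not> thesis"
  with that have all: "(p, q) \<in> (arcs N \<sigma>)\<^sup>+" if "p \<in> {1..N}" "q \<in> {1..N}" "p \<noteq> q" for p q
    using that by blast
  have "communicating_classes N \<sigma> \<subseteq> {{1..N}}"
    unfolding communicating_classes_iff using all by blast
  then have "card (communicating_classes N \<sigma>) \<le> card {{1..N}}"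
    by (intro card_mono) auto
  then show False
    using assms by simp
qed

theorem theorem46:
  fixes s :: "real \<Rightarrow> real" and N :: nat and xhat :: "nat \<Rightarrow> real"
    and \<sigma> :: "nat \<Rightarrow> nat" and a :: "nat \<Rightarrow> nat \<Rightarrow> real"
  assumes "cont_interval_map s"
    and "interval_partition N xhat"
    and "\<forall>i\<le>N. \<exists>j\<le>N. s (xhat i) = xhat j"
    and "\<forall>i\<in>{1..N}. monotone_map_on (piece xhat i) s"
    and "\<sigma> = index_map N xhat s"
    and "\<forall>j\<in>{1..N}. (\<Sum>i\<in>{1..N}. A_star \<sigma> i j) > 1"
    and "admissible_slopes N \<sigma> a"
    and "\<forall>j\<in>{1..N}. (\<Sum>i\<in>{1..N}. A_mat \<sigma> a i j) = 1"
  shows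
    "(irreducible_A_star N \<sigma> \<longrightarrow>
       (\<exists>t. associated N \<sigma> a t \<and> expanding_Markov t \<and> t \<in> PA_lambda \<and>
            (linear_Markov_with_partition N xhat s \<or> expanding_Markov s \<longrightarrow> topologically_conjugate t s) \<and>
            (\<forall>t'. associated N \<sigma> a t' \<longrightarrow> t' = t))) \<and>
     (card (communicating_classes N \<sigma>) > 1 \<and>
      (\<forall>C\<in>communicating_classes N \<sigma>. recurrent_class N (A_mat \<sigma> a) C) \<longrightarrow>
       infinite {t. associated N \<sigma> a t \<and> expanding_Markov t \<and> t \<in> PA_lambda \<and>
            (linear_Markov_with_partition N xhat s \<or> expanding_Markov s \<longrightarrow> topologically_conjugate t s)}) \<and>
     (card (communicating_classes N \<sigma>) > 1 \<and>
      (\<exists>C\<in>communicating_classes N \<sigma>. transient_class N (A_mat \<sigma> a) C) \<longrightarrow>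
       \<not> (\<exists>t. associated N \<sigma> a t))"
proof -
  have sigma: "\<sigma> i \<le> N" "s (xhat i) = xhat (\<sigma> i)" if "i \<le> N" for i
    using index_map_eq[OF assms(2) that] assms(3,5) that by auto
  interpret slope_family N \<sigma> a
    by unfold_locales (use sigma(1) assms(6-8) in auto)
  \<comment> \<open>Every associated map has all the required properties, so the three parts only
    concern the existence and the number of associated maps.\<close>
  have conj: "expanding_Markov t \<and> t \<in> PA_lambda \<and>
      (linear_Markov_with_partition N xhat s \<or> expanding_Markov s \<longrightarrow> topologically_conjugate t s)"
    if t: "associated N \<sigma> a t" for t
  proof -
    obtain x where x: "assoc_with x t"
      using t by (auto simp: associated_iff)
    interpret markov_pair N \<sigma> a x xhat s
      by unfold_locales
        (use assoc_part[OF x] assoc_with_stationary[OF x] assms(1,2,4) sigma(2) in auto)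
    show ?thesis
      using assoc_with_expanding_Markov[OF x] assoc_with_PA_lambda[OF x] conjugate[OF _ x] by blast
  qed
  have N: "0 < N"
    using assms(2) by (intro Nat.gr0I) (auto simp: interval_partition_def)
  have in_class: "\<exists>C\<in>communicating_classes N \<sigma>. j \<in> C" if "j \<in> {1..N}" for j
    unfolding communicating_classes_iff by (rule bexI[OF _ imageI[OF that]]) simp
  \<comment> \<open>A transient class must contain a node of the chain to contradict the recurrence
    of all nodes.\<close>
  have nonempty: "\<exists>j\<in>{1..N}. j \<in> C" if C: "C \<in> communicating_classes N \<sigma>" for C
  proof -
    obtain i where "i \<in> {1..N}"
      and "C = insert i {j \<in> {1..N}. (i, j) \<in> (arcs N \<sigma>)\<^sup>+ \<and> (j, i) \<in> (arcs N \<sigma>)\<^sup>+}"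
      using C unfolding communicating_classes_iff by (rule imageE)
    then show ?thesis
      by (intro bexI[of _ i]) simp_all
  qed
  have part1: "\<exists>t. associated N \<sigma> a t \<and> (\<forall>t'. associated N \<sigma> a t' \<longrightarrow> t' = t)" if "irreducible_A_star N \<sigma>"
  proof -
    note irred = irreducible_reachable[OF that]
    obtain v where v: "positive_stationary v"
      using positive_stationary_if_irreducible[OF irred N] by blast
    obtain t where "associated N \<sigma> a t"
      using assoc_with_partial_sums[OF v] unfolding associated_iff by blast
    then show ?thesis
      using associated_unique[OF irred] by blast
  qed
  have part2: "infinite {t. associated N \<sigma> a t}"
    if several: "card (communicating_classes N \<sigma>) > 1"
      and rec: "\<forall>C\<in>communicating_classes N \<sigma>. recurrent_class N (A_mat \<sigma> a) C"
  proof -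
    have "recurrent_node N (A_mat \<sigma> a) j" if "j \<in> {1..N}" for j
      using in_class[OF that] rec by (auto simp: recurrent_class_def)
    then show ?thesis
      using not_reachable_if_several_classes[OF several] infinitely_many_associated by metis
  qed
  have part3: "\<not> associated N \<sigma> a t"
    if "\<exists>C\<in>communicating_classes N \<sigma>. transient_class N (A_mat \<sigma> a) C" for t
    using that nonempty recurrent_if_associated unfolding transient_class_def transient_node_def by blast
  have "{t. associated N \<sigma> a t} = {t. associated N \<sigma> a t \<and> expanding_Markov t \<and> t \<in> PA_lambda \<and>
      (linear_Markov_with_partition N xhat s \<or> expanding_Markov s \<longrightarrow> topologically_conjugate t s)}"
    using conj by blast
  with part1 part2 part3 conj show ?thesis
    by (simp only:) blast
qed

end
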